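(* Let $\phi(\mu)$ denote the free divisibility indicator of a probability measure $\mu$ on $\mathbb{R}$. Then: (1) $\phi(\mathbf{t}_q)=1$ for $q \in (1, 2] \cup \bigcup_{n=1}^\infty [2n + \frac{1}{4}, 2n+2]$. (2) $\phi(\mathbf{u}_p)=1$ for $p \in [1,\infty)$.
   Context: Distributions: $\mathbf{t}_q(dx)= \frac{1}{B(\frac{1}{2},q- \frac{1}{2})} \frac{1}{(1+x^2)^q}\,dx$ on $\mathbb{R}$ for $q>\frac12$, and $\mathbf{u}_p(dx)= \frac{1}{4^{p}B(p+\frac{1}{2}, p+\frac{1}{2})}(1-x^2)^{p-\frac{1}{2}}1_{[-1,1]}(x)\,dx$ for $p>-\frac12$, where $B$ is the beta function. For a Borel probability measure $\mu$ on $\mathbb{R}$ let $G_\mu(z)=\int_{\mathbb{R}}\frac{1}{z-x}\mu(dx)$ and $F_\mu(z)=1/G_\mu(z)$ for $z\in\mathbb{C}^+$. On a truncated cone $\Gamma_{\lambda,M}=\{z\in\mathbb{C}^+: \mathrm{Im}\,z>M,\ |\mathrm{Re}\,z|<\lambda\,\mathrm{Im}\,z\}$ with $M$ large, $F_\mu$ has a right compositional inverse $F_\mu^{-1}$, and the Voiculescu transform is $\phi_\mu(z)=F_\mu^{-1}(z)-z$. For $s\ge1$, $\mu^{\boxplus s}$ is the probability measure with $\phi_{\mu^{\boxplus s}}=s\phi_\mu$ on some $\Gamma_{\lambda,M}$ (it always exists). For $t\geq 0$, the Boolean power $\mu^{\uplus t}$ is the probability measure defined by $F_{\mu^{\uplus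 t}}(z) = (1-t)z + tF_\mu(z)$. Let $\mathcal{P}$ be the set of Borel probability measures on $\mathbb{R}$ and, for $t\ge 0$, $\mathbb{B}_t(\mu) := \left(\mu^{\boxplus (1+t)}\right) ^{\uplus\frac{1}{1+t}}$ for $\mu\in\mathcal{P}$. The free divisibility indicator is $\phi(\mu):=\sup \{t \geq 0: \mu \in \mathbb{B}_t(\mathcal{P}) \}\in[0,\infty]$. *)

theory Defs
  imports "HOL-Probability.Probability"
begin

definition t_dist :: "real \<Rightarrow> real measure" where
  "t_dist q = density lborel
     (\<lambda>x. ennreal (1 / Beta (1/2) (q - 1/2) * (1 / (1 + x\<^sup>2) powr q)))"

definition u_dist :: "real \<Rightarrow> real measure" where
  "u_dist p = density lborel
     (\<lambda>x. ennreal (1 / (4 powr p * Beta (p + 1/2) (p + 1/2)) *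
                   (1 - x\<^sup>2) powr (p - 1/2) * indicator {-1..1} x))"

definition cauchy_transform :: "real measure \<Rightarrow> complex \<Rightarrow> complex" where
  "cauchy_transform \<mu> z = (LINT x|\<mu>. 1 / (z - of_real x))"

definition F_transform :: "real measure \<Rightarrow> complex \<Rightarrow> complex" where
  "F_transform \<mu> z = 1 / cauchy_transform \<mu> z"

definition trunc_cone :: "real \<Rightarrow> real \<Rightarrow> complex set" where
  "trunc_cone l M = {z. Im z > 0 \<and> Im z > M \<and> \<bar>Re z\<bar> < l * Im z}"

text \<open>
  A right inverse of the F-transform on a set D is not unique in general: for the symmetric
  Bernoulli law F z = z - 1/z, and both branches of (z + sqrt (z^2 + 4)) / 2 map the upper
  half-plane into itself.  As in Bercovici and Voiculescu, the branch meant is the inverse of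
  the restriction of the F-transform to a truncated cone on which it is injective.  On truncated
  cones this determines the inverse uniquely, since any such inverse g satisfies
  g z / z --> 1 as z tends to infinity in the cone.
\<close>

definition F_right_inverse_on :: "real measure \<Rightarrow> complex set \<Rightarrow> (complex \<Rightarrow> complex) \<Rightarrow> bool" where
  "F_right_inverse_on \<mu> D g \<longleftrightarrow>
     (\<exists>\<alpha>>0. \<exists>\<beta>>0. inj_on (F_transform \<mu>) (trunc_cone \<alpha> \<beta>) \<and>
        g ` D \<subseteq> trunc_cone \<alpha> \<beta> \<and> (\<forall>z\<in>D. F_transform \<mu> (g z) = z))"

definition voiculescu_transform_on ::
    "real measure \<Rightarrow> complex set \<Rightarrow> (complex \<Rightarrow> complex) \<Rightarrow> bool" where
  "voiculescu_transform_on \<mu> D v \<longleftrightarrow>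
     (\<exists>g. F_right_inverse_on \<mu> D g \<and> (\<forall>z\<in>D. v z = g z - z))"

text \<open>
  The free power, the Boolean power and the maps \<open>\<mu> \<mapsto> \<B>\<^sub>t(\<mu>)\<close> are given by their graphs; the
  result \<open>\<nu>\<close> exists for every probability measure \<open>\<mu>\<close> (for \<open>s \<ge> 1\<close>, respectively \<open>t \<ge> 0\<close>) and is
  unique, because a probability measure is determined by its Voiculescu transform on a truncated
  cone and by its F-transform.
\<close>

definition is_free_power :: "real \<Rightarrow> real measure \<Rightarrow> real measure \<Rightarrow> bool" where
  "is_free_power s \<mu> \<nu> \<longleftrightarrow> real_distribution \<nu> \<and>
     (\<exists>l>0. \<exists>M>0. \<exists>v w. voiculescu_transform_on \<mu> (trunc_cone l M) v \<and>
        voiculescu_transform_on \<nu> (trunc_cone l M) w \<and>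
        (\<forall>z\<in>trunc_cone l M. w z = of_real s * v z))"

definition is_boolean_power :: "real \<Rightarrow> real measure \<Rightarrow> real measure \<Rightarrow> bool" where
  "is_boolean_power t \<mu> \<nu> \<longleftrightarrow> real_distribution \<nu> \<and>
     (\<forall>z. Im z > 0 \<longrightarrow> F_transform \<nu> z = (1 - of_real t) * z + of_real t * F_transform \<mu> z)"

definition is_BB :: "real \<Rightarrow> real measure \<Rightarrow> real measure \<Rightarrow> bool" where
  "is_BB t \<mu> \<nu> \<longleftrightarrow> (\<exists>\<rho>. is_free_power (1 + t) \<mu> \<rho> \<and> is_boolean_power (1 / (1 + t)) \<rho> \<nu>)"

definition BB_range :: "real \<Rightarrow> real measure set" where
  "BB_range t = {\<nu>. \<exists>\<mu>. real_distribution \<mu> \<and> is_BB t \<mu> \<nu>}"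

definition free_divisibility_indicator :: "real measure \<Rightarrow> ennreal" where
  "free_divisibility_indicator \<mu> = (SUP t\<in>{t. 0 \<le> t \<and> \<mu> \<in> BB_range t}. ennreal t)"

end

(*
  Write F and G for the F-transform and the Cauchy transform of mu.  If mu is the image of nu under
  the map B_t, then H(z) = (1 + t) z - t F_nu(z) inverts w + t (F(w) - w), so that mu lies in the range
  of B_1 as soon as F has an inverse K on the whole upper half-plane: F_nu(z) = 2 z - K(z) is then the
  F-transform of a probability measure by a Nevanlinna-type realisation theorem.

  Both families have densities c (1 + s x^2)^k with s = 1, k = -q, respectively s = -1, k = p - 1/2.
  Consequently (1 + s z^2) G' = 2 k s z G - s (2 k + 1), which gives the continuation
  Gt = G - 2 pi i c (1 + s z^2)^k of G through the support to the lower half-plane.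

  Lower bound.  Let D be the upper half-plane together with the region where |arg (1 + s z^2)| < pi / (2 |k|).
  On the part of the boundary of D in the lower half-plane (1 + s z^2)^k is purely imaginary, so there
  Im Gt = Im G > 0.  Hence Gt is proper over the lower half-plane, and by the differential equation it
  has no critical points there; so 1 / z lifts through Gt, and the lift is K.

  Upper bound.  Follow the imaginary axis downwards: Gt(H) * (t z - (t - 1) F_nu(z)) = 1 as long as H
  stays in the domain of Gt.  For t > 1 this contradicts the behaviour of Gt at the exit point -i, where
  (x + 1) Gt(i x) is unbounded as x decreases to -1 (q > 1), respectively the regularity of Gt on the whole
  imaginary axis (u_p).
*)
theory Submission
  imports Defs "HOL-Complex_Analysis.Complex_Analysis" "HOL-Real_Asymp.Real_Asymp"
begin

section \<open>Cauchy transforms of probability measures\<close>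

text \<open>Free powers are defined through inverses on truncated cones. For the upper bound the
  functional equation is therefore available only high up at first and has to be spread by the
  identity theorem. Critical points: the differential equation turns Gt'(w) = 0 into w Gt(w) = (2 k
  + 1) / (2 k) > 0. For Im w <= 0 this forces Im Gt(w) >= 0. For Im w > 0 and k > 0 the constant
  exceeds 1, against Im F(w) >= Im w. For the t-laws it is below 1, and w G(w) has to be compared
  with i G(i) instead. Upper bound: t z - (t - 1) F_nu(z) is the value of 1 / Gt at H(z). On the
  imaginary axis write H(i s) = i h and 1 / Gt(H(i s)) = i j. Eliminating F_nu gives (t - 1) h = t j
  - s, while j |Gt(i h)| = 1. If h reaches an exit value c where Gt blows up fast enough, j tends to
  0 there, and the relation bounds (h - c) |Gt(i h)| by t / (t - 1). Hence the growth condition is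
  on (x + 1) Gt(i x), and the bound is lost exactly at t = 1.\<close>

lemma norm_Im_diff_of_real_le: "\<bar>Im z\<bar> \<le> norm (z - of_real x)"
  using abs_Im_le_cmod[of "z - of_real x"] by simp

lemma diff_of_real_neq_0: "Im z \<noteq> 0 \<Longrightarrow> z - of_real x \<noteq> 0"
  using norm_Im_diff_of_real_le[of z x] by auto

lemma norm_inverse_diff_of_real_le:
  "Im z \<noteq> 0 \<Longrightarrow> norm (1 / (z - of_real x)) \<le> 1 / \<bar>Im z\<bar>"
  using norm_Im_diff_of_real_le[of z x] by (simp add: norm_divide frac_le)

context real_distribution
begin

lemma integrable_bounded_complex:
  fixes f :: "real \<Rightarrow> complex"
  assumes "f \<in> borel_measurable borel" "\<And>x. norm (f x) \<le> B"
  shows "integrable M f"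
  by (rule integrable_const_bound[where B=B]) (use assms in auto)

lemma integrable_bounded_real:
  fixes f :: "real \<Rightarrow> real"
  assumes "f \<in> borel_measurable borel" "\<And>x. \<bar>f x\<bar> \<le> B"
  shows "integrable M f"
  by (rule integrable_const_bound[where B=B]) (use assms in auto)

lemma norm_integral_bounded:
  fixes f :: "real \<Rightarrow> complex"
  assumes "f \<in> borel_measurable borel" "\<And>x. norm (f x) \<le> B"
  shows "norm (LINT x|M. f x) \<le> B"
proof -
  have "norm (LINT x|M. f x) \<le> (LINT x|M. norm (f x))" by simp
  also have "\<dots> \<le> (LINT x|M. B)"
    using assms by (intro integral_mono integrable_norm integrable_bounded_complex[of f B]) auto
  also have "\<dots> = B" using prob_space by simp
  finally show ?thesis .
qed

lemma integrable_cauchy_kernel: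
  assumes "Im z \<noteq> 0" shows "integrable M (\<lambda>x. 1 / (z - of_real x))"
  by (rule integrable_bounded_complex[where B="1 / \<bar>Im z\<bar>"])
     (use norm_inverse_diff_of_real_le[OF assms] in auto)

lemma norm_cauchy_kernel2:
  assumes "Im z \<noteq> 0" "Im w \<noteq> 0"
  shows "norm (1 / ((z - of_real x) * (w - of_real x))) \<le> 1 / (\<bar>Im z\<bar> * \<bar>Im w\<bar>)"
proof -
  have "norm (1 / ((z - of_real x) * (w - of_real x)))
      = norm (1 / (z - of_real x)) * norm (1 / (w - of_real x))"
    by (simp add: norm_divide norm_mult)
  also have "\<dots> \<le> (1 / \<bar>Im z\<bar>) * (1 / \<bar>Im w\<bar>)"
    by (intro mult_mono norm_inverse_diff_of_real_le assms) auto
  finally show ?thesis by simp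
qed

lemma integrable_cauchy_kernel2:
  assumes "Im z \<noteq> 0" "Im w \<noteq> 0"
  shows "integrable M (\<lambda>x. 1 / ((z - of_real x) * (w - of_real x)))"
  by (rule integrable_bounded_complex[where B="1 / (\<bar>Im z\<bar> * \<bar>Im w\<bar>)"])
     (use norm_cauchy_kernel2[OF assms] in auto)

text \<open>The integrated resolvent identity. Differentiability of G and injectivity of F on cones
  are both read off from the double-kernel integral.\<close>

lemma cauchy_transform_diff:
  assumes "Im z \<noteq> 0" "Im w \<noteq> 0"
  shows "cauchy_transform M w - cauchy_transform M z
       = (z - w) * (LINT x|M. 1 / ((z - of_real x) * (w - of_real x)))"
proof -
  have "cauchy_transform M w - cauchy_transform M z
      = (LINT x|M. 1 / (w - of_real x) - 1 / (z - of_real x))"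
    unfolding cauchy_transform_def
    by (intro Bochner_Integration.integral_diff[symmetric] integrable_cauchy_kernel assms)
  also have "\<dots> = (LINT x|M. (z - w) * (1 / ((z - of_real x) * (w - of_real x))))"
  proof (rule Bochner_Integration.integral_cong[OF refl])
    fix x
    show "1 / (w - of_real x) - 1 / (z - of_real x)
        = (z - w) * (1 / ((z - of_real x) * (w - of_real x)))"
      using diff_of_real_neq_0[OF assms(1), of x] diff_of_real_neq_0[OF assms(2), of x]
      by (simp add: field_simps)
  qed
  also have "\<dots> = (z - w) * (LINT x|M. 1 / ((z - of_real x) * (w - of_real x)))"
    by (rule integral_mult_right_zero)
  finally show ?thesis .
qed

lemma cauchy_transform_has_field_derivative:
  assumes z: "Im z \<noteq> 0"
  shows "(cauchy_transform M has_field_derivative (LINT x|M. - 1 / (z - of_real x)^2)) (at z)"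
proof -
  define D where "D = (LINT x|M. - 1 / (z - of_real x)^2)"
  define b where "b = \<bar>Im z\<bar>"
  have b: "b > 0" using z by (simp add: b_def)
  \<comment> \<open>Inside radius \<open>b / 2\<close> one still has
    \<open>\<bar>Im w\<bar> \<ge> b / 2\<close>; applying the resolvent identity twice leaves a
    triple kernel of size at most 1 / b^2 times 2 / b.\<close>
  have bound: "norm ((cauchy_transform M w - cauchy_transform M z) / (w - z) - D)
       \<le> norm (w - z) * (2 / b^3)" if w: "w \<noteq> z" "norm (w - z) < b / 2" for w
  proof -
    have "\<bar>Im w - Im z\<bar> < b / 2"
      using w(2) abs_Im_le_cmod[of "w - z"] by simp
    then have Imw: "\<bar>Im w\<bar> \<ge> b / 2" by (simp add: b_def abs_if split: if_splits)
    then have w0: "Im w \<noteq> 0" using b by auto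
    have "(cauchy_transform M w - cauchy_transform M z) / (w - z) - D
       = - (LINT x|M. 1 / ((z - of_real x) * (w - of_real x)))
         + (LINT x|M. 1 / ((z - of_real x) * (z - of_real x)))"
    proof -
      have "D = (LINT x|M. - (1 / ((z - of_real x) * (z - of_real x))))"
        by (simp add: D_def power2_eq_square)
      also have "\<dots> = - (LINT x|M. 1 / ((z - of_real x) * (z - of_real x)))"
        by (rule integral_minus)
      finally have "D = - (LINT x|M. 1 / ((z - of_real x) * (z - of_real x)))" .
      moreover have "(z - w) * A / (w - z) = - A" for A :: complex
        using w(1) by (simp add: field_simps)
      ultimately show ?thesis unfolding cauchy_transform_diff[OF z w0] by simp
    qed
    also have "\<dots> = (LINT x|M. 1 / ((z - of_real x) * (z - of_real x))
                        - 1 / ((z - of_real x) * (w - of_real x)))"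
      using integrable_cauchy_kernel2[OF z z] integrable_cauchy_kernel2[OF z w0] by simp
    also have "\<dots> = (LINT x|M. (w - z) * (1 / ((z - of_real x) * (z - of_real x)) * (1 / (w - of_real x))))"
    proof (rule Bochner_Integration.integral_cong[OF refl])
      fix x
      show "1 / ((z - of_real x) * (z - of_real x)) - 1 / ((z - of_real x) * (w - of_real x))
        = (w - z) * (1 / ((z - of_real x) * (z - of_real x)) * (1 / (w - of_real x)))"
      proof -
        have "1 / (a * a) - 1 / (a * b) = (b - a) * (1 / (a * a) * (1 / b))"
          if "a \<noteq> 0" "b \<noteq> 0" for a b :: complex
          using that by (simp add: field_simps)
        from this[OF diff_of_real_neq_0[OF z, of x] diff_of_real_neq_0[OF w0, of x]]
        show ?thesis by simp
      qed
    qed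
    also have "\<dots> = (w - z) * (LINT x|M. (1 / ((z - of_real x) * (z - of_real x)) * (1 / (w - of_real x))))"
      by (rule integral_mult_right_zero)
    also have "norm \<dots> \<le> norm (w - z) * (1 / (b * b) * (1 / (b / 2)))"
      unfolding norm_mult
    proof (intro mult_left_mono norm_integral_bounded)
      fix x
      have "norm (1 / (w - of_real x)) \<le> 1 / \<bar>Im w\<bar>" by (rule norm_inverse_diff_of_real_le[OF w0])
      also have "\<dots> \<le> 1 / (b / 2)" using Imw b by (intro divide_left_mono) auto
      finally have "norm (1 / (w - of_real x)) \<le> 1 / (b / 2)" .
      then show "norm (1 / ((z - of_real x) * (z - of_real x)) * (1 / (w - of_real x)))
          \<le> 1 / (b * b) * (1 / (b / 2))"
        using norm_cauchy_kernel2[OF z z, of x] b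
        unfolding norm_mult b_def[symmetric] by (intro mult_mono) auto
    qed auto
    finally show ?thesis using b by (simp add: power3_eq_cube)
  qed
  have "((\<lambda>w. (cauchy_transform M w - cauchy_transform M z) / (w - z) - D) \<longlongrightarrow> 0) (at z)"
  proof (rule Lim_null_comparison)
    show "\<forall>\<^sub>F w in at z. norm ((cauchy_transform M w - cauchy_transform M z) / (w - z) - D)
        \<le> norm (w - z) * (2 / b^3)"
      unfolding eventually_at
    proof (intro exI[of _ "b / 2"] conjI ballI impI)
      show "0 < b / 2" using b by simp
      fix w assume "w \<noteq> z \<and> dist w z < b / 2"
      then show "norm ((cauchy_transform M w - cauchy_transform M z) / (w - z) - D)
          \<le> norm (w - z) * (2 / b^3)"
        by (intro bound) (auto simp: dist_norm)
    qed
    show "((\<lambda>w. norm (w - z) * (2 / b^3)) \<longlongrightarrow> 0) (at z)"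
      using b by (auto intro!: tendsto_eq_intros)
  qed
  then show ?thesis
    unfolding has_field_derivative_iff D_def[symmetric] using Lim_null by blast
qed

lemma cauchy_transform_holomorphic: "cauchy_transform M holomorphic_on {z. Im z \<noteq> 0}"
proof (rule holomorphic_onI)
  fix z assume "z \<in> {z. Im z \<noteq> 0}"
  then show "cauchy_transform M field_differentiable at z within {z. Im z \<noteq> 0}"
    using cauchy_transform_has_field_derivative[of z] field_differentiable_at_within
    unfolding field_differentiable_def by (metis has_field_derivative_at_within mem_Collect_eq)
qed

lemma norm_cauchy_transform_le:
  assumes "Im z \<noteq> 0" shows "norm (cauchy_transform M z) \<le> 1 / \<bar>Im z\<bar>"
  unfolding cauchy_transform_def
  by (rule norm_integral_bounded) (use norm_inverse_diff_of_real_le[OF assms] in auto)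

lemma Im_cauchy_kernel: "Im (1 / (z - of_real x)) = - Im z / (norm (z - of_real x))^2"
  by (simp add: Im_divide cmod_def power2_eq_square)

lemma integrable_poisson_kernel:
  assumes "Im z \<noteq> 0" shows "integrable M (\<lambda>x. 1 / (norm (z - of_real x))^2)"
proof -
  have "integrable M (\<lambda>x. norm (1 / ((z - of_real x) * (z - of_real x))))"
    using integrable_cauchy_kernel2[OF assms assms] by (rule integrable_norm)
  then show ?thesis by (simp add: norm_divide norm_mult power2_eq_square)
qed

lemma Im_cauchy_transform:
  assumes "Im z \<noteq> 0"
  shows "Im (cauchy_transform M z) = - Im z * (LINT x|M. 1 / (norm (z - of_real x))^2)"
proof -
  have "Im (cauchy_transform M z) = (LINT x|M. Im (1 / (z - of_real x)))"
    unfolding cauchy_transform_def by (rule integral_Im[OF integrable_cauchy_kernel[OF assms], symmetric])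
  also have "\<dots> = (LINT x|M. - Im z * (1 / (norm (z - of_real x))^2))"
    unfolding Im_cauchy_kernel by simp
  also have "\<dots> = - Im z * (LINT x|M. 1 / (norm (z - of_real x))^2)"
    by (rule integral_mult_right_zero)
  finally show ?thesis .
qed

lemma poisson_integral_pos:
  assumes "Im z \<noteq> 0" shows "(LINT x|M. 1 / (norm (z - of_real x))^2) > 0"
proof -
  have "0 < (LINT x|M. 1 / (norm (z - of_real x))^2)"
  proof (rule expectation_greater)
    show "integrable M (\<lambda>x. 1 / (norm (z - of_real x))^2)" by (rule integrable_poisson_kernel[OF assms])
    show "AE x in M. 0 < 1 / (norm (z - of_real x))^2"
      using diff_of_real_neq_0[OF assms] by simp
  qed
  then show ?thesis .
qed

lemma Im_cauchy_transform_neg: "Im z > 0 \<Longrightarrow> Im (cauchy_transform M z) < 0"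
  using poisson_integral_pos[of z] by (simp add: Im_cauchy_transform mult_neg_pos)

lemma Im_cauchy_transform_pos: "Im z < 0 \<Longrightarrow> Im (cauchy_transform M z) > 0"
  using poisson_integral_pos[of z] by (simp add: Im_cauchy_transform mult_neg_pos)

lemma cauchy_transform_neq_0: "Im z \<noteq> 0 \<Longrightarrow> cauchy_transform M z \<noteq> 0"
  using Im_cauchy_transform_neg[of z] Im_cauchy_transform_pos[of z]
  by (cases "Im z > 0") (auto simp: not_less)

text \<open>Nonnegative variance of the real and of the imaginary part of the kernel. Since Im G is
  -Im z times the right-hand side, this is what gives Im F >= Im z.\<close>

lemma norm_cauchy_transform_sq_le:
  assumes z: "Im z \<noteq> 0"
  shows "(norm (cauchy_transform M z))^2 \<le> (LINT x|M. 1 / (norm (z - of_real x))^2)"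
proof -
  let ?R = "\<lambda>x. Re (1 / (z - of_real x))" and ?I = "\<lambda>x. Im (1 / (z - of_real x))"
  have bR: "\<bar>?R x\<bar> \<le> 1 / \<bar>Im z\<bar>" and bI: "\<bar>?I x\<bar> \<le> 1 / \<bar>Im z\<bar>" for x
    using norm_inverse_diff_of_real_le[OF z, of x] abs_Re_le_cmod[of "1 / (z - of_real x)"]
      abs_Im_le_cmod[of "1 / (z - of_real x)"] by linarith+
  have sq: "\<bar>(?R x)^2\<bar> \<le> (1 / \<bar>Im z\<bar>)^2" "\<bar>(?I x)^2\<bar> \<le> (1 / \<bar>Im z\<bar>)^2" for x
    using bR[of x] bI[of x] power_mono[of "\<bar>?R x\<bar>" "1 / \<bar>Im z\<bar>" 2]
      power_mono[of "\<bar>?I x\<bar>" "1 / \<bar>Im z\<bar>" 2] by auto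
  have iR: "integrable M ?R" "integrable M (\<lambda>x. (?R x)^2)"
    by (rule integrable_bounded_real[OF _ bR], measurable) (rule integrable_bounded_real[OF _ sq(1)], measurable)
  have iI: "integrable M ?I" "integrable M (\<lambda>x. (?I x)^2)"
    by (rule integrable_bounded_real[OF _ bI], measurable) (rule integrable_bounded_real[OF _ sq(2)], measurable)
  have vR: "(LINT x|M. ?R x)^2 \<le> (LINT x|M. (?R x)^2)"
    using variance_eq[OF iR] variance_positive[of ?R] by simp
  have vI: "(LINT x|M. ?I x)^2 \<le> (LINT x|M. (?I x)^2)"
    using variance_eq[OF iI] variance_positive[of ?I] by simp
  have "(norm (cauchy_transform M z))^2 = (Re (cauchy_transform M z))^2 + (Im (cauchy_transform M z))^2"
    by (rule cmod_power2)
  also have "\<dots> = (LINT x|M. ?R x)^2 + (LINT x|M. ?I x)^2"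
    unfolding cauchy_transform_def using integrable_cauchy_kernel[OF z] by (simp add: integral_Re integral_Im)
  also have "\<dots> \<le> (LINT x|M. (?R x)^2) + (LINT x|M. (?I x)^2)"
    using vR vI by simp
  also have "\<dots> = (LINT x|M. (?R x)^2 + (?I x)^2)"
    using iR iI by simp
  also have "\<dots> = (LINT x|M. 1 / (norm (z - of_real x))^2)"
    by (simp add: cmod_power2[symmetric] norm_divide power_divide)
  finally show ?thesis .
qed

lemma Im_F_transform_ge:
  assumes z: "Im z > 0" shows "Im (F_transform M z) \<ge> Im z"
proof -
  let ?P = "LINT x|M. 1 / (norm (z - of_real x))^2"
  let ?G = "cauchy_transform M z"
  have n: "norm ?G > 0" using cauchy_transform_neq_0[of z] z by simp
  have "Im (F_transform M z) = - Im ?G / (norm ?G)^2"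
    unfolding F_transform_def by (simp add: Im_divide cmod_power2)
  also have "\<dots> = Im z * (?P / (norm ?G)^2)"
    using Im_cauchy_transform[of z] z by simp
  also have "\<dots> \<ge> Im z * 1"
    using z n norm_cauchy_transform_sq_le[of z]
    by (intro mult_left_mono) (auto simp: field_simps)
  finally show ?thesis by simp
qed

lemma F_transform_holomorphic: "F_transform M holomorphic_on {z. Im z > 0}"
proof -
  have "cauchy_transform M holomorphic_on {z. Im z > 0}"
    by (rule holomorphic_on_subset[OF cauchy_transform_holomorphic]) auto
  then show ?thesis unfolding F_transform_def
    by (intro holomorphic_intros) (use cauchy_transform_neq_0 in auto)
qed

end

section \<open>Asymptotics, injectivity and inversion of the F-transform in truncated cones\<close>

lemma norm_le_trunc_cone:
  assumes "z \<in> trunc_cone a b" shows "norm z \<le> (1 + a) * Im z"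
proof -
  have "norm z \<le> \<bar>Re z\<bar> + \<bar>Im z\<bar>" by (rule cmod_le)
  then show ?thesis using assms by (simp add: trunc_cone_def algebra_simps)
qed

text \<open>In the cone |z| <= (1 + a) Im z <= (1 + a) |z - x|, and |x| <= |z| + |z - x|. The bound
  is uniform in x and z and acts as the dominating constant below.\<close>

lemma norm_kernel_le_trunc_cone:
  assumes a: "a > 0" and z: "z \<in> trunc_cone a b"
  shows "norm (of_real x / (z - of_real x)) \<le> 2 + a"
proof -
  have Imz: "Im z > 0" using z by (auto simp: trunc_cone_def)
  have ge: "norm (z - of_real x) \<ge> Im z" using norm_Im_diff_of_real_le[of z x] Imz by simp
  have "\<bar>x\<bar> = norm (complex_of_real x)" by simp
  also have "\<dots> \<le> norm z + norm (z - of_real x)"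
    using norm_triangle_ineq4[of z "z - of_real x"] by simp
  also have "\<dots> \<le> (1 + a) * Im z + norm (z - of_real x)"
    using norm_le_trunc_cone[OF z] by simp
  also have "\<dots> \<le> (1 + a) * norm (z - of_real x) + norm (z - of_real x)"
    using ge a by (intro add_mono mult_left_mono) auto
  finally have "\<bar>x\<bar> \<le> (2 + a) * norm (z - of_real x)" by (simp add: algebra_simps)
  then show ?thesis
    using ge Imz a by (simp add: norm_divide divide_le_eq)
qed

lemma trunc_cone_mono: "a \<le> a' \<Longrightarrow> b' \<le> b \<Longrightarrow> trunc_cone a b \<subseteq> trunc_cone a' b'"
proof
  fix z assume *: "a \<le> a'" "b' \<le> b" "z \<in> trunc_cone a b"
  then have "a * Im z \<le> a' * Im z" by (intro mult_right_mono) (auto simp: trunc_cone_def)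
  with * show "z \<in> trunc_cone a' b'" unfolding trunc_cone_def mem_Collect_eq by linarith
qed

lemma ii_in_trunc_cone: "a > 0 \<Longrightarrow> b > 0 \<Longrightarrow> y > b \<Longrightarrow> \<i> * of_real y \<in> trunc_cone a b"
  by (simp add: trunc_cone_def)

text \<open>A perturbation by at most half of Im z at worst halves the height and turns the slope a
  into (a + 1/2) / (1/2) = 2 a + 1.\<close>

lemma trunc_cone_nearby:
  assumes a: "a > 0" and z: "z \<in> trunc_cone a b" and w: "norm (w - z) \<le> e * norm z"
    and e: "e * (1 + a) \<le> 1 / 2"
  shows "w \<in> trunc_cone (2 * a + 1) (b / 2)"
proof -
  have Imz: "Im z > 0" "Im z > b" "\<bar>Re z\<bar> < a * Im z" using z by (auto simp: trunc_cone_def)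
  have d: "norm (w - z) \<le> Im z / 2"
  proof (cases "e \<ge> 0")
    case True
    have "norm (w - z) \<le> e * ((1 + a) * Im z)"
      using w mult_left_mono[OF norm_le_trunc_cone[OF z] True] by linarith
    also have "\<dots> = (e * (1 + a)) * Im z" by simp
    also have "\<dots> \<le> 1 / 2 * Im z" using e Imz by (intro mult_right_mono) auto
    finally show ?thesis by simp
  next
    case False
    then have "e * norm z \<le> 0" by (simp add: mult_nonpos_nonneg)
    then show ?thesis using w Imz by linarith
  qed
  have "\<bar>Im w - Im z\<bar> \<le> Im z / 2" "\<bar>Re w - Re z\<bar> \<le> Im z / 2"
    using d abs_Im_le_cmod[of "w - z"] abs_Re_le_cmod[of "w - z"] by auto
  then have Imw: "Im w \<ge> Im z / 2" and Rew: "\<bar>Re w\<bar> < (a + 1 / 2) * Im z"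
    using Imz by (auto simp: abs_if algebra_simps split: if_splits)
  have "(a + 1 / 2) * Im z = (2 * a + 1) * (Im z / 2)" by (simp add: algebra_simps)
  also have "\<dots> \<le> (2 * a + 1) * Im w" using a Imw by (intro mult_left_mono) auto
  finally show ?thesis using Rew Imw Imz by (auto simp: trunc_cone_def)
qed

context real_distribution
begin

lemma tail_integral_small:
  assumes a: "a > 0" and e: "e > 0"
  obtains b where "b > 0"
    "\<And>z. z \<in> trunc_cone a b \<Longrightarrow> (LINT x|M. norm (of_real x / (z - of_real x))) \<le> e"
proof -
  \<comment> \<open>A majorant free of z: in the cone of height n + 1 the kernel is below
    \<open>\<bar>x\<bar> / (real n + 1)\<close> as well as below \<open>2 + a\<close>, so dominated
    convergence in n gives a bound uniform over the cone.\<close>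
  define g where "g = (\<lambda>(n::nat) x::real. min (2 + a) (\<bar>x\<bar> / (real n + 1)))"
  have gb: "\<bar>g n x\<bar> \<le> 2 + a" for n x using a by (auto simp: g_def)
  have gm [measurable]: "g n \<in> borel_measurable borel" for n unfolding g_def by measurable
  have gi: "integrable M (g n)" for n
    by (rule integrable_bounded_real[OF gm gb])
  have "(\<lambda>n. LINT x|M. g n x) \<longlonglongrightarrow> (LINT x|M. 0)"
  proof (rule integral_dominated_convergence[where w = "\<lambda>_. 2 + a"])
    have "(\<lambda>n. g n x) \<longlonglongrightarrow> 0" for x
    proof (rule tendsto_sandwich[of "\<lambda>_. 0" _ _ "\<lambda>n. \<bar>x\<bar> / (real n + 1)"])
      show "(\<lambda>n. \<bar>x\<bar> / (real n + 1)) \<longlonglongrightarrow> 0"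
        using tendsto_mult_left_zero[OF LIMSEQ_inverse_real_of_nat, of "\<bar>x\<bar>"]
        by (simp add: divide_inverse add.commute mult.commute)
    qed (use a in \<open>auto simp: g_def\<close>)
    then show "AE x in M. (\<lambda>n. g n x) \<longlonglongrightarrow> 0" by simp
    show "AE x in M. norm (g n x) \<le> 2 + a" for n using gb by simp
  qed auto
  then have "(\<lambda>n. LINT x|M. g n x) \<longlonglongrightarrow> 0" by simp
  then have "\<forall>\<^sub>F n in sequentially. (LINT x|M. g n x) < e"
    using e by (rule order_tendstoD)
  then obtain n where n: "(LINT x|M. g n x) < e" unfolding eventually_sequentially by blast
  show ?thesis
  proof (rule that[of "real n + 1"])
    show "real n + 1 > 0" by simp
    fix z assume z: "z \<in> trunc_cone a (real n + 1)"
    then have Imz: "Im z > real n + 1" "Im z > 0" by (auto simp: trunc_cone_def)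
    have le: "norm (of_real x / (z - of_real x)) \<le> g n x" for x
    proof -
      have ge: "norm (z - of_real x) \<ge> Im z" using norm_Im_diff_of_real_le[of z x] Imz by simp
      have 1: "norm (of_real x / (z - of_real x)) \<le> \<bar>x\<bar> / (real n + 1)"
        unfolding norm_divide using ge Imz by (auto intro!: frac_le)
      have "norm (of_real x / (z - of_real x)) \<le> 2 + a"
        by (rule norm_kernel_le_trunc_cone[OF a z])
      with 1 show ?thesis by (simp add: g_def)
    qed
    have "(LINT x|M. norm (of_real x / (z - of_real x))) \<le> (LINT x|M. g n x)"
    proof (rule integral_mono[OF integrable_norm gi le])
      show "integrable M (\<lambda>x. of_real x / (z - of_real x))"
        by (rule integrable_bounded_complex[where B="2 + a"])
           (use le gb in \<open>auto intro: order_trans[OF _ order_trans[OF abs_ge_self gb]]\<close>)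
    qed
    then show "(LINT x|M. norm (of_real x / (z - of_real x))) \<le> e" using n by simp
  qed
qed

lemma kernel_integrable:
  assumes "Im z \<noteq> 0" shows "integrable M (\<lambda>x. of_real x / (z - of_real x))"
proof -
  have "integrable M (\<lambda>x. z * (1 / (z - of_real x)) - 1)"
    by (intro Bochner_Integration.integrable_diff integrable_mult_right integrable_cauchy_kernel assms) simp
  moreover have "z * (1 / (z - of_real x)) - 1 = of_real x / (z - of_real x)" for x
    using diff_of_real_neq_0[OF assms, of x] by (simp add: field_simps)
  ultimately show ?thesis by simp
qed

lemma mult_cauchy_transform_diff_1:
  assumes "Im z \<noteq> 0"
  shows "z * cauchy_transform M z - 1 = (LINT x|M. of_real x / (z - of_real x))"
proof -
  have "(LINT x|M. of_real x / (z - of_real x)) = (LINT x|M. z * (1 / (z - of_real x)) - 1)"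
    using diff_of_real_neq_0[OF assms] by (intro Bochner_Integration.integral_cong) (auto simp: field_simps)
  also have "\<dots> = (LINT x|M. z * (1 / (z - of_real x))) - (LINT x|M. 1)"
    by (intro Bochner_Integration.integral_diff integrable_mult_right integrable_cauchy_kernel assms) simp
  also have "(LINT x|M. z * (1 / (z - of_real x))) = z * cauchy_transform M z"
    unfolding cauchy_transform_def by (rule integral_mult_right_zero)
  finally show ?thesis using prob_space by simp
qed

lemma cauchy_transform_asymp:
  assumes "a > 0" "e > 0"
  obtains b where "b > 0" "\<And>z. z \<in> trunc_cone a b \<Longrightarrow> norm (z * cauchy_transform M z - 1) \<le> e"
proof -
  obtain b where b: "b > 0"
    "\<And>z. z \<in> trunc_cone a b \<Longrightarrow> (LINT x|M. norm (of_real x / (z - of_real x))) \<le> e"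
    using tail_integral_small[OF assms] by metis
  show ?thesis
  proof (rule that[OF b(1)])
    fix z assume z: "z \<in> trunc_cone a b"
    then have "Im z \<noteq> 0" by (auto simp: trunc_cone_def)
    then show "norm (z * cauchy_transform M z - 1) \<le> e"
      unfolding mult_cauchy_transform_diff_1[OF \<open>Im z \<noteq> 0\<close>]
      using order_trans[OF integral_norm_bound b(2)[OF z]] by simp
  qed
qed

lemma F_transform_asymp:
  assumes a: "a > 0" and e: "e > 0"
  obtains b where "b > 0" "\<And>z. z \<in> trunc_cone a b \<Longrightarrow> norm (F_transform M z - z) \<le> e * norm z"
proof -
  define d where "d = min (1 / 2) (e / 2)"
  have d: "d > 0" "d \<le> 1 / 2" "2 * d \<le> e" using e by (auto simp: d_def)
  obtain b where b: "b > 0"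
    "\<And>z. z \<in> trunc_cone a b \<Longrightarrow> norm (z * cauchy_transform M z - 1) \<le> d"
    using cauchy_transform_asymp[OF a d(1)] by metis
  show ?thesis
  proof (rule that[OF b(1)])
    fix z assume z: "z \<in> trunc_cone a b"
    let ?G = "cauchy_transform M z"
    have Imz: "Im z \<noteq> 0" using z by (auto simp: trunc_cone_def)
    have G0: "?G \<noteq> 0" by (rule cauchy_transform_neq_0[OF Imz])
    have bz: "norm (z * ?G - 1) \<le> d" by (rule b(2)[OF z])
    have "1 - norm (z * ?G) \<le> norm (z * ?G - 1)"
      using norm_triangle_ineq3[of "z * ?G" 1] by simp
    then have ge: "norm (z * ?G) \<ge> 1 / 2" using bz d by linarith
    have "F_transform M z - z = - (z * ?G - 1) / (z * ?G) * z"
    proof -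
      have "1 / g - z = - (z * g - 1) / (z * g) * z" if "g \<noteq> 0" "z \<noteq> 0" for g
        using that by (simp add: divide_simps)
      then show ?thesis using G0 Imz by (auto simp: F_transform_def)
    qed
    then have "norm (F_transform M z - z) = norm (z * ?G - 1) / norm (z * ?G) * norm z"
      by (simp add: norm_mult norm_divide norm_minus_commute)
    also have "\<dots> \<le> d / (1 / 2) * norm z"
      using bz ge d by (intro mult_right_mono frac_le) auto
    also have "\<dots> \<le> e * norm z" using d by (intro mult_right_mono) auto
    finally show "norm (F_transform M z - z) \<le> e * norm z" .
  qed
qed

text \<open>By the resolvent identity, equal values at z and w force z = w once the double-kernel
  integral \<open>Q\<close> is nonzero; and \<open>z * w * Q\<close> is close to 1 high up in the
  cone.\<close>

lemma F_transform_inj_on_trunc_cone: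
  assumes a: "a > 0"
  obtains b where "b > 0" "inj_on (F_transform M) (trunc_cone a b)"
proof -
  \<comment> \<open>Chosen so that the final error bound \<open>e * (3 + a) + e\<close> stays below
    1.\<close>
  define e where "e = 1 / (2 * (3 + a))"
  have e: "e > 0" "e * (3 + a) < 1" using a by (auto simp: e_def)
  obtain b where b: "b > 0"
    "\<And>z. z \<in> trunc_cone a b \<Longrightarrow> (LINT x|M. norm (of_real x / (z - of_real x))) \<le> e"
    using tail_integral_small[OF a e(1)] by metis
  show ?thesis
  proof (rule that[OF b(1)], rule inj_onI)
    fix z w assume z: "z \<in> trunc_cone a b" and w: "w \<in> trunc_cone a b"
      and eq: "F_transform M z = F_transform M w"
    have I: "Im z > 0" "Im w > 0" using z w by (auto simp: trunc_cone_def)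
    then have I0: "Im z \<noteq> 0" "Im w \<noteq> 0" by auto
    define k where "k = (\<lambda>u x. complex_of_real x / (u - of_real x))"
    define Q where "Q = (LINT x|M. 1 / ((z - of_real x) * (w - of_real x)))"
    have kb: "norm (k z x) \<le> 2 + a" for x
      unfolding k_def by (rule norm_kernel_le_trunc_cone[OF a z])
    have expand: "z * w * (1 / ((z - of_real x) * (w - of_real x))) = 1 + (k w x + k z x + k z x * k w x)" for x
    proof -
      have *: "1 + k u x = u * (1 / (u - of_real x))" if "Im u \<noteq> 0" for u
        using diff_of_real_neq_0[OF that, of x] by (simp add: k_def field_simps)
      have "z * w * (1 / ((z - of_real x) * (w - of_real x))) = (1 + k z x) * (1 + k w x)"
        unfolding *[OF I0(1)] *[OF I0(2)] by simp
      then show ?thesis by (simp add: algebra_simps)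
    qed
    have ki: "integrable M (k z)" "integrable M (k w)"
      unfolding k_def using I0 by (auto intro: kernel_integrable)
    have km: "k z \<in> borel_measurable borel" "k w \<in> borel_measurable borel"
      unfolding k_def by measurable
    have int: "integrable M (\<lambda>x. z * w * (1 / ((z - of_real x) * (w - of_real x))))"
      using integrable_cauchy_kernel2[OF I0] by (rule integrable_mult_right)
    have int2: "integrable M (\<lambda>x. k w x + k z x + k z x * k w x)"
    proof -
      have "integrable M (\<lambda>x. z * w * (1 / ((z - of_real x) * (w - of_real x))) - 1)"
        using int by simp
      then show ?thesis unfolding expand by simp
    qed
    have "z * w * Q - 1 = (LINT x|M. z * w * (1 / ((z - of_real x) * (w - of_real x)))) - (LINT x|M. 1)"
      unfolding Q_def integral_mult_right_zero using prob_space by simp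
    also have "\<dots> = (LINT x|M. z * w * (1 / ((z - of_real x) * (w - of_real x))) - 1)"
      by (rule Bochner_Integration.integral_diff[symmetric]) (use int in auto)
    also have "\<dots> = (LINT x|M. k w x + k z x + k z x * k w x)"
      unfolding expand by simp
    finally have "norm (z * w * Q - 1) \<le> (LINT x|M. norm (k w x + k z x + k z x * k w x))"
      using integral_norm_bound by metis
    also have "\<dots> \<le> (LINT x|M. norm (k w x) * (3 + a) + norm (k z x))"
    proof (rule integral_mono[OF integrable_norm[OF int2]])
      show "integrable M (\<lambda>x. norm (k w x) * (3 + a) + norm (k z x))"
        using ki by (intro Bochner_Integration.integrable_add integrable_mult_left integrable_norm)
      fix x
      have "norm (k w x + k z x + k z x * k w x) \<le> norm (k w x) + norm (k z x) + norm (k z x) * norm (k w x)"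
        by (metis norm_mult norm_triangle_mono norm_triangle_ineq order_refl)
      also have "\<dots> \<le> norm (k w x) + norm (k z x) + (2 + a) * norm (k w x)"
        using kb by (intro add_left_mono mult_right_mono) auto
      finally show "norm (k w x + k z x + k z x * k w x) \<le> norm (k w x) * (3 + a) + norm (k z x)"
        by (simp add: algebra_simps)
    qed
    also have "\<dots> = (LINT x|M. norm (k w x)) * (3 + a) + (LINT x|M. norm (k z x))"
      using ki by (subst Bochner_Integration.integral_add) auto
    also have "\<dots> \<le> e * (3 + a) + e"
      using b(2)[OF z] b(2)[OF w] a unfolding k_def by (intro add_mono mult_right_mono) auto
    also have "\<dots> < 1" using a by (simp add: e_def field_simps)
    finally have Q0: "Q \<noteq> 0" by auto
    have "cauchy_transform M w - cauchy_transform M z = 0"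
      using eq cauchy_transform_neq_0[OF I0(1)] cauchy_transform_neq_0[OF I0(2)]
      by (simp add: F_transform_def field_simps)
    then show "z = w"
      using cauchy_transform_diff[OF I0] Q0 by (simp add: Q_def)
  qed
qed

text \<open>Brouwer's theorem for w \<mapsto> z - (F w - w) on the ball of radius
  \<open>e * norm z\<close>; its fixed points solve F w = z. The half in \<open>e / 2\<close> pays
  for \<open>norm w \<le> 2 * norm z\<close> on that ball.\<close>

lemma F_transform_right_inverse:
  assumes a: "a > 0" and e: "e > 0" "e * (1 + a) \<le> 1 / 2"
  obtains b where "b > 0"
    "\<And>z. z \<in> trunc_cone a b \<Longrightarrow> \<exists>w. F_transform M w = z \<and> norm (w - z) \<le> e * norm z"
proof -
  have a': "2 * a + 1 > 0" "e / 2 > 0" using a e by auto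
  obtain b where b: "b > 0"
    "\<And>z. z \<in> trunc_cone (2 * a + 1) b \<Longrightarrow> norm (F_transform M z - z) \<le> e / 2 * norm z"
    using F_transform_asymp[OF a'] by metis
  show ?thesis
  proof (rule that[of "2 * b"])
    show "2 * b > 0" using b by simp
    fix z assume z: "z \<in> trunc_cone a (2 * b)"
    let ?S = "cball z (e * norm z)"
    have e1: "e \<le> 1"
    proof -
      have "e * 1 \<le> e * (1 + a)" using e a by (intro mult_left_mono) auto
      then show ?thesis using e(2) by linarith
    qed
    have S: "w \<in> trunc_cone (2 * a + 1) b" if "w \<in> ?S" for w
      using trunc_cone_nearby[OF a z, of w e] that e by (simp add: dist_norm norm_minus_commute)
    obtain w where w: "w \<in> ?S" "z - (F_transform M w - w) = w"
    proof (rule brouwer[of ?S "\<lambda>w. z - (F_transform M w - w)"])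
      have "?S \<subseteq> {z. Im z > 0}" using S by (auto simp: trunc_cone_def)
      then have "continuous_on ?S (F_transform M)"
        using holomorphic_on_imp_continuous_on[OF F_transform_holomorphic] continuous_on_subset by blast
      then show "continuous_on ?S (\<lambda>w. z - (F_transform M w - w))"
        by (intro continuous_intros)
      show "?S \<noteq> {}" using e(1) by (simp add: not_less)
      show "(\<lambda>w. z - (F_transform M w - w)) \<in> ?S \<rightarrow> ?S"
      proof
        fix w assume w: "w \<in> ?S"
        have "norm w \<le> norm z + e * norm z"
          using w norm_triangle_ineq[of z "w - z"] by (simp add: dist_norm norm_minus_commute)
        also have "\<dots> \<le> 2 * norm z" using mult_right_mono[OF e1, of "norm z"] by simp
        finally have "e / 2 * norm w \<le> e / 2 * (2 * norm z)"
          using e by (intro mult_left_mono) auto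
        then show "z - (F_transform M w - w) \<in> ?S"
          using b(2)[OF S[OF w]] by (simp add: dist_norm)
      qed
    qed auto
    then show "\<exists>w. F_transform M w = z \<and> norm (w - z) \<le> e * norm z"
      by (intro exI[of _ w]) (auto simp: dist_norm norm_minus_commute algebra_simps)
  qed
qed

end

section \<open>Realisation of F-transforms\<close>

lemma poisson_kernel_eq:
  fixes z :: complex and x :: real
  assumes "Im z > 0"
  shows "1 / (of_real x - z) - 1 / (of_real x - cnj z) = 2 * \<i> * of_real (Im z / (norm (z - of_real x))^2)"
proof -
  have 1: "of_real x - z \<noteq> 0" "of_real x - cnj z \<noteq> 0"
    using assms by (auto simp: complex_eq_iff)
  have "(norm (z - of_real x))^2 = Re ((of_real x - z) * (of_real x - cnj z))"
    unfolding cmod_power2 by (simp add: algebra_simps power2_eq_square)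
  moreover have "Im ((of_real x - z) * (of_real x - cnj z)) = 0"
    by (simp add: algebra_simps)
  ultimately have 2: "of_real ((norm (z - of_real x))^2) = (of_real x - z) * (of_real x - cnj z)"
    by (simp add: complex_eq_iff)
  have "1 / (of_real x - z) - 1 / (of_real x - cnj z) = (z - cnj z) / ((of_real x - z) * (of_real x - cnj z))"
    using 1 by (simp add: divide_simps)
  also have "z - cnj z = 2 * \<i> * of_real (Im z)" by (simp add: complex_eq_iff)
  finally show ?thesis using 2 by (simp add: of_real_divide)
qed

lemma integrable_poisson_kernel_lborel:
  assumes "Im z > 0" shows "integrable lborel (\<lambda>x. Im z / (norm (z - of_real x))^2)"
proof -
  have i: "integrable lborel (\<lambda>x. inverse (1 + x^2) :: real)"
  proof -
    have "set_integrable lborel (einterval (-\<infinity>) \<infinity>) (\<lambda>x. inverse (1 + x^2) :: real)"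
    proof (rule interval_integral_FTC_nonneg(1)[where F = arctan and A = "-pi/2" and B = "pi/2"])
      show "((arctan \<circ> real_of_ereal) \<longlongrightarrow> - pi / 2) (at_right (-\<infinity>))"
        using tendsto_arctan_at_bot by (simp add: ereal_tendsto_simps)
      show "((arctan \<circ> real_of_ereal) \<longlongrightarrow> pi / 2) (at_left \<infinity>)"
        using tendsto_arctan_at_top by (simp add: ereal_tendsto_simps)
      show "DERIV arctan x :> inverse (1 + x^2)" for x by (rule DERIV_arctan)
      show "isCont (\<lambda>x. inverse (1 + x^2)) x" for x :: real
        by (intro continuous_intros) (auto simp: add_nonneg_eq_0_iff)
    qed auto
    then show ?thesis by (simp add: set_integrable_def einterval_def)
  qed
  define b where "b = Im z" have b: "b > 0" using assms by (simp add: b_def)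
  have "integrable lborel (\<lambda>x. inverse (1 + (- Re z / b + (1 / b) * x)^2) :: real)"
    using i by (rule lborel_integrable_real_affine) (use b in auto)
  then have "integrable lborel (\<lambda>x. (1 / b) * inverse (1 + (- Re z / b + (1 / b) * x)^2))"
    by (rule integrable_mult_right)
  moreover have "(1 / b) * inverse (1 + (- Re z / b + (1 / b) * x)^2) = Im z / (norm (z - of_real x))^2" for x
  proof -
    have "(norm (z - of_real x))^2 = b^2 * (1 + (- Re z / b + (1 / b) * x)^2)"
      using b unfolding cmod_power2 by (simp add: b_def[symmetric] field_simps power2_eq_square)
    moreover have "1 + (- Re z / b + (1 / b) * x)^2 > 0" by (intro add_pos_nonneg) auto
    ultimately show ?thesis using b by (simp add: b_def[symmetric] divide_simps power2_eq_square)
  qed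
  ultimately show ?thesis by simp
qed

text \<open>Cauchy's formula at z minus Cauchy's theorem at the reflected pole \<open>cnj z\<close>,
  over a rectangle with base [-R, R]. The difference of the two kernels is O(1 / R^2) on the other
  three sides, so boundedness of g suffices to discard them as R grows, and the base gives the
  Poisson integral.\<close>

lemma poisson_upper_half_plane:
  fixes g :: "complex \<Rightarrow> complex"
  assumes e: "e > 0" and hol: "g holomorphic_on {z. Im z > - e}"
    and bnd: "\<And>z. Im z \<ge> 0 \<Longrightarrow> norm (g z) \<le> B" and z: "Im z > 0"
  shows "integrable lborel (\<lambda>x. g (of_real x) * of_real (Im z / (norm (z - of_real x))^2))"
    and "(LINT x|lborel. g (of_real x) * of_real (Im z / (norm (z - of_real x))^2)) = pi * g z"
proof -
  let ?P = "\<lambda>x. Im z / (norm (z - complex_of_real x))^2"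
  define h where "h = (\<lambda>x. g (of_real x) * of_real (?P x))"
  define k where "k = (\<lambda>w. g w * (1 / (w - z) - 1 / (w - cnj z)))"
  have B: "B \<ge> 0" using order_trans[OF norm_ge_zero bnd[of 0]] by simp
  have cg: "continuous_on {z. Im z > - e} g"
    by (rule holomorphic_on_imp_continuous_on[OF hol])
  have gx: "continuous_on UNIV (\<lambda>x::real. g (of_real x))"
    by (rule continuous_on_compose2[OF cg]) (use e in \<open>auto intro!: continuous_intros\<close>)
  then have [measurable]: "(\<lambda>x::real. g (of_real x)) \<in> borel_measurable borel"
    by (rule borel_measurable_continuous_onI)
  have hint: "integrable lborel h"
  proof (rule Bochner_Integration.integrable_bound)
    show "integrable lborel (\<lambda>x. B * ?P x)"
      using integrable_poisson_kernel_lborel[OF z] by (rule integrable_mult_right)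
    show "AE x in lborel. norm (h x) \<le> norm (B * ?P x)"
    proof (rule AE_I2)
      fix x
      have "norm (h x) = norm (g (of_real x)) * ?P x"
        unfolding h_def norm_mult norm_of_real using z by simp
      also have "\<dots> \<le> B * ?P x" using bnd[of "of_real x"] z by (intro mult_right_mono) auto
      finally have "norm (h x) \<le> B * ?P x" .
      also have "\<dots> \<le> norm (B * ?P x)" unfolding real_norm_def by (rule abs_ge_self)
      finally show "norm (h x) \<le> norm (B * ?P x)" .
    qed
  qed (simp add: h_def)
  then show "integrable lborel (\<lambda>x. g (of_real x) * of_real (?P x))" by (simp add: h_def)
  have kx: "k (of_real x) = 2 * \<i> * h x" for x
    unfolding k_def h_def poisson_kernel_eq[OF z] by simp
  \<comment> \<open>The half-plane \<open>S\<close> must contain the real axis but not the pole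
    \<open>cnj z\<close>, hence the minimum with \<open>Im z\<close>.\<close>
  define e' where "e' = min e (Im z)"
  have e': "e' > 0" "e' \<le> e" "e' \<le> Im z" using e z by (auto simp: e'_def)
  define S where "S = {w. Im w > - e'}"
  have S: "convex S" "open S"
    unfolding S_def by (auto simp: convex_halfspace_Im_gt open_halfspace_Im_gt)
  have holS: "g holomorphic_on S" by (rule holomorphic_on_subset[OF hol]) (use e' in \<open>auto simp: S_def\<close>)
  have main: "norm (2 * \<i> * integral {-R..R} h - 2 * pi * \<i> * g z) \<le> 96 * B * Im z / R"
    if R: "R > 2 * norm z" "R > 0" for R
  proof -
    define a1 a2 a3 a4 where "a1 = complex_of_real (-R)" "a2 = complex_of_real R"
      "a3 = Complex R R" "a4 = Complex (-R) R"
    note a = this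
    let ?r = "rectpath a1 a3"
    have zin: "z \<in> box a1 a3"
      using R z abs_Re_le_cmod[of z] abs_Im_le_cmod[of z] by (auto simp: in_box_complex_iff a)
    have imr: "path_image ?r = cbox a1 a3 - box a1 a3"
      by (rule path_image_rectpath_cbox_minus_box) (use R in \<open>auto simp: a\<close>)
    have rS: "path_image ?r \<subseteq> S" unfolding imr using e' by (auto simp: in_cbox_complex_iff S_def a)
    have r_eq: "?r = linepath a1 a2 +++ linepath a2 a3 +++ linepath a3 a4 +++ linepath a4 a1"
      unfolding rectpath_def Let_def
      by (simp add: a complex_of_real_def)
    have "((\<lambda>w. g w / (w - z)) has_contour_integral (2 * pi * \<i> * winding_number ?r z * g z)) ?r"
      by (rule Cauchy_integral_formula_convex_simple[OF S(1) holS])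
         (use z e' rS zin imr S in \<open>auto simp: interior_open S_def\<close>)
    then have 1: "((\<lambda>w. g w / (w - z)) has_contour_integral (2 * pi * \<i> * g z)) ?r"
      using winding_number_rectpath[OF zin] by simp
    have 2: "((\<lambda>w. g w / (w - cnj z)) has_contour_integral 0) ?r"
    proof (rule Cauchy_theorem_convex_simple[OF _ S(1)])
      show "(\<lambda>w. g w / (w - cnj z)) holomorphic_on S"
        using e' by (intro holomorphic_intros holS) (auto simp: S_def)
    qed (use rS in auto)
    have 3: "(k has_contour_integral (2 * pi * \<i> * g z)) ?r"
      using has_contour_integral_diff[OF 1 2] by (simp add: k_def algebra_simps)
    then have ci: "k contour_integrable_on ?r" "contour_integral ?r k = 2 * pi * \<i> * g z"
      by (auto simp: contour_integrable_on_def contour_integral_unique)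
    have ci': "k contour_integrable_on linepath a1 a2" "k contour_integrable_on linepath a2 a3"
      "k contour_integrable_on linepath a3 a4" "k contour_integrable_on linepath a4 a1"
      using ci(1) unfolding r_eq by auto
    have sum: "contour_integral (linepath a1 a2) k + (contour_integral (linepath a2 a3) k
        + (contour_integral (linepath a3 a4) k + contour_integral (linepath a4 a1) k)) = 2 * pi * \<i> * g z"
      using ci(2) ci' unfolding r_eq by simp
    have bottom: "contour_integral (linepath a1 a2) k = 2 * \<i> * integral {-R..R} h"
    proof -
      have "contour_integral (linepath a1 a2) k = integral {Re a1..Re a2} (\<lambda>x. k (of_real x))"
        by (rule contour_integral_linepath_Reals_eq) (use R in \<open>auto simp: a\<close>)
      then show ?thesis unfolding kx by (simp add: a)
    qed
    have kb: "norm (k w) \<le> 8 * B * Im z / R^2" if w: "Im w \<ge> 0" "norm w \<ge> R" for w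
    proof -
      have w1: "norm (w - z) \<ge> R / 2" using norm_triangle_ineq2[of w z] w R by simp
      have w2: "norm (w - cnj z) \<ge> R / 2" using norm_triangle_ineq2[of w "cnj z"] w R by simp
      have nz: "w - z \<noteq> 0" "w - cnj z \<noteq> 0" using w1 w2 R by auto
      have "1 / (w - z) - 1 / (w - cnj z) = (z - cnj z) / ((w - z) * (w - cnj z))"
        using nz by (simp add: divide_simps)
      also have "norm \<dots> = 2 * Im z / (norm (w - z) * norm (w - cnj z))"
        using z by (simp add: norm_divide norm_mult complex_diff_cnj)
      also have "\<dots> \<le> 2 * Im z / (R / 2 * (R / 2))"
        using w1 w2 R z by (intro divide_left_mono mult_mono mult_pos_pos) auto
      finally have "norm (1 / (w - z) - 1 / (w - cnj z)) \<le> 8 * Im z / R^2"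
        by (simp add: power2_eq_square)
      then have "norm (k w) \<le> B * (8 * Im z / R^2)"
        unfolding k_def norm_mult using bnd[OF w(1)] B by (intro mult_mono) auto
      then show ?thesis by (simp add: mult_ac)
    qed
    have C0: "8 * B * Im z / R^2 \<ge> 0" using B z by simp
    have s1: "norm (contour_integral (linepath a2 a3) k) \<le> 8 * B * Im z / R^2 * norm (a3 - a2)"
    proof (rule contour_integral_bound_linepath[OF ci'(2) C0 kb])
      fix w assume w: "w \<in> closed_segment a2 a3"
      then obtain u where u: "0 \<le> u" "u \<le> 1" "w = (1 - u) *\<^sub>R a2 + u *\<^sub>R a3"
        by (auto simp: closed_segment_def)
      have "Re w = (1 - u) * R + u * R" "Im w = u * R" using u(3) by (auto simp: a)
      then have "Re w = R" "Im w \<ge> 0" using R u(1,2) by (auto simp: algebra_simps mult_left_le_one_le)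
      then show "Im w \<ge> 0" "norm w \<ge> R" using abs_Re_le_cmod[of w] R by auto
    qed
    have s2: "norm (contour_integral (linepath a3 a4) k) \<le> 8 * B * Im z / R^2 * norm (a4 - a3)"
    proof (rule contour_integral_bound_linepath[OF ci'(3) C0 kb])
      fix w assume w: "w \<in> closed_segment a3 a4"
      then obtain u where u: "0 \<le> u" "u \<le> 1" "w = (1 - u) *\<^sub>R a3 + u *\<^sub>R a4"
        by (auto simp: closed_segment_def)
      have "Im w = (1 - u) * R + u * R" using u(3) by (auto simp: a)
      then have "Im w = R" using R u(1,2) by (auto simp: algebra_simps mult_left_le_one_le)
      then show "Im w \<ge> 0" "norm w \<ge> R" using abs_Im_le_cmod[of w] R by auto
    qed
    have s3: "norm (contour_integral (linepath a4 a1) k) \<le> 8 * B * Im z / R^2 * norm (a1 - a4)"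
    proof (rule contour_integral_bound_linepath[OF ci'(4) C0 kb])
      fix w assume w: "w \<in> closed_segment a4 a1"
      then obtain u where u: "0 \<le> u" "u \<le> 1" "w = (1 - u) *\<^sub>R a4 + u *\<^sub>R a1"
        by (auto simp: closed_segment_def)
      have "Re w = (1 - u) * (- R) + u * (- R)" "Im w = (1 - u) * R" using u(3) by (auto simp: a)
      moreover have "(1 - u) * R \<ge> 0" using R u(1,2) by simp
      ultimately have "Re w = - R" "Im w \<ge> 0" by (simp add: algebra_simps, linarith)
      then show "Im w \<ge> 0" "norm w \<ge> R" using abs_Re_le_cmod[of w] R by auto
    qed
    have len: "norm (a3 - a2) = R" "norm (a4 - a3) = 2 * R" "norm (a1 - a4) = R"
      using R by (auto simp: a cmod_def real_sqrt_mult)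
    have "2 * \<i> * integral {-R..R} h - 2 * pi * \<i> * g z = - (contour_integral (linepath a2 a3) k
        + (contour_integral (linepath a3 a4) k + contour_integral (linepath a4 a1) k))"
      using sum bottom by (simp add: algebra_simps)
    then have "norm (2 * \<i> * integral {-R..R} h - 2 * pi * \<i> * g z)
       \<le> norm (contour_integral (linepath a2 a3) k)
        + (norm (contour_integral (linepath a3 a4) k) + norm (contour_integral (linepath a4 a1) k))"
      by (metis norm_minus_cancel norm_triangle_mono norm_triangle_ineq order_refl)
    also have "\<dots> \<le> 8 * B * Im z / R^2 * R + (8 * B * Im z / R^2 * (2 * R) + 8 * B * Im z / R^2 * R)"
      using s1 s2 s3 unfolding len by linarith
    also have "\<dots> = 32 * B * Im z / R" using R by (simp add: field_simps power2_eq_square)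
    also have "\<dots> \<le> 96 * B * Im z / R" using R B z by (intro divide_right_mono mult_right_mono) auto
    finally show ?thesis .
  qed
  have lim1: "(\<lambda>n. integral {- real n..real n} h) \<longlonglongrightarrow> (LINT x|lborel. h x)"
  proof -
    have "(\<lambda>n. LINT x|lborel. indicator {- real n..real n} x *\<^sub>R h x) \<longlonglongrightarrow> (LINT x|lborel. h x)"
    proof (rule integral_dominated_convergence[where w = "\<lambda>x. norm (h x)"])
      show "AE x in lborel. (\<lambda>n. indicator {- real n..real n} x *\<^sub>R h x) \<longlonglongrightarrow> h x"
      proof (rule AE_I2)
        fix x :: real
        obtain m where m: "\<bar>x\<bar> \<le> real m" using real_arch_simple by blast
        have "\<forall>\<^sub>F n in sequentially. indicator {- real n..real n} x *\<^sub>R h x = h x"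
          unfolding eventually_sequentially
          by (rule exI[of _ m]) (use m in \<open>auto simp: indicator_def\<close>)
        then show "(\<lambda>n. indicator {- real n..real n} x *\<^sub>R h x) \<longlonglongrightarrow> h x"
          by (rule tendsto_eventually)
      qed
    qed (use hint in \<open>auto simp: indicator_def\<close>)
    moreover have "(LINT x|lborel. indicator {- real n..real n} x *\<^sub>R h x) = integral {- real n..real n} h" for n
    proof -
      have "set_integrable lborel {- real n..real n} h"
        unfolding set_integrable_def by (rule integrable_mult_indicator[OF _ hint]) simp
      from set_borel_integral_eq_integral(2)[OF this] show ?thesis
        by (simp add: set_lebesgue_integral_def)
    qed
    ultimately show ?thesis by simp
  qed
  have lim2: "(\<lambda>n. 2 * \<i> * integral {- real n..real n} h - 2 * pi * \<i> * g z) \<longlonglongrightarrow> 0"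
  proof (rule Lim_null_comparison)
    show "\<forall>\<^sub>F n in sequentially. norm (2 * \<i> * integral {- real n..real n} h - 2 * pi * \<i> * g z) \<le> 96 * B * Im z / real n"
    proof -
      obtain m where "real m > 2 * norm z" using reals_Archimedean2 by blast
      then show ?thesis unfolding eventually_sequentially
        by (intro exI[of _ "m + 1"] allI impI main) auto
    qed
    show "(\<lambda>n. 96 * B * Im z / real n) \<longlonglongrightarrow> 0" by (rule lim_const_over_n)
  qed
  have "(\<lambda>n. 2 * \<i> * integral {- real n..real n} h - 2 * pi * \<i> * g z) \<longlonglongrightarrow> 2 * \<i> * (LINT x|lborel. h x) - 2 * pi * \<i> * g z"
    by (intro tendsto_intros lim1)
  from LIMSEQ_unique[OF this lim2] show "(LINT x|lborel. g (of_real x) * of_real (?P x)) = pi * g z"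
    by (simp add: h_def)
qed

lemma holomorphic_Im_0_constant:
  assumes "f holomorphic_on S" "open S" "connected S" "\<And>z. z \<in> S \<Longrightarrow> Im (f z) = 0"
  shows "f constant_on S"
proof (rule ccontr)
  assume "\<not> f constant_on S"
  then have op: "open (f ` S)" using open_mapping_thm[OF assms(1-3,2)] by blast
  have "S \<noteq> {}" using \<open>\<not> f constant_on S\<close> by (auto simp: constant_on_def)
  then obtain z where z: "z \<in> S" by blast
  then obtain d where d: "d > 0" "ball (f z) d \<subseteq> f ` S"
    using op by (meson image_eqI open_contains_ball)
  then have "f z + \<i> * of_real (d / 2) \<in> f ` S" by (auto simp: dist_norm norm_mult)
  then obtain y where "y \<in> S" "f z + \<i> * of_real (d / 2) = f y" by auto
  then show False using assms(4)[of y] assms(4)[OF z] d(1) by (metis Im_complex_of_real add_0 Im_i_times Re_complex_of_real less_irrefl half_gt_zero plus_complex.sel(2))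
qed


text \<open>Stieltjes inversion made elementary: after the shift by i e the function is holomorphic
  across the real axis, so -Im g / pi on the axis is a genuine continuous density, and its Poisson
  integral recovers -Im g.\<close>

lemma cauchy_transform_shifted_representation:
  fixes G :: "complex \<Rightarrow> complex"
  assumes hol: "G holomorphic_on {z. Im z > 0}"
    and neg: "\<And>z. Im z > 0 \<Longrightarrow> Im (G z) \<le> 0"
    and bnd: "\<And>z. Im z > 0 \<Longrightarrow> norm (G z) \<le> 1 / Im z"
    and lim: "((\<lambda>y. \<i> * of_real y * G (\<i> * of_real y)) \<longlongrightarrow> 1) at_top"
    and e: "e > 0"
  obtains \<nu> where "real_distribution \<nu>"
    "\<And>z. Im z > 0 \<Longrightarrow> cauchy_transform \<nu> z = G (z + \<i> * of_real e)"
proof -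
  define g where "g = (\<lambda>z. G (z + \<i> * of_real e))"
  have holg: "g holomorphic_on {z. Im z > - e}"
    unfolding g_def
    by (rule holomorphic_on_compose_gen[OF _ hol, unfolded o_def]) (auto intro!: holomorphic_intros)
  have gb: "norm (g z) \<le> 1 / e" if "Im z \<ge> 0" for z
  proof -
    have "norm (g z) \<le> 1 / (Im z + e)" using bnd[of "z + \<i> * of_real e"] that e by (simp add: g_def)
    also have "\<dots> \<le> 1 / e" using that e by (intro divide_left_mono) auto
    finally show ?thesis .
  qed
  have gb2: "norm (g z) \<le> 1 / Im z" if "Im z > 0" for z
  proof -
    have "norm (g z) \<le> 1 / (Im z + e)" using bnd[of "z + \<i> * of_real e"] that e by (simp add: g_def)
    also have "\<dots> \<le> 1 / Im z" using that e by (intro divide_left_mono) auto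
    finally show ?thesis .
  qed
  define d where "d = (\<lambda>x::real. - Im (g (of_real x)) / pi)"
  have d0: "d x \<ge> 0" for x
    using neg[of "of_real x + \<i> * of_real e"] e by (simp add: d_def g_def divide_nonpos_pos)
  have "continuous_on UNIV (\<lambda>x::real. g (of_real x))"
    by (rule continuous_on_compose2[OF holomorphic_on_imp_continuous_on[OF holg]])
       (use e in \<open>auto intro!: continuous_intros\<close>)
  then have "continuous_on UNIV d" unfolding d_def by (intro continuous_intros) auto
  then have dm [measurable]: "d \<in> borel_measurable borel" by (rule borel_measurable_continuous_onI)
  have pois: "integrable lborel (\<lambda>x. d x * (Im z / (norm (z - of_real x))^2))"
    "(LINT x|lborel. d x * (Im z / (norm (z - of_real x))^2)) = - Im (g z)" if z: "Im z > 0" for z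
  proof -
    have P: "integrable lborel (\<lambda>x. g (of_real x) * of_real (Im z / (norm (z - of_real x))^2))"
      "(LINT x|lborel. g (of_real x) * of_real (Im z / (norm (z - of_real x))^2)) = pi * g z"
      using poisson_upper_half_plane[OF e holg _ z, of "1 / e"] gb by blast+
    have *: "d x * (Im z / (norm (z - of_real x))^2)
      = - (1 / pi) * Im (g (of_real x) * of_real (Im z / (norm (z - of_real x))^2))" for x
      by (simp add: d_def Im_divide_of_real)
    show "integrable lborel (\<lambda>x. d x * (Im z / (norm (z - of_real x))^2))"
      unfolding * by (intro integrable_mult_right integrable_Im P(1))
    have "(LINT x|lborel. d x * (Im z / (norm (z - of_real x))^2))
       = - (1 / pi) * (LINT x|lborel. Im (g (of_real x) * of_real (Im z / (norm (z - of_real x))^2)))"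
      unfolding * by (rule integral_mult_right_zero)
    also have "\<dots> = - (1 / pi) * Im (LINT x|lborel. g (of_real x) * of_real (Im z / (norm (z - of_real x))^2))"
      by (subst integral_Im[OF P(1)]) (rule refl)
    also have "\<dots> = - Im (g z)" unfolding P(2) by simp
    finally show "(LINT x|lborel. d x * (Im z / (norm (z - of_real x))^2)) = - Im (g z)" .
  qed
  have ylim: "((\<lambda>y. y * (- Im (g (\<i> * of_real y)))) \<longlongrightarrow> 1) at_top"
  proof -
    have 1: "((\<lambda>y. \<i> * of_real (y + e) * G (\<i> * of_real (y + e))) \<longlongrightarrow> 1) at_top"
      by (rule filterlim_compose[OF lim])
         (intro filterlim_tendsto_add_at_top[OF tendsto_const, of _ _ e, simplified add.commute[of e]] filterlim_ident)
    have 2: "((\<lambda>y. complex_of_real (y / (y + e))) \<longlongrightarrow> of_real 1) at_top"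
    proof (rule tendsto_of_real)
      show "((\<lambda>y. y / (y + e)) \<longlongrightarrow> 1) at_top" using e by real_asymp
    qed
    have "((\<lambda>y. Re (\<i> * of_real (y + e) * G (\<i> * of_real (y + e)) * complex_of_real (y / (y + e)))) \<longlongrightarrow> Re (1 * of_real 1)) at_top"
      by (intro tendsto_Re tendsto_mult 1 2)
    moreover have "\<forall>\<^sub>F y in at_top. Re (\<i> * of_real (y + e) * G (\<i> * of_real (y + e)) * complex_of_real (y / (y + e)))
        = y * (- Im (g (\<i> * of_real y)))"
      using eventually_gt_at_top[of 0]
    proof eventually_elim
      case (elim y)
      have "\<i> * of_real (y + e) * G (\<i> * of_real (y + e)) * complex_of_real (y / (y + e))
         = of_real ((y + e) * (y / (y + e))) * (\<i> * G (\<i> * of_real (y + e)))"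
        by (simp only: of_real_mult mult_ac)
      also have "(y + e) * (y / (y + e)) = y" using elim e by simp
      finally show ?case by (simp add: g_def distrib_left)
    qed
    ultimately show ?thesis by (auto elim: Lim_transform_eventually)
  qed
  \<comment> \<open>Mass one: y^2 / (x^2 + y^2) increases to 1 with y, and its integral against
    \<open>d\<close> is -y Im g(i y), which tends to 1 by \<open>ylim\<close>.\<close>
  have total: "(\<integral>\<^sup>+x. ennreal (d x) \<partial>lborel) = 1"
  proof -
    define f where "f = (\<lambda>(n::nat) x. ennreal (d x * ((real n + 1)^2 / (x^2 + (real n + 1)^2))))"
    have mono: "s^2 / (x^2 + s^2) \<le> t^2 / (x^2 + t^2)" if "0 < s" "s \<le> t" for s t x :: real
    proof -
      have "s^2 \<le> t^2" using that by (intro power_mono) auto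
      moreover have "x^2 + s^2 > 0" "x^2 + t^2 > 0" using that by (auto intro: add_nonneg_pos)
      moreover have "s^2 * x^2 \<le> t^2 * x^2" using calculation(1) by (rule mult_right_mono) simp
      ultimately show ?thesis by (simp add: divide_simps algebra_simps)
    qed
    have "(\<lambda>n. integral\<^sup>N lborel (f n)) \<longlonglongrightarrow> integral\<^sup>N lborel (\<lambda>x. ennreal (d x))"
    proof (rule nn_integral_LIMSEQ)
      show "incseq f" unfolding f_def incseq_def le_fun_def
        by (intro allI impI ennreal_leI mult_left_mono d0 mono) auto
      show "f n \<in> borel_measurable lborel" for n unfolding f_def by measurable
      fix x
      have "(\<lambda>n. (real n + 1)^2 / (x^2 + (real n + 1)^2)) \<longlonglongrightarrow> 1" by real_asymp
      then have "(\<lambda>n. d x * ((real n + 1)^2 / (x^2 + (real n + 1)^2))) \<longlonglongrightarrow> d x * 1"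
        by (intro tendsto_intros)
      then show "(\<lambda>n. f n x) \<longlonglongrightarrow> ennreal (d x)" unfolding f_def by (intro tendsto_ennrealI) simp
    qed
    moreover have "(\<lambda>n. integral\<^sup>N lborel (f n)) \<longlonglongrightarrow> ennreal 1"
    proof -
      have "integral\<^sup>N lborel (f n) = ennreal ((real n + 1) * (- Im (g (\<i> * of_real (real n + 1)))))" for n
      proof -
        let ?y = "real n + 1" let ?z = "\<i> * complex_of_real ?y"
        have z: "Im ?z > 0" by simp
        have *: "d x * (?y^2 / (x^2 + ?y^2)) = ?y * (d x * (Im ?z / (norm (?z - of_real x))^2))" for x
          unfolding cmod_power2 by (simp add: power2_eq_square)
        have "integral\<^sup>N lborel (f n) = ennreal (LINT x|lborel. ?y * (d x * (Im ?z / (norm (?z - of_real x))^2)))"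
          unfolding f_def *
          by (intro nn_integral_eq_integral integrable_mult_right pois(1)[OF z] AE_I2)
             (use z d0 in \<open>auto intro!: mult_nonneg_nonneg divide_nonneg_nonneg\<close>)
        also have "(LINT x|lborel. ?y * (d x * (Im ?z / (norm (?z - of_real x))^2))) = ?y * (- Im (g ?z))"
          by (simp only: integral_mult_right_zero pois(2)[OF z])
        finally show ?thesis .
      qed
      moreover have "(\<lambda>n. (real n + 1) * (- Im (g (\<i> * of_real (real n + 1))))) \<longlonglongrightarrow> 1"
        by (rule filterlim_compose[OF ylim]) real_asymp
      ultimately show ?thesis by (simp only:) (rule tendsto_ennrealI)
    qed
    ultimately show ?thesis using LIMSEQ_unique by fastforce
  qed
  define \<nu> where "\<nu> = density lborel (\<lambda>x. ennreal (d x))"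
  have rd: "real_distribution \<nu>"
  proof -
    have "prob_space \<nu>"
      by (rule prob_spaceI) (simp add: \<nu>_def emeasure_density total)
    then show ?thesis
      by (simp add: real_distribution_def real_distribution_axioms_def \<nu>_def)
  qed
  interpret \<nu>: real_distribution \<nu> by (rule rd)
  define D where "D = (\<lambda>z. cauchy_transform \<nu> z - g z)"
  \<comment> \<open>Equal imaginary parts leave only a constant; both transforms are bounded by 1 /
    y at i y, which forces it to be 0.\<close>
  have "D constant_on {z. Im z > 0}"
  proof (rule holomorphic_Im_0_constant)
    show "D holomorphic_on {z. Im z > 0}" unfolding D_def
      by (intro holomorphic_intros holomorphic_on_subset[OF \<nu>.cauchy_transform_holomorphic]
            holomorphic_on_subset[OF holg]) (use e in auto)
    show "open {z. Im z > 0}" by (rule open_halfspace_Im_gt)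
    show "connected {z. Im z > 0}" by (intro convex_connected convex_halfspace_Im_gt)
    fix z assume "z \<in> {z. Im z > 0}"
    then have z: "Im z > 0" by simp
    have "Im (cauchy_transform \<nu> z) = - Im z * (LINT x|\<nu>. 1 / (norm (z - of_real x))^2)"
      using z by (simp add: \<nu>.Im_cauchy_transform)
    also have "(LINT x|\<nu>. 1 / (norm (z - of_real x))^2) = (LINT x|lborel. d x *\<^sub>R (1 / (norm (z - of_real x))^2))"
      unfolding \<nu>_def by (rule integral_density) (use d0 in auto)
    also have "- Im z * \<dots> = - (LINT x|lborel. d x * (Im z / (norm (z - of_real x))^2))"
      by (subst integral_mult_right_zero[symmetric], subst integral_minus[symmetric]) (simp add: mult_ac)
    also have "\<dots> = Im (g z)" using pois(2)[OF z] by simp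
    finally show "Im (D z) = 0" by (simp add: D_def)
  qed
  then obtain c where c: "\<And>z. Im z > 0 \<Longrightarrow> D z = c" by (auto simp: constant_on_def)
  have "norm c \<le> 2 / y" if "y > 0" for y
  proof -
    let ?z = "\<i> * complex_of_real y"
    have "norm c \<le> norm (cauchy_transform \<nu> ?z) + norm (g ?z)"
      using c[of ?z] that norm_triangle_ineq4[of "cauchy_transform \<nu> ?z" "g ?z"] by (simp add: D_def)
    also have "\<dots> \<le> 1 / y + 1 / y"
      using \<nu>.norm_cauchy_transform_le[of ?z] gb2[of ?z] that by (intro add_mono) auto
    finally show ?thesis by simp
  qed
  then have c': "norm c * y \<le> 2" if "y > 0" for y using that by (simp add: field_simps)
  have "c = 0"
  proof (rule ccontr)
    assume "c \<noteq> 0"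
    then show False using c'[of "3 / norm c"] by simp
  qed
  then show ?thesis using that[OF rd] c by (simp add: D_def g_def)
qed

text \<open>The shifts of 1 / N by i / (n + 1) are Cauchy transforms; the behaviour of 1 / N along
  the imaginary axis makes their laws tight, and the Cauchy kernel is a bounded continuous test
  function for a weak limit.\<close>

theorem F_transform_realization:
  assumes hol: "N holomorphic_on {z. Im z > 0}"
    and Im: "\<And>z. Im z > 0 \<Longrightarrow> Im (N z) \<ge> Im z"
    and lim: "((\<lambda>y. N (\<i> * of_real y) / (\<i> * of_real y)) \<longlongrightarrow> 1) at_top"
  obtains \<nu> where "real_distribution \<nu>" "\<And>z. Im z > 0 \<Longrightarrow> F_transform \<nu> z = N z"
proof -
  define G where "G = (\<lambda>z. 1 / N z)"
  have N0: "N z \<noteq> 0" if "Im z > 0" for z using Im[OF that] that by auto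
  have holG: "G holomorphic_on {z. Im z > 0}"
    unfolding G_def using N0 by (intro holomorphic_intros hol) auto
  have neg: "Im (G z) \<le> 0" if "Im z > 0" for z
    using Im[OF that] that by (simp add: G_def Im_divide divide_nonpos_nonneg)
  have bnd: "norm (G z) \<le> 1 / Im z" if "Im z > 0" for z
    using Im[OF that] that abs_Im_le_cmod[of "N z"] unfolding G_def norm_divide
    by (auto intro!: frac_le)
  have limG: "((\<lambda>y. \<i> * of_real y * G (\<i> * of_real y)) \<longlongrightarrow> 1) at_top"
    using tendsto_inverse[OF lim] by (simp add: G_def inverse_eq_divide)
  have "\<exists>\<nu>. real_distribution \<nu> \<and> (\<forall>z. Im z > 0 \<longrightarrow> cauchy_transform \<nu> z = G (z + \<i> * of_real (1 / real (Suc n))))" for n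
    by (rule cauchy_transform_shifted_representation[OF holG neg bnd limG, of "1 / real (Suc n)"]) auto
  then obtain \<mu> where \<mu>: "\<And>n. real_distribution (\<mu> n)"
    "\<And>n z. Im z > 0 \<Longrightarrow> cauchy_transform (\<mu> n) z = G (z + \<i> * of_real (1 / real (Suc n)))"
    by metis
  have key: "(LINT x|\<mu> n. y^2 / (x^2 + y^2)) = - y * Im (G (\<i> * of_real (y + 1 / real (Suc n))))" if y: "y > 0" for n y
  proof -
    interpret m: real_distribution "\<mu> n" by (rule \<mu>(1))
    let ?z = "\<i> * complex_of_real y"
    have "(LINT x|\<mu> n. y^2 / (x^2 + y^2)) = (LINT x|\<mu> n. y^2 * (1 / (norm (?z - of_real x))^2))"
      unfolding cmod_power2 by simp
    also have "\<dots> = y^2 * (LINT x|\<mu> n. 1 / (norm (?z - of_real x))^2)" by (rule integral_mult_right_zero)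
    also have "\<dots> = - y * Im (cauchy_transform (\<mu> n) ?z)"
      using y by (simp add: m.Im_cauchy_transform power2_eq_square)
    also have "\<dots> = - y * Im (G (\<i> * of_real (y + 1 / real (Suc n))))"
      using \<mu>(2)[of ?z n] y by (simp add: distrib_left)
    finally show ?thesis .
  qed
  have limI: "((\<lambda>y. - y * Im (G (\<i> * of_real y))) \<longlongrightarrow> 1) at_top"
    using tendsto_Re[OF limG] by simp
  have "tight \<mu>"
    unfolding tight_def
  proof (intro conjI allI impI \<mu>(1))
    fix \<epsilon> :: real assume \<epsilon>: "\<epsilon> > 0"
    \<comment> \<open>The mass of the interval will be at least 1 - 4 \<delta> + 2 \<delta>^2, hence
      the bound \<open>\<epsilon> / 8\<close>.\<close>
    define \<delta> where "\<delta> = min (\<epsilon> / 8) (1/2)"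
    have \<delta>: "\<delta> > 0" "\<delta> \<le> 1/2" "4 * \<delta> < \<epsilon>" using \<epsilon> by (auto simp: \<delta>_def)
    have "\<forall>\<^sub>F y in at_top. - y * Im (G (\<i> * of_real y)) > 1 - \<delta>"
      using limI \<delta> by (intro order_tendstoD) auto
    then obtain y0 where y0: "\<And>y. y \<ge> y0 \<Longrightarrow> - y * Im (G (\<i> * of_real y)) > 1 - \<delta>"
      unfolding eventually_at_top_linorder by blast
    \<comment> \<open>\<open>y \<ge> 1 / \<delta>\<close> makes a shift by s <= 1 harmless: y / (y +
      s) >= 1 - \<delta>.\<close>
    define y where "y = max y0 (1 / \<delta>)"
    have y: "y \<ge> y0" "y \<ge> 1 / \<delta>" "y > 0" using \<delta> by (auto simp: y_def less_max_iff_disj)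
    show "\<exists>a b. a < b \<and> (\<forall>n. measure (\<mu> n) {a<..b} > 1 - \<epsilon>)"
    proof (rule exI[of _ "-y"], rule exI[of _ y], intro conjI allI)
      show "- y < y" using y by simp
      fix n
      interpret m: real_distribution "\<mu> n" by (rule \<mu>(1))
      let ?s = "1 / real (Suc n)"
      have s: "?s > 0" "?s \<le> 1" by auto
      have 1: "- (y + ?s) * Im (G (\<i> * of_real (y + ?s))) > 1 - \<delta>" using y0[of "y + ?s"] y s by linarith
      have "y * \<delta> \<ge> 1" using y \<delta> by (simp add: field_simps)
      then have "(1 - \<delta>) * (y + 1) \<le> y" using \<delta> by (simp add: algebra_simps)
      then have "(1 - \<delta>) * (y + ?s) \<le> y" using s \<delta>
        by (intro order_trans[OF mult_left_mono[of "y + ?s" "y + 1"]]) auto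
      moreover have ys: "y + ?s > 0" using y s by linarith
      ultimately have 2: "y / (y + ?s) \<ge> 1 - \<delta>" by (subst pos_le_divide_eq)
      have "(1 - \<delta>) * (1 - \<delta>) \<le> y / (y + ?s) * (- (y + ?s) * Im (G (\<i> * of_real (y + ?s))))"
        using 1 2 \<delta> y s by (intro mult_mono) auto
      also have "\<dots> = - y * Im (G (\<i> * of_real (y + ?s)))"
      proof -
        have "y / u * (- u * I) = - y * I" if "u > 0" for u I :: real using that by simp
        from this[OF ys] show ?thesis .
      qed
      also have "\<dots> = (LINT x|\<mu> n. y^2 / (x^2 + y^2))" using key[OF y(3), of n] by simp
      \<comment> \<open>The kernel is at most 1 inside the interval and at most 1/2 outside, so a
        kernel integral near 1 leaves little mass outside.\<close>
      also have "\<dots> \<le> (LINT x|\<mu> n. 1 / 2 + 1 / 2 * (indicator {-y<..y} x :: real))"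
      proof (rule integral_mono)
        show "integrable (\<mu> n) (\<lambda>x. y^2 / (x^2 + y^2))"
          by (rule m.integrable_bounded_real[where B=1])
             (use y in \<open>auto simp: divide_le_eq add_nonneg_pos\<close>)
        show "integrable (\<mu> n) (\<lambda>x. 1 / 2 + 1 / 2 * (indicator {-y<..y} x :: real))"
          by (rule m.integrable_bounded_real[where B=1]) (auto simp: indicator_def)
        fix x
        have pos: "x^2 + y^2 > 0" using y by (simp add: add_nonneg_pos)
        show "y^2 / (x^2 + y^2) \<le> 1 / 2 + 1 / 2 * indicator {-y<..y} x"
        proof (cases "x \<in> {-y<..y}")
          case True then show ?thesis using pos by (simp add: divide_le_eq)
        next
          case False
          then have "\<bar>y\<bar> \<le> \<bar>x\<bar>" using y by auto
          then have "y^2 \<le> x^2" using abs_le_square_iff by blast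
          then show ?thesis using False pos by (simp add: divide_le_eq)
        qed
      qed
      also have "\<dots> = 1 / 2 + 1 / 2 * measure (\<mu> n) {-y<..y}"
        
      proof -
        have "integrable (\<mu> n) (\<lambda>x. 1 / 2 * (indicator {-y<..y} x :: real))"
          by (rule m.integrable_bounded_real[where B=1]) (auto simp: indicator_def)
        then show ?thesis using m.prob_space by (subst Bochner_Integration.integral_add) auto
      qed
      finally have "measure (\<mu> n) {-y<..y} \<ge> 2 * ((1 - \<delta>) * (1 - \<delta>)) - 1" by simp
      moreover have "2 * ((1 - \<delta>) * (1 - \<delta>)) - 1 = 1 - 4 * \<delta> + 2 * \<delta> * \<delta>" by (simp add: algebra_simps)
      moreover have "2 * \<delta> * \<delta> \<ge> 0" using \<delta> by simp
      ultimately show "measure (\<mu> n) {-y<..y} > 1 - \<epsilon>" using \<delta> by linarith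
    qed
  qed
  then obtain r \<nu> where r: "strict_mono (r :: nat \<Rightarrow> nat)" and \<nu>: "real_distribution \<nu>" "weak_conv_m (\<mu> \<circ> r) \<nu>"
    using tight_imp_convergent_subsubsequence[of \<mu> id] strict_mono_id by auto
  interpret \<nu>: real_distribution \<nu> by (rule \<nu>(1))
  have "F_transform \<nu> z = N z" if z: "Im z > 0" for z
  proof -
    have "(\<lambda>n. integral\<^sup>L ((\<mu> \<circ> r) n) (\<lambda>x. 1 / (z - of_real x))) \<longlonglongrightarrow> integral\<^sup>L \<nu> (\<lambda>x. 1 / (z - of_real x))"
    proof (rule weak_conv_imp_integral_bdd_continuous_conv[where B="1 / \<bar>Im z\<bar>"])
      show "real_distribution ((\<mu> \<circ> r) n)" for n using \<mu>(1) by simp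
      show "isCont (\<lambda>x. 1 / (z - of_real x)) x" for x
        using diff_of_real_neq_0[of z x] z by (intro continuous_intros) auto
    next
      show "weak_conv_m (\<mu> \<circ> r) \<nu>" by (rule \<nu>(2))
      show "norm (1 / (z - of_real x)) \<le> 1 / \<bar>Im z\<bar>" for x
        using norm_inverse_diff_of_real_le[of z] z by simp
    qed (rule \<nu>(1))
    then have 1: "(\<lambda>n. G (z + \<i> * of_real (1 / real (Suc (r n))))) \<longlonglongrightarrow> cauchy_transform \<nu> z"
      using \<mu>(2)[OF z] by (simp add: cauchy_transform_def)
    have "(\<lambda>n. z + \<i> * of_real (1 / real (Suc (r n)))) \<longlonglongrightarrow> z + \<i> * of_real 0"
    proof (intro tendsto_intros)
      have "(\<lambda>n. 1 / real (Suc n)) \<longlonglongrightarrow> 0" by real_asymp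
      from LIMSEQ_subseq_LIMSEQ[OF this r] show "(\<lambda>n. 1 / real (Suc (r n))) \<longlonglongrightarrow> 0" by (simp add: o_def)
    qed
    moreover have "isCont G z"
      using holomorphic_on_imp_continuous_on[OF holG] z
      by (simp add: continuous_on_eq_continuous_at open_halfspace_Im_gt)
    ultimately have 2: "(\<lambda>n. G (z + \<i> * of_real (1 / real (Suc (r n))))) \<longlonglongrightarrow> G z"
      using isCont_tendsto_compose[of z G] by simp
    from LIMSEQ_unique[OF 1 2] show ?thesis using N0[OF z] by (simp add: F_transform_def G_def)
  qed
  then show ?thesis using that[OF \<nu>(1)] by blast
qed

section \<open>Inverses of F-transforms and the range of \<open>\<B>\<^sub>1\<close>\<close>

text \<open>A proper local homeomorphism into a connected space is a finite covering: the image is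
  open, and relatively closed by properness, while fibres are compact and discrete.\<close>

lemma holomorphic_proper_covering_space:
  fixes g :: "complex \<Rightarrow> complex"
  assumes E: "open E" "E \<noteq> {}" and hol: "g holomorphic_on E"
    and dg: "\<And>w. w \<in> E \<Longrightarrow> deriv g w \<noteq> 0"
    and S: "open S" "connected S" and gE: "g ` E \<subseteq> S"
    and proper: "\<And>L. compact L \<Longrightarrow> L \<subseteq> S \<Longrightarrow> compact {w \<in> E. g w \<in> L}"
  shows "covering_space E g S"
proof -
  have cont: "continuous_on E g" by (rule holomorphic_on_imp_continuous_on[OF hol])
  obtain r where r: "\<And>w. w \<in> E \<Longrightarrow> r w > 0 \<and> ball w (r w) \<subseteq> E \<and> inj_on g (ball w (r w))"
  proof -
    have "\<exists>r>0. ball w r \<subseteq> E \<and> inj_on g (ball w r)" if "w \<in> E" for w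
      using has_complex_derivative_locally_injective[OF hol that E(1) dg[OF that]] by metis
    then show ?thesis using that by metis
  qed
  have open_image: "open (g ` B)" if "open B" "B \<subseteq> E" "inj_on g B" for B
    using open_mapping_thm3[OF holomorphic_on_subset[OF hol that(2)] that(1,3)] .
  have cpt: "compact (g ` {w \<in> E. g w \<in> L})" if "compact L" "L \<subseteq> S" for L
    by (rule compact_continuous_image[OF continuous_on_subset[OF cont] proper[OF that]]) auto
  have onto: "g ` E = S"
  proof -
    have "open (g ` E)"
    proof -
      have "g ` E = (\<Union>w\<in>E. g ` ball w (r w))" using r by force
      also have "open \<dots>" using r by (intro open_UN ballI open_image) auto
      finally show ?thesis .
    qed
    moreover have "open (S - g ` E)"
      unfolding open_contains_ball
    proof
      fix x assume x: "x \<in> S - g ` E"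
      then obtain e where e: "e > 0" "cball x e \<subseteq> S" using S(1) by (meson DiffD1 open_contains_cball)
      let ?C = "g ` {w \<in> E. g w \<in> cball x e}"
      have "open (ball x e - ?C)" using cpt[OF compact_cball e(2)] by (intro open_Diff compact_imp_closed) auto
      moreover have "x \<in> ball x e - ?C" using x e by auto
      ultimately obtain d where "d > 0" "ball x d \<subseteq> ball x e - ?C" by (meson open_contains_ball)
      have "y \<in> S - g ` E" if "y \<in> ball x d" for y
      proof -
        have "y \<in> ball x e" "y \<notin> ?C" using that \<open>ball x d \<subseteq> ball x e - ?C\<close> by blast+
        then have "y \<in> cball x e" "y \<notin> ?C" by auto
        then show ?thesis using e(2) by blast
      qed
      then have "d > 0 \<and> ball x d \<subseteq> S - g ` E" using \<open>d > 0\<close> by blast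
      then show "\<exists>e>0. ball x e \<subseteq> S - g ` E" by blast
    qed
    moreover have "g ` E \<inter> (S - g ` E) \<inter> S = {}" "S \<subseteq> g ` E \<union> (S - g ` E)" "g ` E \<inter> S \<noteq> {}"
      using gE E(2) by auto
    ultimately have "(S - g ` E) \<inter> S = {}" using connectedD[OF S(2)] by blast
    then show ?thesis using gE by auto
  qed
  show ?thesis
    unfolding covering_space_def
  proof (intro conjI ballI cont onto)
    fix x assume x: "x \<in> S"
    define A where "A = {w \<in> E. g w = x}"
    have "compact A" using proper[of "{x}"] x by (simp add: A_def)
    then obtain A' where A': "A' \<subseteq> A" "finite A'" "A \<subseteq> (\<Union>w\<in>A'. ball w (r w))"
      using compactE_image[of A A "\<lambda>w. ball w (r w)"] r by (force simp: A_def)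
    \<comment> \<open>Each injectivity ball meets the fibre only in its centre, so a finite subcover
      already lists the whole fibre.\<close>
    have "A \<subseteq> A'"
    proof
      fix a assume a: "a \<in> A"
      then obtain w where w: "w \<in> A'" "a \<in> ball w (r w)" using A' by blast
      then have "w \<in> E" "g w = g a" using A'(1) a by (auto simp: A_def)
      moreover have "w \<in> ball w (r w)" using r[OF \<open>w \<in> E\<close>] by simp
      ultimately have "w = a" using r[OF \<open>w \<in> E\<close>] w(2) by (meson inj_onD)
      then show "a \<in> A'" using w by simp
    qed
    then have finA: "finite A" using A' finite_subset by blast
    obtain d where d: "d > 0" "\<And>a b. a \<in> A \<Longrightarrow> b \<in> A \<Longrightarrow> dist a b < d \<Longrightarrow> a = b"
      using uniform_discrete_finite_iff[of A] finA unfolding uniform_discrete_def by metis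
    define B where "B = (\<lambda>w. ball w (min (r w) (d / 2)))"
    have B: "open (B w)" "B w \<subseteq> E" "inj_on g (B w)" "w \<in> B w" if "w \<in> A" for w
    proof -
      have "B w \<subseteq> ball w (r w)" by (auto simp: B_def)
      moreover have "w \<in> E" using that by (simp add: A_def)
      ultimately show "open (B w)" "B w \<subseteq> E" "inj_on g (B w)" "w \<in> B w"
        using r[of w] d(1) inj_on_subset[of g "ball w (r w)" "B w"] by (auto simp: B_def)
    qed
    have Bd: "B a \<inter> B b = {}" if "a \<in> A" "b \<in> A" "a \<noteq> b" for a b
    proof (rule ccontr)
      assume "B a \<inter> B b \<noteq> {}"
      then obtain u where "dist a u < d / 2" "dist b u < d / 2" by (auto simp: B_def)
      then have "dist a b < d" using dist_triangle2[of a b u] by linarith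
      then show False using d(2) that by blast
    qed
    obtain e where e: "e > 0" "cball x e \<subseteq> S" using S(1) x by (meson open_contains_cball)
    define C where "C = {w \<in> E. g w \<in> cball x e} - (\<Union>w\<in>A. B w)"
    have "compact C" unfolding C_def by (intro compact_diff proper e open_UN ballI B) auto
    then have gC: "closed (g ` C)"
      by (intro compact_imp_closed compact_continuous_image continuous_on_subset[OF cont]) (auto simp: C_def)
    have xC: "x \<notin> g ` C" using B(4) by (auto simp: C_def A_def)
    \<comment> \<open>The intersection makes every sheet map onto \<open>T\<close>; removing the
      image of the compact remainder \<open>C\<close> keeps the preimage of \<open>T\<close> inside
      the chosen balls.\<close>
    define T where "T = ball x e \<inter> (\<Inter>w\<in>A. g ` B w) - g ` C"
    have "open T" unfolding T_def
      by (intro open_Diff open_Int open_ball open_INT finA ballI open_image B gC)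
    have xT: "x \<in> T" using xC e B(4) by (auto simp: T_def A_def)
    have TS: "T \<subseteq> S" using e by (auto simp: T_def)
    define V where "V = (\<lambda>w. B w \<inter> g -` T)"
    show "\<exists>T. x \<in> T \<and> openin (top_of_set S) T \<and> (\<exists>v. \<Union> v = E \<inter> g -` T \<and> (\<forall>u\<in>v. openin (top_of_set E) u) \<and>
              pairwise disjnt v \<and> (\<forall>u\<in>v. \<exists>q. homeomorphism u T g q))"
    proof (intro exI[of _ T] conjI)
      show "x \<in> T" by (rule xT)
      show "openin (top_of_set S) T" using \<open>open T\<close> TS S(1) by (simp add: openin_open_eq)
      show "\<exists>v. \<Union> v = E \<inter> g -` T \<and> (\<forall>u\<in>v. openin (top_of_set E) u) \<and>
              pairwise disjnt v \<and> (\<forall>u\<in>v. \<exists>q. homeomorphism u T g q)"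
      proof (intro exI[of _ "V ` A"] conjI ballI)
        show "\<Union> (V ` A) = E \<inter> g -` T"
        proof
          show "\<Union> (V ` A) \<subseteq> E \<inter> g -` T" using B(2) by (auto simp: V_def)
          show "E \<inter> g -` T \<subseteq> \<Union> (V ` A)"
          proof
            fix u assume u: "u \<in> E \<inter> g -` T"
            then have "g u \<in> cball x e" "g u \<notin> g ` C" by (auto simp: T_def)
            then have "u \<in> (\<Union>w\<in>A. B w)" using u by (auto simp: C_def)
            then show "u \<in> \<Union> (V ` A)" using u by (auto simp: V_def)
          qed
        qed
        show "pairwise disjnt (V ` A)"
          using Bd by (auto simp: pairwise_def disjnt_def V_def)
        fix u assume "u \<in> V ` A"
        then obtain w where w: "w \<in> A" "u = V w" by blast
        have opu: "open u"
        proof -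
          have "continuous_on (B w) g" using continuous_on_subset[OF cont B(2)[OF w(1)]] .
          then show ?thesis using continuous_open_preimage[OF _ B(1)[OF w(1)] \<open>open T\<close>] by (simp add: w V_def)
        qed
        have uE: "u \<subseteq> E" "inj_on g u" using w B(2,3)[OF w(1)] by (auto simp: V_def inj_on_def)
        show "openin (top_of_set E) u" using opu uE E by (simp add: openin_open_eq)
        have "T \<subseteq> g ` B w" using w by (auto simp: T_def)
        then have gu: "g ` u = T" using w by (auto simp: V_def)
        obtain q where q: "q holomorphic_on (g ` u)" "\<And>z. z \<in> u \<Longrightarrow> q (g z) = z"
          using holomorphic_has_inverse[OF holomorphic_on_subset[OF hol uE(1)] opu uE(2)] by metis
        have "homeomorphism u T g q"
          unfolding homeomorphism_def gu[symmetric]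
          using q holomorphic_on_imp_continuous_on[OF q(1)] continuous_on_subset[OF cont uE(1)] by force
        then show "\<exists>q. homeomorphism u T g q" by blast
      qed
    qed
  qed
qed

text \<open>The lift exists topologically because \<open>U\<close> is simply connected; locally it
  is a holomorphic inverse branch of g composed with f.\<close>

lemma holomorphic_covering_lift:
  fixes g f :: "complex \<Rightarrow> complex"
  assumes cov: "covering_space E g S" and E: "open E" and hol: "g holomorphic_on E"
    and dg: "\<And>w. w \<in> E \<Longrightarrow> deriv g w \<noteq> 0"
    and U: "open U" "simply_connected U" and f: "f holomorphic_on U" "f ` U \<subseteq> S"
    and a: "a \<in> E" "z \<in> U" "f z = g a"
  obtains K where "K holomorphic_on U" "K ` U \<subseteq> E" "K z = a" "\<And>y. y \<in> U \<Longrightarrow> g (K y) = f y"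
proof -
  obtain K where K: "continuous_on U K" "K \<in> U \<rightarrow> E" "K z = a" "\<And>y. y \<in> U \<Longrightarrow> g (K y) = f y"
    using covering_space_lift_strong[OF cov a(1,2) U(2) open_imp_locally_path_connected[OF U(1)]
        holomorphic_on_imp_continuous_on[OF f(1)] _ a(3)] f(2) by blast
  have "K holomorphic_on U"
    unfolding holomorphic_on_open[OF U(1)]
  proof
    fix y assume y: "y \<in> U"
    then have Ky: "K y \<in> E" using K by blast
    obtain r where r: "r > 0" "ball (K y) r \<subseteq> E" "inj_on g (ball (K y) r)"
      using has_complex_derivative_locally_injective[OF hol Ky E dg[OF Ky]] by metis
    obtain q where q: "q holomorphic_on (g ` ball (K y) r)" "\<And>z. z \<in> ball (K y) r \<Longrightarrow> q (g z) = z"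
      using holomorphic_has_inverse[OF holomorphic_on_subset[OF hol r(2)] open_ball r(3)] by metis
    define W where "W = U \<inter> K -` ball (K y) r"
    have W: "open W" unfolding W_def by (rule continuous_open_preimage[OF K(1) U(1) open_ball])
    have "(\<lambda>y. q (f y)) holomorphic_on W"
    proof (rule holomorphic_on_compose_gen[OF _ q(1), unfolded o_def])
      show "f holomorphic_on W" by (rule holomorphic_on_subset[OF f(1)]) (auto simp: W_def)
      show "f ` W \<subseteq> g ` ball (K y) r"
        using K(4) by (force simp: W_def)
    qed
    then have "K holomorphic_on W"
      
    proof (rule holomorphic_transform)
      fix x assume "x \<in> W"
      then show "q (f x) = K x" using q(2)[of "K x"] K(4)[of x] by (simp add: W_def)
    qed
    moreover have "y \<in> W" using y r by (simp add: W_def)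
    ultimately show "\<exists>f'. (K has_field_derivative f') (at y)"
      using W by (auto simp: holomorphic_on_open)
  qed
  then show ?thesis using that[of K] K by blast
qed


section \<open>Free squares and the criterion for membership in \<open>BB_range 1\<close>\<close>

lemma open_upper_halfplane: "open {z. 0 < Im z}"
  by (rule open_halfspace_Im_gt)

lemma connected_upper_halfplane: "connected {z. 0 < Im z}"
  by (intro convex_connected convex_halfspace_Im_gt)

lemma tendsto_div_imaginary:
  fixes h :: "complex \<Rightarrow> complex"
  assumes "\<And>e. e > 0 \<Longrightarrow> \<exists>b>0. \<forall>y>b. norm (h (\<i> * of_real y) - \<i> * of_real y) \<le> e * y"
  shows "((\<lambda>y. h (\<i> * of_real y) / (\<i> * of_real y)) \<longlongrightarrow> 1) at_top"
  unfolding tendsto_iff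
proof (intro allI impI)
  fix e :: real assume e: "e > 0"
  then obtain b where b: "b > 0" "\<And>y. y > b \<Longrightarrow> norm (h (\<i> * of_real y) - \<i> * of_real y) \<le> e / 2 * y"
    using assms[of "e / 2"] by auto
  show "\<forall>\<^sub>F y in at_top. dist (h (\<i> * of_real y) / (\<i> * of_real y)) 1 < e"
    using eventually_gt_at_top[of b]
  proof eventually_elim
    case (elim y)
    let ?z = "\<i> * complex_of_real y"
    have y: "y > 0" using elim b by simp
    then have "h ?z / ?z - 1 = (h ?z - ?z) / ?z" by (simp add: field_simps)
    then have "dist (h ?z / ?z) 1 = norm (h ?z - ?z) / y"
      using y by (simp add: dist_norm norm_divide norm_mult)
    also have "\<dots> \<le> e / 2" using b(2)[OF elim] y by (simp add: divide_le_eq)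
    finally show ?case using e by simp
  qed
qed

text \<open>Doubling the Voiculescu transform means that the inverse branches satisfy g_nu(z) = (z +
  g_rho(z)) / 2; at z = F_rho(w) this is the relation \<open>rel\<close>.\<close>

lemma free_power_2I:
  assumes \<nu>: "real_distribution \<nu>" and \<rho>: "real_distribution \<rho>"
    and rel: "\<And>w. Im w > 0 \<Longrightarrow> F_transform \<nu> ((F_transform \<rho> w + w) / 2) = F_transform \<rho> w"
  shows "is_free_power 2 \<nu> \<rho>"
proof -
  interpret \<nu>: real_distribution \<nu> by (rule \<nu>)
  interpret \<rho>: real_distribution \<rho> by (rule \<rho>)
  obtain b1 where b1: "b1 > 0" "inj_on (F_transform \<rho>) (trunc_cone 3 b1)"
    using \<rho>.F_transform_inj_on_trunc_cone[of 3] by auto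
  obtain b2 where b2: "b2 > 0" "inj_on (F_transform \<nu>) (trunc_cone 3 b2)"
    using \<nu>.F_transform_inj_on_trunc_cone[of 3] by auto
  obtain b where b: "b > 0"
    "\<And>z. z \<in> trunc_cone 1 b \<Longrightarrow> \<exists>w. F_transform \<rho> w = z \<and> norm (w - z) \<le> 1/4 * norm z"
    using \<rho>.F_transform_right_inverse[of 1 "1/4"] by auto
  then obtain g where g: "\<And>z. z \<in> trunc_cone 1 b \<Longrightarrow> F_transform \<rho> (g z) = z \<and> norm (g z - z) \<le> 1/4 * norm z"
    by metis
  \<comment> \<open>\<open>trunc_cone_nearby\<close> with slope 1 yields slope 3 and half the
    height, so \<open>M / 2\<close> has to reach both injectivity heights.\<close>
  define M where "M = max b (2 * max b1 b2)"
  have M: "M > 0" "M \<ge> b" "M / 2 \<ge> b1" "M / 2 \<ge> b2" using b(1) by (auto simp: M_def)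
  have sub: "trunc_cone 1 M \<subseteq> trunc_cone 1 b" using M by (intro trunc_cone_mono) auto
  have g1: "g z \<in> trunc_cone 3 (M / 2)" if "z \<in> trunc_cone 1 M" for z
    using trunc_cone_nearby[of 1 z M "g z" "1/4"] that g[of z] sub by auto
  have g2: "(z + g z) / 2 \<in> trunc_cone 3 (M / 2)" if "z \<in> trunc_cone 1 M" for z
  proof -
    have "(z + g z) / 2 - z = (g z - z) / 2" by (simp add: field_simps)
    then have "norm ((z + g z) / 2 - z) = norm (g z - z) / 2" by (simp only: norm_divide norm_numeral)
    then have "norm ((z + g z) / 2 - z) \<le> 1/8 * norm z" using g[of z] that sub by auto
    then show ?thesis using trunc_cone_nearby[of 1 z M "(z + g z) / 2" "1/8"] that by auto
  qed
  have mono: "trunc_cone 3 (M / 2) \<subseteq> trunc_cone 3 b1" "trunc_cone 3 (M / 2) \<subseteq> trunc_cone 3 b2"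
    using M by (simp_all add: trunc_cone_mono)
  have F\<rho>: "F_right_inverse_on \<rho> (trunc_cone 1 M) g"
    unfolding F_right_inverse_on_def
    by (rule exI[of _ 3], rule conjI, simp, rule exI[of _ b1]) (use b1 g g1 mono sub in auto)
  have F\<nu>: "F_right_inverse_on \<nu> (trunc_cone 1 M) (\<lambda>z. (z + g z) / 2)"
    unfolding F_right_inverse_on_def
  proof (rule exI[of _ 3], rule conjI, simp, rule exI[of _ b2], intro conjI)
    show "(\<lambda>z. (z + g z) / 2) ` trunc_cone 1 M \<subseteq> trunc_cone 3 b2" using g2 mono by auto
    show "\<forall>z\<in>trunc_cone 1 M. F_transform \<nu> ((z + g z) / 2) = z"
    proof
      fix z assume z: "z \<in> trunc_cone 1 M"
      have "Im (g z) > 0" using g1[OF z] by (auto simp: trunc_cone_def)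
      from rel[OF this] show "F_transform \<nu> ((z + g z) / 2) = z" using g[of z] z sub by auto
    qed
  qed (use b2 in auto)
  show ?thesis
    unfolding is_free_power_def voiculescu_transform_on_def
  proof (intro conjI \<rho>)
    show "\<exists>l>0. \<exists>M>0. \<exists>v w. (\<exists>g. F_right_inverse_on \<nu> (trunc_cone l M) g \<and> (\<forall>z\<in>trunc_cone l M. v z = g z - z)) \<and>
        (\<exists>g. F_right_inverse_on \<rho> (trunc_cone l M) g \<and> (\<forall>z\<in>trunc_cone l M. w z = g z - z)) \<and>
        (\<forall>z\<in>trunc_cone l M. w z = complex_of_real 2 * v z)"
      by (rule exI[of _ 1], rule conjI, simp, rule exI[of _ M], rule conjI, rule M(1),
          rule exI[of _ "\<lambda>z. (z + g z) / 2 - z"], rule exI[of _ "\<lambda>z. g z - z"])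
         (use F\<rho> F\<nu> in \<open>auto simp: field_simps\<close>)
  qed
qed

text \<open>
  The inverse of the F-transform is lifted to the whole upper half-plane along the proper local
  homeomorphism \<open>Gt\<close>; the lift \<open>K\<close> automatically satisfies \<open>Im (K z) \<le> Im z\<close>, as \<open>Gt = 1 / F\<close> wherever
  \<open>K\<close> takes values in the upper half-plane.
\<close>

theorem BB_range_1I:
  fixes Gt :: "complex \<Rightarrow> complex"
  assumes \<mu>: "real_distribution \<mu>" and D: "open D" "{z. Im z > 0} \<subseteq> D"
    and hol: "Gt holomorphic_on D"
    and Gt: "\<And>z. Im z > 0 \<Longrightarrow> Gt z = cauchy_transform \<mu> z"
    and dG: "\<And>w. w \<in> D \<Longrightarrow> Im (Gt w) < 0 \<Longrightarrow> deriv Gt w \<noteq> 0"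
    and proper: "\<And>L. compact L \<Longrightarrow> L \<subseteq> {z. Im z < 0} \<Longrightarrow> compact {w \<in> D. Gt w \<in> L}"
  shows "\<mu> \<in> BB_range 1"
proof -
  interpret \<mu>: real_distribution \<mu> by (rule \<mu>)
  let ?F = "F_transform \<mu>" and ?H = "{z. 0 < Im z}" and ?L = "{z. Im z < 0}"
  define E where "E = {w \<in> D. Im (Gt w) < 0}"
  have E_eq: "E = D \<inter> Gt -` ?L" by (auto simp: E_def)
  have E: "open E" unfolding E_eq
    by (rule continuous_open_preimage[OF holomorphic_on_imp_continuous_on[OF hol] D(1) open_halfspace_Im_lt])
  have HE: "?H \<subseteq> E" using D(2) Gt \<mu>.Im_cauchy_transform_neg by (auto simp: E_def)
  have holE: "Gt holomorphic_on E" by (rule holomorphic_on_subset[OF hol]) (auto simp: E_def)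
  have dE: "deriv Gt w \<noteq> 0" if "w \<in> E" for w using dG that by (auto simp: E_def)
  have F_pos: "Im (?F z) > 0" if "Im z > 0" for z using \<mu>.Im_F_transform_ge[OF that] that by linarith
  have cov: "covering_space E Gt ?L"
  proof (rule holomorphic_proper_covering_space[OF E _ holE dE])
    show "E \<noteq> {}" using subsetD[OF HE, of "\<i>"] by auto
    show "connected ?L" by (intro convex_connected convex_halfspace_Im_lt)
    show "Gt ` E \<subseteq> ?L" by (auto simp: E_def)
    fix L assume L: "compact L" "L \<subseteq> ?L"
    have "{w \<in> E. Gt w \<in> L} = {w \<in> D. Gt w \<in> L}" using L(2) by (auto simp: E_def)
    then show "compact {w \<in> E. Gt w \<in> L}" using proper[OF L] by simp
  qed (auto simp: open_halfspace_Im_lt)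
  obtain K where K: "K holomorphic_on ?H" "K ` ?H \<subseteq> E" "K (?F \<i>) = \<i>" "\<And>z. z \<in> ?H \<Longrightarrow> Gt (K z) = 1 / z"
  proof (rule holomorphic_covering_lift[OF cov E holE dE open_upper_halfplane])
    show "simply_connected ?H" by (intro convex_imp_simply_connected convex_halfspace_Im_gt)
    show "(\<lambda>z. 1 / z) holomorphic_on ?H" by (intro holomorphic_intros) auto
    show "(\<lambda>z. 1 / z) ` ?H \<subseteq> ?L" by (auto simp: Im_divide divide_neg_pos add_nonneg_pos)
    show "\<i> \<in> E" using HE by auto
    show "?F \<i> \<in> ?H" using F_pos by simp
    show "1 / ?F \<i> = Gt \<i>" using Gt by (simp add: F_transform_def)
  qed auto
  \<comment> \<open>The composition of \<open>K\<close> with F and the identity are two lifts that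
    agree at i: they coincide near i by local injectivity of \<open>Gt\<close>, and everywhere by
    the identity theorem.\<close>
  have KF: "K (?F w) = w" if "Im w > 0" for w
  proof -
    have iE: "\<i> \<in> E" using HE by auto
    obtain r where r: "r > 0" "ball \<i> r \<subseteq> E" "inj_on Gt (ball \<i> r)"
      using has_complex_derivative_locally_injective[OF holE iE E dE[OF iE]] by metis
    have holKF: "(\<lambda>w. K (?F w)) holomorphic_on ?H"
      by (rule holomorphic_on_compose_gen[OF \<mu>.F_transform_holomorphic K(1), unfolded o_def]) (use F_pos in auto)
    define W where "W = ?H \<inter> (\<lambda>w. K (?F w)) -` ball \<i> r"
    have W: "open W" unfolding W_def
      by (rule continuous_open_preimage[OF holomorphic_on_imp_continuous_on[OF holKF] open_upper_halfplane open_ball])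
    show ?thesis
    proof (rule analytic_continuation_open[of "W \<inter> ball \<i> r" ?H "\<lambda>w. K (?F w)" "\<lambda>w. w" w])
      show "open (W \<inter> ball \<i> r)" using W by auto
      have "\<i> \<in> W \<inter> ball \<i> r" using r K(3) by (auto simp: W_def)
      then show "W \<inter> ball \<i> r \<noteq> {}" by blast
      show "W \<inter> ball \<i> r \<subseteq> ?H" by (auto simp: W_def)
      fix u assume u: "u \<in> W \<inter> ball \<i> r"
      then have Imu: "Im u > 0" by (auto simp: W_def)
      have "Gt (K (?F u)) = Gt u" using K(4)[of "?F u"] F_pos[OF Imu] Gt[OF Imu] by (simp add: F_transform_def)
      then show "K (?F u) = u" using r(3) u by (auto simp: W_def dest: inj_onD)
    qed (use holKF that open_upper_halfplane connected_upper_halfplane in auto)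
  qed
  have ImK: "Im (K z) \<le> Im z" if z: "Im z > 0" for z
  proof (cases "Im (K z) > 0")
    case True
    then have "?F (K z) = z" using K(4)[of z] z Gt[of "K z"] by (simp add: F_transform_def)
    then show ?thesis using \<mu>.Im_F_transform_ge[OF True] by simp
  qed (use z in auto)
  have limK: "((\<lambda>y. K (\<i> * of_real y) / (\<i> * of_real y)) \<longlongrightarrow> 1) at_top"
  proof (rule tendsto_div_imaginary)
    fix e :: real assume e: "e > 0"
    define d where "d = min (1/4) e"
    have d: "d > 0" "d \<le> 1/4" "d \<le> e" using e by (auto simp: d_def)
    obtain b where b: "b > 0"
      "\<And>z. z \<in> trunc_cone 1 b \<Longrightarrow> \<exists>w. ?F w = z \<and> norm (w - z) \<le> d * norm z"
      using \<mu>.F_transform_right_inverse[of 1 d] d by auto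
    have "norm (K (\<i> * of_real y) - \<i> * of_real y) \<le> e * y" if y: "y > b" for y
    proof -
      let ?z = "\<i> * complex_of_real y"
      have z: "?z \<in> trunc_cone 1 b" using ii_in_trunc_cone[of 1 b y] b y by simp
      then obtain w where w: "?F w = ?z" "norm (w - ?z) \<le> d * norm ?z" using b by blast
      have "Im w > 0" using trunc_cone_nearby[OF _ z w(2)] d by (auto simp: trunc_cone_def)
      then have Kw: "K ?z = w" using KF[of w] w(1) by simp
      have "norm (w - ?z) \<le> d * y" using w(2) b(1) y by (simp add: norm_mult)
      also have "\<dots> \<le> e * y" using d b(1) y by (intro mult_right_mono) auto
      finally show ?thesis unfolding Kw .
    qed
    then show "\<exists>b>0. \<forall>y>b. norm (K (\<i> * of_real y) - \<i> * of_real y) \<le> e * y" using b(1) by blast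
  qed
  have limF: "((\<lambda>y. ?F (\<i> * of_real y) / (\<i> * of_real y)) \<longlongrightarrow> 1) at_top"
  proof (rule tendsto_div_imaginary)
    fix e :: real assume e: "e > 0"
    obtain b where b: "b > 0" "\<And>z. z \<in> trunc_cone 1 b \<Longrightarrow> norm (?F z - z) \<le> e * norm z"
      using \<mu>.F_transform_asymp[of 1 e] e by auto
    have "norm (?F (\<i> * of_real y) - \<i> * of_real y) \<le> e * y" if y: "y > b" for y
      using b(2)[of "\<i> * of_real y"] ii_in_trunc_cone[of 1 b y] b(1) y by (simp add: norm_mult)
    then show "\<exists>b>0. \<forall>y>b. norm (?F (\<i> * of_real y) - \<i> * of_real y) \<le> e * y" using b(1) by blast
  qed
  \<comment> \<open>Solving K(z) = (1 + t) z - t F_nu(z) at t = 1 dictates this choice;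
    \<open>ImK\<close> is exactly the lower bound on imaginary parts that the realisation theorem
    asks for.\<close>
  obtain \<nu> where \<nu>: "real_distribution \<nu>" "\<And>z. Im z > 0 \<Longrightarrow> F_transform \<nu> z = 2 * z - K z"
  proof (rule F_transform_realization[of "\<lambda>z. 2 * z - K z"])
    show "(\<lambda>z. 2 * z - K z) holomorphic_on ?H" by (intro holomorphic_intros K(1))
    show "Im z \<le> Im (2 * z - K z)" if "0 < Im z" for z using ImK[OF that] by simp
    have "((\<lambda>y. 2 - K (\<i> * of_real y) / (\<i> * of_real y)) \<longlongrightarrow> 2 - 1) at_top" by (intro tendsto_intros limK)
    moreover have "\<forall>\<^sub>F y in at_top. 2 - K (\<i> * of_real y) / (\<i> * of_real y) = (2 * (\<i> * of_real y) - K (\<i> * of_real y)) / (\<i> * of_real y)"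
      using eventually_gt_at_top[of "0::real"] by eventually_elim (simp add: field_simps)
    ultimately show "((\<lambda>y. (2 * (\<i> * of_real y) - K (\<i> * of_real y)) / (\<i> * of_real y)) \<longlongrightarrow> 1) at_top"
      by (auto elim: Lim_transform_eventually)
  qed auto
  \<comment> \<open>The Boolean square of \<open>\<mu>\<close>, so that the Boolean power 1/2
    returns \<open>\<mu>\<close>.\<close>
  obtain \<rho> where \<rho>: "real_distribution \<rho>" "\<And>z. Im z > 0 \<Longrightarrow> F_transform \<rho> z = 2 * ?F z - z"
  proof (rule F_transform_realization[of "\<lambda>z. 2 * ?F z - z"])
    show "(\<lambda>z. 2 * ?F z - z) holomorphic_on ?H" by (intro holomorphic_intros \<mu>.F_transform_holomorphic)
    show "Im z \<le> Im (2 * ?F z - z)" if "0 < Im z" for z using \<mu>.Im_F_transform_ge[OF that] by simp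
    have "((\<lambda>y. 2 * (?F (\<i> * of_real y) / (\<i> * of_real y)) - 1) \<longlongrightarrow> 2 * 1 - 1) at_top" by (intro tendsto_intros limF)
    moreover have "\<forall>\<^sub>F y in at_top. 2 * (?F (\<i> * of_real y) / (\<i> * of_real y)) - 1 = (2 * ?F (\<i> * of_real y) - \<i> * of_real y) / (\<i> * of_real y)"
      using eventually_gt_at_top[of "0::real"] by eventually_elim (simp add: field_simps)
    ultimately show "((\<lambda>y. (2 * ?F (\<i> * of_real y) - \<i> * of_real y) / (\<i> * of_real y)) \<longlongrightarrow> 1) at_top"
      by (auto elim: Lim_transform_eventually)
  qed auto
  have "is_free_power 2 \<nu> \<rho>"
  proof (rule free_power_2I[OF \<nu>(1) \<rho>(1)])
    fix w assume w: "Im w > 0"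
    have "(F_transform \<rho> w + w) / 2 = ?F w" using \<rho>(2)[OF w] by simp
    then show "F_transform \<nu> ((F_transform \<rho> w + w) / 2) = F_transform \<rho> w"
      using \<nu>(2)[OF F_pos[OF w]] KF[OF w] \<rho>(2)[OF w] by simp
  qed
  moreover have "is_boolean_power (1 / 2) \<rho> \<mu>"
    unfolding is_boolean_power_def using \<rho>(2) \<mu> by (simp add: field_simps)
  ultimately show ?thesis
    unfolding BB_range_def is_BB_def using \<nu>(1) by auto
qed

section \<open>An obstruction to membership in the range of \<open>\<B>\<^sub>t\<close>\<close>

lemma (in real_distribution) cauchy_transform_cnj:
  "cauchy_transform M (cnj z) = cnj (cauchy_transform M z)"
  proof -
  have "cauchy_transform M (cnj z) = (LINT x|M. cnj (1 / (z - of_real x)))"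
    unfolding cauchy_transform_def by (simp del: Bochner_Integration.integral_cnj)
  also have "\<dots> = cnj (cauchy_transform M z)"
    unfolding cauchy_transform_def by (rule Bochner_Integration.integral_cnj)
  finally show ?thesis .
qed

lemma islimpt_imaginary_ray: "s > s0 \<Longrightarrow> (\<i> * complex_of_real s) islimpt ((\<lambda>s. \<i> * of_real s) ` {s0..})"
  unfolding islimpt_approachable
proof (intro allI impI)
  fix e :: real assume *: "s > s0" "e > 0"
  have "dist (\<i> * complex_of_real (s + e / 2)) (\<i> * of_real s) = e / 2"
  proof -
    have "\<i> * complex_of_real (s + e / 2) - \<i> * of_real s = \<i> * of_real (e / 2)" by (simp add: algebra_simps)
    then show ?thesis using *(2) unfolding dist_norm by (simp only: norm_mult norm_of_real) simp
  qed
  then show "\<exists>x'\<in>(\<lambda>s. \<i> * of_real s) ` {s0..}. x' \<noteq> \<i> * complex_of_real s \<and> dist x' (\<i> * of_real s) < e"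
    using * by (intro bexI[of _ "\<i> * complex_of_real (s + e / 2)"] imageI) auto
qed

text \<open>
  If \<open>\<mu>\<close> is the image of \<open>\<nu>\<close> under \<open>\<B>\<^sub>t\<close>, then \<open>H z = (1 + t) z - t F\<^sub>\<nu> z\<close> and
  \<open>J z = t z - (t - 1) F\<^sub>\<nu> z\<close> satisfy \<open>J \<cdot> (G \<circ> H) = 1\<close> for large imaginary arguments, hence as long as \<open>H\<close>
  stays in the domain of the continuation of \<open>G\<close>; following the imaginary axis downwards leads to a
  contradiction when \<open>t > 1\<close>.
\<close>

lemma BB_range_imaginary_axis:
  assumes \<mu>: "real_distribution \<mu>" and t: "t > 1" and range: "\<mu> \<in> BB_range t"
    and sym: "\<And>y. y > 0 \<Longrightarrow> Re (cauchy_transform \<mu> (\<i> * of_real y)) = 0"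
  obtains \<nu> s0 f where "real_distribution \<nu>" "s0 > 0" "continuous_on {0<..} f"
    "\<And>s. s > 0 \<Longrightarrow> F_transform \<nu> (\<i> * of_real s) = \<i> * of_real (f s)"
    "\<And>s. s > 0 \<Longrightarrow> f s > 0"
    "\<And>s. s \<ge> s0 \<Longrightarrow> (1 + t) * s - t * f s > 0"
    "\<And>s. s \<ge> s0 \<Longrightarrow> t * s - (t - 1) * f s > 0"
    "\<And>s. s \<ge> s0 \<Longrightarrow> \<i> * of_real (t * s - (t - 1) * f s)
        * cauchy_transform \<mu> (\<i> * of_real ((1 + t) * s - t * f s)) = 1"
proof -
  interpret \<mu>: real_distribution \<mu> by (rule \<mu>)
  obtain \<nu> \<rho> where \<nu>: "real_distribution \<nu>" and fp: "is_free_power (1 + t) \<nu> \<rho>"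
    and bp: "is_boolean_power (1 / (1 + t)) \<rho> \<mu>"
    using range by (auto simp: BB_range_def is_BB_def)
  interpret \<nu>: real_distribution \<nu> by (rule \<nu>)
  have \<rho>: "real_distribution \<rho>" using fp by (auto simp: is_free_power_def)
  interpret \<rho>: real_distribution \<rho> by (rule \<rho>)
  have t0: "complex_of_real t + 1 \<noteq> 0"
    using t by (metis add_pos_pos less_numeral_extra(1) less_trans of_real_1 of_real_add of_real_eq_0_iff less_irrefl)
  have F\<rho>: "F_transform \<rho> z = (1 + of_real t) * F_transform \<mu> z - of_real t * z" if "Im z > 0" for z
  proof -
    have "F_transform \<mu> z = (1 - of_real (1 / (1 + t))) * z + of_real (1 / (1 + t)) * F_transform \<rho> z"
      using bp that by (auto simp: is_boolean_power_def)
    then show ?thesis using t0 by (simp add: field_simps)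
  qed
  define f\<mu> where "f\<mu> = (\<lambda>y. Im (F_transform \<mu> (\<i> * of_real y)))"
  have F\<mu>: "F_transform \<mu> (\<i> * of_real y) = \<i> * of_real (f\<mu> y)" "f\<mu> y \<ge> y" if y: "y > 0" for y
  proof -
    show "f\<mu> y \<ge> y" using \<mu>.Im_F_transform_ge[of "\<i> * of_real y"] y by (simp add: f\<mu>_def)
    have "Re (F_transform \<mu> (\<i> * of_real y)) = 0"
      using sym[OF y] by (simp add: F_transform_def Re_divide)
    then show "F_transform \<mu> (\<i> * of_real y) = \<i> * of_real (f\<mu> y)"
      by (simp add: complex_eq_iff f\<mu>_def)
  qed
  \<comment> \<open>\<open>r\<close> is F_rho on the imaginary axis, solved from the Boolean
    relation; \<open>\<theta>\<close> is the point w + t (F w - w) at which F_nu takes that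
    value.\<close>
  define r where "r = (\<lambda>y. (1 + t) * f\<mu> y - t * y)"
  define \<theta> where "\<theta> = (\<lambda>y. t * f\<mu> y + (1 - t) * y)"
  have r: "F_transform \<rho> (\<i> * of_real y) = \<i> * of_real (r y)" if y: "y > 0" for y
    using F\<rho>[of "\<i> * of_real y"] y F\<mu>(1)[OF y] by (simp add: r_def algebra_simps)
  have r_ge: "r y \<ge> y" if y: "y > 0" for y
    using mult_left_mono[OF F\<mu>(2)[OF y], of "1 + t"] t by (simp add: r_def algebra_simps)
  have \<theta>_ge: "\<theta> y \<ge> y" if y: "y > 0" for y
    using mult_left_mono[OF F\<mu>(2)[OF y], of t] t by (simp add: \<theta>_def algebra_simps)
  obtain l M g1 g2 where lM: "l > 0" "M > 0"
    and g1: "F_right_inverse_on \<nu> (trunc_cone l M) g1" and g2: "F_right_inverse_on \<rho> (trunc_cone l M) g2"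
    and rel: "\<And>z. z \<in> trunc_cone l M \<Longrightarrow> g2 z - z = of_real (1 + t) * (g1 z - z)"
    using fp unfolding is_free_power_def voiculescu_transform_on_def by metis
  obtain a b where ab: "a > 0" "b > 0" and inj: "inj_on (F_transform \<rho>) (trunc_cone a b)"
    and g2': "g2 ` trunc_cone l M \<subseteq> trunc_cone a b" "\<And>z. z \<in> trunc_cone l M \<Longrightarrow> F_transform \<rho> (g2 z) = z"
    using g2 unfolding F_right_inverse_on_def by blast
  have g1': "\<And>z. z \<in> trunc_cone l M \<Longrightarrow> F_transform \<nu> (g1 z) = z"
    using g1 unfolding F_right_inverse_on_def by blast
  define y0 where "y0 = max b M + 1"
  have y0: "y0 > 0" using ab by (simp add: y0_def)
  have \<theta>: "F_transform \<nu> (\<i> * of_real (\<theta> y)) = \<i> * of_real (r y)" if y: "y \<ge> y0" for y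
  proof -
    have y': "y > b" "y > M" "y > 0" using y ab by (auto simp: y0_def)
    define z where "z = \<i> * complex_of_real (r y)"
    have z: "z \<in> trunc_cone l M" using r_ge[OF y'(3)] y' lM by (auto simp: z_def intro!: ii_in_trunc_cone)
    have "F_transform \<rho> (g2 z) = F_transform \<rho> (\<i> * of_real y)"
      using g2'(2)[OF z] r[OF y'(3)] by (simp add: z_def)
    \<comment> \<open>Both points lie in a cone on which F_rho is injective; this selects the branch
      of the inverse.\<close>
    then have "g2 z = \<i> * of_real y"
      using inj g2'(1) z ii_in_trunc_cone[OF ab y'(1)] by (meson inj_onD image_subset_iff)
    then have "\<i> * of_real y - z = (1 + of_real t) * (g1 z - z)" using rel[OF z] by simp
    then have "g1 z = z + (\<i> * of_real y - z) / (1 + of_real t)" using t0 by (simp add: field_simps)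
    also have "\<dots> = \<i> * of_real (r y + (y - r y) / (1 + t))" by (simp add: z_def algebra_simps diff_divide_distrib)
    also have "r y + (y - r y) / (1 + t) = \<theta> y"
      using t by (simp add: r_def \<theta>_def field_simps)
    finally show ?thesis using g1'[OF z] by (simp add: z_def)
  qed
  have cont_f\<mu>: "continuous_on {0<..} f\<mu>"
  proof -
    have "continuous_on {0<..} (\<lambda>y. F_transform \<mu> (\<i> * of_real y))"
      by (rule continuous_on_compose2[OF holomorphic_on_imp_continuous_on[OF \<mu>.F_transform_holomorphic]])
         (auto intro!: continuous_intros)
    then show ?thesis unfolding f\<mu>_def by (intro continuous_intros)
  qed
  \<comment> \<open>Since \<open>\<theta> y \<ge> y\<close>, the intermediate value theorem covers a
    full ray, so the relations can be parametrised by the argument of F_nu.\<close>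
  have surj: "\<exists>y\<ge>y0. \<theta> y = s" if s: "s \<ge> \<theta> y0" for s
  proof -
    have "continuous_on {y0..s} \<theta>"
      unfolding \<theta>_def using y0 by (intro continuous_intros continuous_on_subset[OF cont_f\<mu>]) auto
    moreover have "y0 \<le> s" using \<theta>_ge[OF y0] s by simp
    moreover have "s \<le> \<theta> s" using \<theta>_ge[of s] \<open>y0 \<le> s\<close> y0 by simp
    ultimately obtain y where "y0 \<le> y" "y \<le> s" "\<theta> y = s" using IVT'[of \<theta> y0 s s] s by blast
    then show ?thesis by blast
  qed
  define s0 where "s0 = \<theta> y0"
  have s0: "s0 > 0" using \<theta>_ge[OF y0] y0 by (simp add: s0_def)
  let ?H = "{z. 0 < Im z}"
  \<comment> \<open>Purely imaginary values on a ray amount to oddness there; the identity theorem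
    extends it, which makes F_nu purely imaginary on the whole positive imaginary axis.\<close>
  have sym\<nu>: "cauchy_transform \<nu> z + cauchy_transform \<nu> (- z) = 0" if "Im z > 0" for z
  proof (rule analytic_continuation[of "\<lambda>z. cauchy_transform \<nu> z + cauchy_transform \<nu> (- z)" ?H
        "(\<lambda>s. \<i> * of_real s) ` {s0..}" "\<i> * of_real (s0 + 1)"])
    have "(\<lambda>z. cauchy_transform \<nu> (- z)) holomorphic_on ?H"
      by (rule holomorphic_on_compose_gen[OF _ \<nu>.cauchy_transform_holomorphic, unfolded o_def])
         (auto intro!: holomorphic_intros)
    moreover have "cauchy_transform \<nu> holomorphic_on ?H"
      by (rule holomorphic_on_subset[OF \<nu>.cauchy_transform_holomorphic]) auto
    ultimately show "(\<lambda>z. cauchy_transform \<nu> z + cauchy_transform \<nu> (- z)) holomorphic_on ?H"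
      by (intro holomorphic_intros)
    show "(\<lambda>s. \<i> * of_real s) ` {s0..} \<subseteq> ?H" using s0 by auto
    show "(\<i> * complex_of_real (s0 + 1)) islimpt ((\<lambda>s. \<i> * of_real s) ` {s0..})"
      by (rule islimpt_imaginary_ray) simp
    fix z assume "z \<in> (\<lambda>s. \<i> * complex_of_real s) ` {s0..}"
    then obtain s where s: "s \<ge> s0" "z = \<i> * of_real s" by auto
    obtain y where y: "y \<ge> y0" "\<theta> y = s" using surj s by (auto simp: s0_def)
    have "F_transform \<nu> z = \<i> * of_real (r y)" using \<theta>[OF y(1)] s y by simp
    moreover have "cauchy_transform \<nu> z = 1 / F_transform \<nu> z" by (simp add: F_transform_def)
    ultimately have G: "cauchy_transform \<nu> z = 1 / (\<i> * of_real (r y))" by simp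
    have "- z = cnj z" by (simp add: s)
    then have "cauchy_transform \<nu> (- z) = cnj (cauchy_transform \<nu> z)" by (simp add: \<nu>.cauchy_transform_cnj)
    then show "cauchy_transform \<nu> z + cauchy_transform \<nu> (- z) = 0" unfolding G by simp
  qed (use s0 that open_upper_halfplane connected_upper_halfplane in auto)
  define f where "f = (\<lambda>s. Im (F_transform \<nu> (\<i> * of_real s)))"
  have F\<nu>: "F_transform \<nu> (\<i> * of_real s) = \<i> * of_real (f s)" if s: "s > 0" for s
  proof -
    let ?G = "cauchy_transform \<nu> (\<i> * of_real s)"
    have "cauchy_transform \<nu> (- (\<i> * of_real s)) = cnj ?G"
      using \<nu>.cauchy_transform_cnj[of "\<i> * of_real s"] by simp
    then have "?G + cnj ?G = 0" using sym\<nu>[of "\<i> * of_real s"] s by simp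
    then have "Re ?G = 0" by (simp add: complex_eq_iff)
    then have "Re (F_transform \<nu> (\<i> * of_real s)) = 0" by (simp add: F_transform_def Re_divide)
    then show ?thesis by (simp add: complex_eq_iff f_def)
  qed
  have f_pos: "f s > 0" if "s > 0" for s
    using \<nu>.Im_F_transform_ge[of "\<i> * of_real s"] that by (simp add: f_def)
  have cont_f: "continuous_on {0<..} f"
  proof -
    have "continuous_on {0<..} (\<lambda>y. F_transform \<nu> (\<i> * of_real y))"
      by (rule continuous_on_compose2[OF holomorphic_on_imp_continuous_on[OF \<nu>.F_transform_holomorphic]])
         (auto intro!: continuous_intros)
    then show ?thesis unfolding f_def by (intro continuous_intros)
  qed
  \<comment> \<open>Undoing the substitution: at the argument i \<theta>(y) the function H has the
    value i y, and J has the value F_mu(i y).\<close>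
  have large: "\<exists>y>0. (1 + t) * s - t * f s = y \<and> t * s - (t - 1) * f s = f\<mu> y" if s: "s \<ge> s0" for s
  proof -
    obtain y where y: "y \<ge> y0" "\<theta> y = s" using surj s by (auto simp: s0_def)
    then have fs: "f s = (1 + t) * f\<mu> y - t * y" using \<theta>[OF y(1)] by (simp add: f_def r_def)
    have s_eq: "s = t * f\<mu> y + (1 - t) * y" using y(2) by (simp add: \<theta>_def)
    have "(1 + t) * s - t * f s = y \<and> t * s - (t - 1) * f s = f\<mu> y"
      unfolding fs s_eq[symmetric] by (simp add: s_eq algebra_simps)
    then show ?thesis using y y0 by (intro exI[of _ y]) auto
  qed
  show ?thesis
  proof (rule that[OF \<nu> s0 cont_f F\<nu> f_pos])
    fix s assume s: "s \<ge> s0"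
    obtain y where y: "y > 0" "(1 + t) * s - t * f s = y" "t * s - (t - 1) * f s = f\<mu> y"
      using large[OF s] by blast
    show "(1 + t) * s - t * f s > 0" using y by simp
    show "t * s - (t - 1) * f s > 0" using y F\<mu>(2)[of y] by simp
    have "\<i> * of_real (f\<mu> y) * cauchy_transform \<mu> (\<i> * of_real y) = 1"
      unfolding F\<mu>(1)[OF y(1), symmetric] F_transform_def
      using \<mu>.cauchy_transform_neq_0[of "\<i> * of_real y"] y by simp
    then show "\<i> * of_real (t * s - (t - 1) * f s) * cauchy_transform \<mu> (\<i> * of_real ((1 + t) * s - t * f s)) = 1"
      by (simp only: y)
  qed auto
qed

text \<open>Let h and j be H and J on the imaginary axis, and lower s towards 0. If h never leaves
  \<open>D\<close>, positivity of j squeezes f to 0, so h and j tend to 0 and their product relation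
  fails because Gt is finite at 0. Otherwise the condition \<open>exit\<close> is violated at the
  first exit point.\<close>

theorem BB_range_le_1:
  fixes Gt :: "complex \<Rightarrow> complex"
  assumes \<mu>: "real_distribution \<mu>" and range: "\<mu> \<in> BB_range t"
    and sym: "\<And>y. y > 0 \<Longrightarrow> Re (cauchy_transform \<mu> (\<i> * of_real y)) = 0"
    and D: "open D" "\<And>y. y \<ge> 0 \<Longrightarrow> \<i> * of_real y \<in> D"
    and hol: "Gt holomorphic_on D"
    and Gt: "\<And>y. y > 0 \<Longrightarrow> Gt (\<i> * of_real y) = cauchy_transform \<mu> (\<i> * of_real y)"
    and exit: "\<And>c. c < 0 \<Longrightarrow> (\<And>y. y > c \<Longrightarrow> \<i> * of_real y \<in> D) \<Longrightarrow> \<i> * of_real c \<notin> D \<Longrightarrow>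
        filterlim (\<lambda>x. (x - c) * norm (Gt (\<i> * of_real x))) at_top (at_right c)"
  shows "t \<le> 1"
proof (rule ccontr)
  assume "\<not> t \<le> 1"
  then have t: "t > 1" by simp
  obtain \<nu> s0 f where \<nu>: "real_distribution \<nu>" and s0: "s0 > 0" and cont_f: "continuous_on {0<..} f"
    and F\<nu>: "\<And>s. s > 0 \<Longrightarrow> F_transform \<nu> (\<i> * of_real s) = \<i> * of_real (f s)"
    and f_pos: "\<And>s. s > 0 \<Longrightarrow> f s > 0"
    and h_pos: "\<And>s. s \<ge> s0 \<Longrightarrow> (1 + t) * s - t * f s > 0"
    and j_pos: "\<And>s. s \<ge> s0 \<Longrightarrow> t * s - (t - 1) * f s > 0"
    and eq: "\<And>s. s \<ge> s0 \<Longrightarrow> \<i> * of_real (t * s - (t - 1) * f s)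
        * cauchy_transform \<mu> (\<i> * of_real ((1 + t) * s - t * f s)) = 1"
    using BB_range_imaginary_axis[OF \<mu> t range sym] by blast
  interpret \<nu>: real_distribution \<nu> by (rule \<nu>)
  define h where "h = (\<lambda>s. (1 + t) * s - t * f s)"
  define j where "j = (\<lambda>s. t * s - (t - 1) * f s)"
  define H where "H = (\<lambda>z. (1 + of_real t) * z - of_real t * F_transform \<nu> z)"
  define J where "J = (\<lambda>z. of_real t * z - (of_real t - 1) * F_transform \<nu> z)"
  let ?U = "{z. 0 < Im z}"
  have Hh: "H (\<i> * of_real s) = \<i> * of_real (h s)" "J (\<i> * of_real s) = \<i> * of_real (j s)" if "s > 0" for s
    unfolding H_def J_def F\<nu>[OF that] h_def j_def by (simp_all add: algebra_simps)
  have holH: "H holomorphic_on ?U" "J holomorphic_on ?U"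
    unfolding H_def J_def by (intro holomorphic_intros \<nu>.F_transform_holomorphic)+
  have conth: "continuous_on {0<..} h" and contj: "continuous_on {0<..} j"
    unfolding h_def j_def by (intro continuous_intros cont_f)+
  \<comment> \<open>Elimination of f. As s decreases to the exit, where j vanishes, this bounds the
    distance of h from its exit value by a multiple of j.\<close>
  have hj: "(t - 1) * h s = t * j s - s" for s
    by (simp add: h_def j_def algebra_simps)
  \<comment> \<open>The identity is known only high up on the ray; it is continued within the
    connected component of the preimage of \<open>D\<close> under \<open>H\<close> that contains the
    ray.\<close>
  have ident: "\<i> * of_real (j s) * Gt (\<i> * of_real (h s)) = 1"
    if s1: "s1 \<ge> 0" and in_D: "\<And>s. s > s1 \<Longrightarrow> \<i> * of_real (h s) \<in> D" and s: "s > s1" for s1 s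
  proof -
    define W where "W = ?U \<inter> H -` D"
    have W: "open W" unfolding W_def
      by (rule continuous_open_preimage[OF holomorphic_on_imp_continuous_on[OF holH(1)] open_upper_halfplane D(1)])
    define s2 where "s2 = max s0 s1 + 1"
    have s2: "s2 > s0" "s2 > s1" by (auto simp: s2_def)
    define C where "C = connected_component_set W (\<i> * of_real s2)"
    have C: "open C" "connected C" "C \<subseteq> W"
      unfolding C_def using W by (auto simp: open_connected_component connected_component_subset)
    have rayW: "(\<lambda>s. \<i> * complex_of_real s) ` {s1<..} \<subseteq> W"
      using in_D s1 Hh(1) by (auto simp: W_def)
    have "connected ((\<lambda>s. \<i> * complex_of_real s) ` {s1<..})"
      by (intro connected_continuous_image continuous_intros) simp
    then have rayC: "(\<lambda>s. \<i> * complex_of_real s) ` {s1<..} \<subseteq> C"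
      unfolding C_def using s2 by (intro connected_component_maximal rayW) auto
    have "J (\<i> * of_real s) * Gt (H (\<i> * of_real s)) - 1 = 0"
    proof (rule analytic_continuation[of "\<lambda>z. J z * Gt (H z) - 1" C "(\<lambda>s. \<i> * of_real s) ` {s2..}" "\<i> * of_real (s2 + 1)"])
      have "(\<lambda>z. Gt (H z)) holomorphic_on C"
        by (rule holomorphic_on_compose_gen[OF holomorphic_on_subset[OF holH(1)] hol, unfolded o_def])
           (use C(3) in \<open>auto simp: W_def\<close>)
      moreover have "J holomorphic_on C"
        by (rule holomorphic_on_subset[OF holH(2)]) (use C(3) in \<open>auto simp: W_def\<close>)
      ultimately show "(\<lambda>z. J z * Gt (H z) - 1) holomorphic_on C" by (intro holomorphic_intros)
      show "(\<lambda>s. \<i> * of_real s) ` {s2..} \<subseteq> C" using rayC s2 by auto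
      show "\<i> * of_real (s2 + 1) \<in> C" by (rule subsetD[OF rayC], rule imageI) (use s2 in simp)
      show "\<i> * of_real s \<in> C" by (rule subsetD[OF rayC], rule imageI) (use s in simp)
      show "(\<i> * complex_of_real (s2 + 1)) islimpt ((\<lambda>s. \<i> * of_real s) ` {s2..})"
        by (rule islimpt_imaginary_ray) simp
      fix z assume "z \<in> (\<lambda>s. \<i> * complex_of_real s) ` {s2..}"
      then obtain u where u: "u \<ge> s2" "z = \<i> * of_real u" by auto
      then have u': "u \<ge> s0" "u > 0" using s2 s0 by auto
      have "h u > 0" using h_pos[OF u'(1)] by (simp add: h_def)
      then show "J z * Gt (H z) - 1 = 0"
        using eq[OF u'(1)] u Hh[OF u'(2)] Gt[of "h u"] by (simp add: h_def j_def)
    qed (use C in auto)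
    then show ?thesis using Hh[of s] s s1 by simp
  qed
  \<comment> \<open>\<open>ident\<close> forbids zeros of j, and j is positive for large s.\<close>
  have j_gt0: "j s > 0" if s1: "s1 \<ge> 0" and in_D: "\<And>s. s > s1 \<Longrightarrow> \<i> * of_real (h s) \<in> D" and s: "s > s1" for s1 s
  proof (rule ccontr)
    assume "\<not> j s > 0"
    then have js: "j s \<le> 0" by simp
    define u where "u = max s s0"
    have ju: "j u > 0" using j_pos[of u] by (simp add: j_def u_def)
    have "continuous_on {s..u} j" using s s1 by (intro continuous_on_subset[OF contj]) auto
    then obtain x where x: "s \<le> x" "j x = 0" using IVT'[of j s 0 u] js ju by (metis less_imp_le max.cobounded1 u_def)
    have "\<i> * of_real (j x) * Gt (\<i> * of_real (h x)) = 1"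
      using ident[OF s1 in_D, of x] x s by simp
    then show False using x by simp
  qed
  show False
  proof (cases "\<forall>s>0. \<i> * of_real (h s) \<in> D")
    case True
    have j0: "j s > 0" if "s > 0" for s using j_gt0[of 0 s] True that by simp
    have id: "\<i> * of_real (j s) * Gt (\<i> * of_real (h s)) = 1" if "s > 0" for s
      using ident[of 0 s] True that by simp
    have f_le: "f s \<le> t * s / (t - 1)" if "s > 0" for s
      using j0[OF that] t by (simp add: j_def field_simps)
    have f0: "(f \<longlongrightarrow> 0) (at_right 0)"
    proof (rule tendsto_sandwich[of "\<lambda>_. 0" f _ "\<lambda>s. t * s / (t - 1)"])
      show "\<forall>\<^sub>F s in at_right 0. 0 \<le> f s"
        using eventually_at_right_less[of 0] by eventually_elim (use f_pos in force)
      show "\<forall>\<^sub>F s in at_right 0. f s \<le> t * s / (t - 1)"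
        using eventually_at_right_less[of 0] by eventually_elim (use f_le in force)
      show "((\<lambda>s. t * s / (t - 1)) \<longlongrightarrow> 0) (at_right 0)"
        using t by (auto intro!: tendsto_eq_intros)
    qed auto
    have h0: "(h \<longlongrightarrow> 0) (at_right 0)" and j0': "(j \<longlongrightarrow> 0) (at_right 0)"
      unfolding h_def j_def by (auto intro!: tendsto_eq_intros f0)
    have "((\<lambda>s. \<i> * complex_of_real (h s)) \<longlongrightarrow> \<i> * of_real 0) (at_right 0)" by (intro tendsto_intros h0)
    moreover have "isCont Gt 0"
      using holomorphic_on_imp_continuous_on[OF hol] D(1) D(2)[of 0] by (simp add: continuous_on_eq_continuous_at)
    ultimately have "((\<lambda>s. Gt (\<i> * of_real (h s))) \<longlongrightarrow> Gt 0) (at_right 0)"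
      using isCont_tendsto_compose[of 0 Gt] by simp
    then have "((\<lambda>s. \<i> * of_real (j s) * Gt (\<i> * of_real (h s))) \<longlongrightarrow> \<i> * of_real 0 * Gt 0) (at_right 0)"
      by (intro tendsto_intros j0')
    moreover have "((\<lambda>s. \<i> * of_real (j s) * Gt (\<i> * of_real (h s))) \<longlongrightarrow> 1) (at_right 0)"
      by (rule tendsto_eventually) (use eventually_at_right_less[of "0::real"] in \<open>eventually_elim, use id in auto\<close>)
    ultimately show False using tendsto_unique[of "at_right (0::real)"] by force
  next
    case False
    \<comment> \<open>\<open>Sup A\<close> is the first parameter, coming down from infinity, at
      which h leaves \<open>D\<close>.\<close>
    define A where "A = {s. s > 0 \<and> \<i> * of_real (h s) \<notin> D}"
    have A_le: "s \<le> s0" if "s \<in> A" for s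
    proof (rule ccontr)
      assume "\<not> s \<le> s0"
      then have "h s > 0" using h_pos[of s] by (simp add: h_def)
      then show False using that D(2)[of "h s"] by (simp add: A_def)
    qed
    define s1 where "s1 = Sup A"
    have A0: "A \<noteq> {}" using False by (auto simp: A_def)
    have bdd: "bdd_above A" using A_le by (auto simp: bdd_above_def)
    have s1_ge: "s \<le> s1" if "s \<in> A" for s using cSup_upper[OF that bdd] by (simp add: s1_def)
    have s1: "s1 > 0"
    proof -
      obtain s where "s \<in> A" using A0 by blast
      then show ?thesis using s1_ge[of s] by (simp add: A_def)
    qed
    have in_D: "\<i> * of_real (h s) \<in> D" if "s > s1" for s
      using s1_ge[of s] that s1 by (force simp: A_def)
    have notD: "\<i> * of_real (h s1) \<notin> D"
    proof
      assume d: "\<i> * of_real (h s1) \<in> D"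
      have "continuous_on {0<..} (\<lambda>s. \<i> * complex_of_real (h s))" by (intro continuous_intros conth)
      then have "open ({0<..} \<inter> (\<lambda>s. \<i> * complex_of_real (h s)) -` D)"
        by (rule continuous_open_preimage) (auto simp: D(1))
      moreover have "s1 \<in> {0<..} \<inter> (\<lambda>s. \<i> * complex_of_real (h s)) -` D" using d s1 by simp
      ultimately obtain e where e: "e > 0" "ball s1 e \<subseteq> {0<..} \<inter> (\<lambda>s. \<i> * complex_of_real (h s)) -` D"
        by (meson openE)
      obtain s where s: "s \<in> A" "s > s1 - e"
        using less_cSup_iff[OF A0 bdd, of "s1 - e"] e(1) by (auto simp: s1_def)
      then have "s \<in> ball s1 e" using s1_ge[of s] by (auto simp: dist_real_def)
      then show False using e(2) s(1) by (auto simp: A_def)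
    qed
    define c where "c = h s1"
    have c: "c < 0" using notD D(2)[of c] by (force simp: c_def)
    have jp: "j s > 0" if "s > s1" for s using j_gt0[of s1 s] in_D that s1 by simp
    have id: "\<i> * of_real (j s) * Gt (\<i> * of_real (h s)) = 1" if "s > s1" for s
      using ident[of s1 s] in_D that s1 by simp
    \<comment> \<open>Beyond s1 the function h sweeps all values between c and 0; together with
      \<open>D(2)\<close> this places the whole imaginary ray above i c in \<open>D\<close>, as
      \<open>exit\<close> demands.\<close>
    have IV: "\<exists>s>s1. h s = y" if y: "c < y" "y \<le> 0" for y
    proof -
      define u where "u = max s1 s0 + 1"
      have u: "u > s1" "h u > 0" using h_pos[of u] by (auto simp: u_def h_def)
      have "continuous_on {s1..u} h" using s1 by (intro continuous_on_subset[OF conth]) auto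
      then obtain x where "s1 \<le> x" "h x = y" using IVT'[of h s1 y u] y u by (auto simp: c_def)
      then show ?thesis using y by (intro exI[of _ x]) (auto simp: c_def less_le)
    qed
    have allD: "\<i> * of_real y \<in> D" if y: "y > c" for y
    proof (cases "y \<le> 0")
      case True
      then obtain s where "s > s1" "h s = y" using IV[OF y] by blast
      then show ?thesis using in_D by blast
    qed (use D(2)[of y] in simp)
    have hc: "h s > c" if s: "s > s1" for s
    proof (rule ccontr)
      assume "\<not> h s > c"
      define u where "u = max s s0"
      have hu: "h u > 0" using h_pos[of u] by (simp add: h_def u_def)
      have "continuous_on {s..u} h" using s s1 by (intro continuous_on_subset[OF conth]) auto
      then obtain x where x: "s \<le> x" "h x = c" using IVT'[of h s c u] \<open>\<not> h s > c\<close> hu c by (metis less_imp_le less_trans max.cobounded1 not_less u_def)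
      then show False using in_D[of x] notD s by (simp add: c_def)
    qed
    have lim: "filterlim (\<lambda>x. (x - c) * norm (Gt (\<i> * of_real x))) at_top (at_right c)"
      by (rule exit[OF c]) (use allD notD in \<open>auto simp: c_def\<close>)
    have hlim: "(h \<longlongrightarrow> c) (at_right s1)"
    proof -
      have "isCont h s1" using conth s1 by (simp add: continuous_on_eq_continuous_at)
      then show ?thesis by (simp add: c_def isCont_def filterlim_at_split)
    qed
    have "filterlim h (at_right c) (at_right s1)"
      unfolding filterlim_at using hlim eventually_at_right_less[of s1]
      by (auto elim!: eventually_mono dest!: hc)
    then have lim2: "filterlim (\<lambda>s. (h s - c) * norm (Gt (\<i> * of_real (h s)))) at_top (at_right s1)"
      using filterlim_compose[OF lim] by blast
    have norm1: "j s * norm (Gt (\<i> * of_real (h s))) = 1" if "s > s1" for s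
    proof -
      have "norm (\<i> * of_real (j s) * Gt (\<i> * of_real (h s))) = 1" using id[OF that] by simp
      then show ?thesis using jp[OF that] by (simp add: norm_mult)
    qed
    \<comment> \<open>By \<open>norm1\<close>, j is h - c divided by (h - c) |Gt|: a vanishing
      quantity over one tending to infinity.\<close>
    have js1: "j s1 = 0"
    proof -
      have jl: "(j \<longlongrightarrow> j s1) (at_right s1)"
      proof -
        have "isCont j s1" using contj s1 by (simp add: continuous_on_eq_continuous_at)
        then show ?thesis by (simp add: isCont_def filterlim_at_split)
      qed
      have "((\<lambda>s. (h s - c) * inverse ((h s - c) * norm (Gt (\<i> * of_real (h s))))) \<longlongrightarrow> (c - c) * 0) (at_right s1)"
        by (intro tendsto_intros hlim tendsto_inverse_0_at_top[OF lim2])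
      moreover have "\<forall>\<^sub>F s in at_right s1. (h s - c) * inverse ((h s - c) * norm (Gt (\<i> * of_real (h s)))) = j s"
        using eventually_at_right_less[of s1]
      proof eventually_elim
        case (elim s)
        then have "h s - c > 0" "norm (Gt (\<i> * of_real (h s))) \<noteq> 0" using hc norm1[of s] by auto
        then show ?case using norm1[OF elim] by (simp add: field_simps)
      qed
      ultimately have "(j \<longlongrightarrow> 0) (at_right s1)" by (auto elim: Lim_transform_eventually)
      then show ?thesis using tendsto_unique[OF _ jl] by simp
    qed
    have bound: "(h s - c) * norm (Gt (\<i> * of_real (h s))) \<le> t / (t - 1)" if s: "s > s1" for s
    proof -
      have "(t - 1) * (h s - c) \<le> t * j s" using hj[of s] hj[of s1] js1 s by (simp add: c_def algebra_simps)
      then have "h s - c \<le> t / (t - 1) * j s" using t by (simp add: field_simps)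
      then have "(h s - c) * norm (Gt (\<i> * of_real (h s))) \<le> t / (t - 1) * j s * norm (Gt (\<i> * of_real (h s)))"
        by (rule mult_right_mono) simp
      also have "\<dots> = t / (t - 1)" using norm1[OF s] by (simp only: mult.assoc mult_1_right)
      finally show ?thesis .
    qed
    have "\<forall>\<^sub>F s in at_right s1. (h s - c) * norm (Gt (\<i> * of_real (h s))) > t / (t - 1)"
      using lim2 by (simp add: filterlim_at_top_dense)
    then have "\<forall>\<^sub>F s in at_right s1. False"
      using eventually_at_right_less[of s1] by eventually_elim (use bound in force)
    then show False by simp
  qed
qed

section \<open>Densities \<open>c (1 + \<sigma> x\<^sup>2)\<^bsup>\<kappa>\<^esup>\<close>\<close>

text \<open>Unlike \<open>Im (Ln v)\<close>, the arccos form of |arg v| is continuous across the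
  negative real axis, so limits onto the branch cut can be taken.\<close>

lemma abs_Im_Ln_eq:
  assumes "v \<noteq> 0" shows "\<bar>Im (Ln v)\<bar> = arccos (Re v / norm v)"
proof -
  have "v = exp (Ln v)" using assms by simp
  then have "Re v = exp (Re (Ln v)) * cos (Im (Ln v))" by (metis Re_exp)
  also have "exp (Re (Ln v)) = norm v" using assms by (simp add: Re_Ln)
  finally have "Re v / norm v = cos \<bar>Im (Ln v)\<bar>" using assms by simp
  moreover have "\<bar>Im (Ln v)\<bar> \<le> pi" using Im_Ln_le_pi[OF assms] mpi_less_Im_Ln[OF assms] by simp
  ultimately show ?thesis using arccos_cos[of "\<bar>Im (Ln v)\<bar>"] by (metis abs_ge_zero)
qed

lemma Re_powr_of_real:
  assumes "v \<noteq> 0"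
  shows "Re (v powr of_real k) = norm v powr k * cos (\<bar>k\<bar> * arccos (Re v / norm v))"
proof -
  have "v powr of_real k = exp (of_real k * Ln v)" using assms by (simp add: powr_def)
  then have "Re (v powr of_real k) = exp (k * Re (Ln v)) * cos (k * Im (Ln v))" by (simp add: Re_exp)
  also have "exp (k * Re (Ln v)) = norm v powr k" using assms by (simp add: Re_Ln powr_def)
  also have "cos (k * Im (Ln v)) = cos \<bar>k * Im (Ln v)\<bar>" by (metis cos_abs_real)
  also have "\<bar>k * Im (Ln v)\<bar> = \<bar>k\<bar> * arccos (Re v / norm v)" using abs_Im_Ln_eq[OF assms] by (simp add: abs_mult)
  finally show ?thesis .
qed

lemma norm_powr_of_real_complex: "v \<noteq> 0 \<Longrightarrow> norm (v powr of_real k) = norm v powr k" for v :: complex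
  by (simp add: powr_def norm_exp_eq_Re Re_Ln)

text \<open>The analytic facts shared by the two families. The differential equation leaves one
  constant of integration, which \<open>limit_0\<close> fixes; the two smallness conditions on Im G
  and \<open>bounded_at_infinity\<close> feed properness. Absence of critical points in the upper
  half-plane is demanded for \<open>\<kappa> < 0\<close>; for \<open>\<kappa> > 0\<close> it follows
  from Im F >= Im z.\<close>

locale power_density = real_distribution M for M :: "real measure" +
  fixes c \<sigma> \<kappa> :: real
  assumes c_pos: "c > 0"
    and params: "\<sigma> = 1 \<and> \<kappa> < -1 \<or> \<sigma> = -1 \<and> \<kappa> \<ge> 1 / 2"
    and ode: "\<And>z. Im z \<noteq> 0 \<Longrightarrow> (1 + of_real \<sigma> * z\<^sup>2) * deriv (cauchy_transform M) z
        = 2 * of_real (\<kappa> * \<sigma>) * z * cauchy_transform M z - of_real (\<sigma> * (2 * \<kappa> + 1))"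
    and odd: "\<And>z. Im z \<noteq> 0 \<Longrightarrow> cauchy_transform M (- z) = - cauchy_transform M z"
    and limit_0: "((\<lambda>y. cauchy_transform M (\<i> * of_real y)) \<longlongrightarrow> - \<i> * of_real (pi * c)) (at_right 0)"
    and Im_small_at_infinity: "\<And>d. d > 0 \<Longrightarrow> \<exists>B. \<forall>w. Im w > 0 \<longrightarrow> d \<le> - Im (cauchy_transform M w) \<longrightarrow> norm w \<le> B"
    and Im_small_off_support: "\<And>x d. 1 + \<sigma> * x\<^sup>2 \<le> 0 \<Longrightarrow> d > 0 \<Longrightarrow>
        \<forall>\<^sub>F w in nhds (of_real x). Im w > 0 \<longrightarrow> - Im (cauchy_transform M w) < d"
    and bounded_at_infinity: "\<kappa> > 0 \<Longrightarrow> \<exists>B. \<forall>w. Im w < 0 \<longrightarrow> B \<le> norm w \<longrightarrow> norm (cauchy_transform M w) \<le> B"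
    and critical: "\<And>w. \<kappa> < 0 \<Longrightarrow> Im w > 0 \<Longrightarrow> deriv (cauchy_transform M) w \<noteq> 0"
begin

section \<open>Geometry of the cut plane\<close>

abbreviation "G \<equiv> cauchy_transform M"

definition v :: "complex \<Rightarrow> complex" where "v z = 1 + of_real \<sigma> * z\<^sup>2"
text \<open>Where the principal powers of \<open>v\<close> are holomorphic: the plane cut along the
  imaginary rays from i and -i outwards for \<open>\<sigma> = 1\<close>, along the real rays from 1
  and -1 outwards for \<open>\<sigma> = -1\<close>.\<close>

definition \<Omega> :: "complex set" where "\<Omega> = {z. v z \<notin> \<real>\<^sub>\<le>\<^sub>0}"

lemma \<sigma>: "\<sigma> = 1 \<or> \<sigma> = -1" "\<sigma> * \<sigma> = 1" "\<bar>\<sigma>\<bar> = 1" using params by auto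

lemma \<kappa>: "\<kappa> \<noteq> 0" "2 * \<bar>\<kappa>\<bar> \<ge> 1" "2 * \<kappa> + 1 \<noteq> 0" "(2 * \<kappa> + 1) / (2 * \<kappa>) > 0"
  using params by (auto simp: zero_less_divide_iff)

lemma v_0 [simp]: "v 0 = 1" by (simp add: v_def)
lemma v_minus [simp]: "v (- z) = v z" by (simp add: v_def)
lemma zero_in_\<Omega>: "0 \<in> \<Omega>" by (simp add: \<Omega>_def)
lemma minus_in_\<Omega>: "- z \<in> \<Omega> \<longleftrightarrow> z \<in> \<Omega>" by (simp add: \<Omega>_def)

lemma v_holomorphic: "v holomorphic_on A"
  unfolding v_def by (intro holomorphic_intros)

lemma continuous_on_v: "continuous_on A v"
  by (rule holomorphic_on_imp_continuous_on[OF v_holomorphic])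

lemma v_deriv: "(v has_field_derivative 2 * of_real \<sigma> * z) (at z)"
  unfolding v_def by (auto intro!: derivative_eq_intros)

lemma open_\<Omega>: "open \<Omega>"
proof -
  have "open (v -` (- \<real>\<^sub>\<le>\<^sub>0))"
    by (rule open_vimage[OF _ continuous_on_v]) (simp add: open_Compl)
  moreover have "v -` (- \<real>\<^sub>\<le>\<^sub>0) = \<Omega>" by (auto simp: \<Omega>_def)
  ultimately show ?thesis by simp
qed

lemma ball_subset_\<Omega>: "ball 0 1 \<subseteq> \<Omega>"
proof
  fix z :: complex assume "z \<in> ball 0 1"
  then have "norm (of_real \<sigma> * z\<^sup>2) < 1" using \<sigma> by (simp add: norm_mult norm_power power_less_one_iff)
  then have "Re (v z) > 0" using abs_Re_le_cmod[of "of_real \<sigma> * z\<^sup>2"] by (simp add: v_def)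
  then show "z \<in> \<Omega>" by (auto simp: \<Omega>_def complex_nonpos_Reals_iff)
qed

text \<open>Along a ray from 0 the quantity v - 1 is only scaled by a growing positive factor, so a
  ray that has entered the cut never leaves it.\<close>

lemma scale_in_\<Omega>:
  assumes z: "z \<in> \<Omega>" and r: "0 \<le> r" "r \<le> 1" shows "of_real r * z \<in> \<Omega>"
proof (cases "r = 0")
  case False
  then have r0: "r > 0" using r by simp
  have r1: "r\<^sup>2 \<le> 1" "r\<^sup>2 > 0" using r r0 by (auto simp: power_le_one)
  define u where "u = of_real \<sigma> * z\<^sup>2"
  have vz: "v z = 1 + u" "v (of_real r * z) = 1 + of_real (r\<^sup>2) * u"
    by (simp_all add: v_def u_def power_mult_distrib)
  show ?thesis
  proof (rule ccontr)
    assume "of_real r * z \<notin> \<Omega>"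
    then have "v (of_real r * z) \<in> \<real>\<^sub>\<le>\<^sub>0" by (simp add: \<Omega>_def)
    then have "1 + of_real (r\<^sup>2) * u \<in> \<real>\<^sub>\<le>\<^sub>0" by (simp only: vz(2))
    then have *: "r\<^sup>2 * Im u = 0" "1 + r\<^sup>2 * Re u \<le> 0"
      by (auto simp: complex_nonpos_Reals_iff simp del: of_real_power)
    have "Im u = 0" using * r1 by auto
    moreover have "Re u \<le> -1"
    proof (rule ccontr)
      assume "\<not> Re u \<le> -1"
      then have "r\<^sup>2 * Re u > r\<^sup>2 * (-1)" using r1 by (intro mult_strict_left_mono) auto
      then show False using * r1 by simp
    qed
    ultimately have "1 + u \<in> \<real>\<^sub>\<le>\<^sub>0" by (simp add: complex_nonpos_Reals_iff)
    moreover have "v z \<notin> \<real>\<^sub>\<le>\<^sub>0" using z by (simp add: \<Omega>_def)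
    ultimately show False by (metis vz(1))
  qed
qed (simp add: zero_in_\<Omega>)

lemma starlike_\<Omega>: "starlike \<Omega>"
  unfolding starlike_def
proof (intro bexI[of _ 0] ballI subsetI)
  fix z w assume z: "z \<in> \<Omega>" "w \<in> closed_segment 0 z"
  then obtain r where "0 \<le> r" "r \<le> 1" "w = of_real r * z"
    by (auto simp: closed_segment_def scaleR_conv_of_real)
  then show "w \<in> \<Omega>" using scale_in_\<Omega>[OF z(1)] by simp
qed (rule zero_in_\<Omega>)

text \<open>For \<open>\<sigma> = 1\<close> the cut enters the upper half-plane; every remaining
  point is joined by its segment towards 0 to a common half disc.\<close>

lemma connected_\<Omega>_upper: "connected (\<Omega> \<inter> {z. Im z > 0})"
proof -
  let ?H = "{z. Im z > 0}"
  define S where "S = (\<lambda>w. ((\<lambda>r. of_real r * w) ` {0<..1}) \<union> (ball 0 1 \<inter> ?H))"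
  have conn: "connected (S w)" if w: "w \<in> \<Omega> \<inter> ?H" for w
    unfolding S_def
  proof (rule connected_Un)
    show "connected ((\<lambda>r. complex_of_real r * w) ` {0<..1})"
      by (intro connected_continuous_image continuous_intros) simp
    show "connected (ball 0 1 \<inter> ?H)"
      by (intro convex_connected convex_Int convex_ball convex_halfspace_Im_gt)
    define r where "r = min 1 (1 / (2 * norm w))"
    have "w \<noteq> 0" using w by auto
    then have r: "0 < r" "r \<le> 1" "r * norm w < 1" by (auto simp: r_def min_def field_simps)
    then have "of_real r * w \<in> ((\<lambda>r. complex_of_real r * w) ` {0<..1}) \<inter> (ball 0 1 \<inter> ?H)"
      using w by (auto simp: norm_mult)
    then show "((\<lambda>r. complex_of_real r * w) ` {0<..1}) \<inter> (ball 0 1 \<inter> ?H) \<noteq> {}" by blast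
  qed
  have "connected (\<Union> (S ` (\<Omega> \<inter> ?H)))"
  proof (rule connected_Union)
    have "\<i> / 2 \<in> \<Inter> (S ` (\<Omega> \<inter> ?H))" by (auto simp: S_def norm_divide)
    then show "\<Inter> (S ` (\<Omega> \<inter> ?H)) \<noteq> {}" by blast
  qed (use conn in auto)
  moreover have "\<Union> (S ` (\<Omega> \<inter> ?H)) = \<Omega> \<inter> ?H"
  proof
    show "\<Union> (S ` (\<Omega> \<inter> ?H)) \<subseteq> \<Omega> \<inter> ?H"
      using ball_subset_\<Omega> scale_in_\<Omega> by (auto simp: S_def)
    show "\<Omega> \<inter> ?H \<subseteq> \<Union> (S ` (\<Omega> \<inter> ?H))"
    proof
      fix w assume w: "w \<in> \<Omega> \<inter> ?H"
      have "w \<in> S w" unfolding S_def by (intro UnI1 image_eqI[of _ _ 1]) auto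
      then show "w \<in> \<Union> (S ` (\<Omega> \<inter> ?H))" using w by blast
    qed
  qed
  ultimately show ?thesis by simp
qed

section \<open>The continuation of G through the support\<close>

definition vp :: "real \<Rightarrow> complex \<Rightarrow> complex" where "vp k z = v z powr of_real k"

lemma v_neq_0: "z \<in> \<Omega> \<Longrightarrow> v z \<noteq> 0" by (auto simp: \<Omega>_def)

lemma vp_minus: "vp k (- z) = vp k z" by (simp add: vp_def)

lemma vp_add: "vp (j + k) z = vp j z * vp k z"
  by (simp add: vp_def powr_add)

lemma vp_1: "z \<in> \<Omega> \<Longrightarrow> vp 1 z = v z" using v_neq_0 by (simp add: vp_def)

lemma vp_0: "z \<in> \<Omega> \<Longrightarrow> vp 0 z = 1" using v_neq_0 by (simp add: vp_def)

lemma vp_deriv: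
  assumes "z \<in> \<Omega>"
  shows "(vp k has_field_derivative of_real k * vp (k - 1) z * (2 * of_real \<sigma> * z)) (at z)"
proof -
  have "((\<lambda>u. u powr of_real k) has_field_derivative of_real k * v z powr (of_real k - 1)) (at (v z))"
    using assms by (intro has_field_derivative_powr) (auto simp: \<Omega>_def)
  from DERIV_chain2[OF this v_deriv] show ?thesis by (simp add: vp_def[abs_def])
qed

lemma vp_holomorphic: "vp k holomorphic_on \<Omega>"
  using vp_deriv open_\<Omega> by (auto simp: holomorphic_on_open)

text \<open>Variation of constants: \<open>vp \<kappa>\<close> solves the homogeneous equation, and
  this primitive, normalised at 0, produces the inhomogeneous term.\<close>

definition prim :: "complex \<Rightarrow> complex" where
  "prim = (SOME I. I 0 = 0 \<and> (\<forall>z\<in>\<Omega>. (I has_field_derivative vp (- \<kappa> - 1) z) (at z)))"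

lemma prim: "prim 0 = 0" "z \<in> \<Omega> \<Longrightarrow> (prim has_field_derivative vp (- \<kappa> - 1) z) (at z)"
proof -
  have "\<exists>g. \<forall>x\<in>\<Omega>. (g has_field_derivative vp (- \<kappa> - 1) x) (at x)"
  proof (rule holomorphic_starlike_primitive[OF holomorphic_on_imp_continuous_on[OF vp_holomorphic] starlike_\<Omega> open_\<Omega> finite.emptyI])
    fix x assume "x \<in> \<Omega> - {}"
    then show "vp (- \<kappa> - 1) field_differentiable at x"
      using vp_deriv[of x] unfolding field_differentiable_def by blast
  qed
  then obtain g where g: "\<And>x. x \<in> \<Omega> \<Longrightarrow> (g has_field_derivative vp (- \<kappa> - 1) x) (at x)" by blast
  have "\<exists>I. I 0 = 0 \<and> (\<forall>z\<in>\<Omega>. (I has_field_derivative vp (- \<kappa> - 1) z) (at z))"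
    by (rule exI[of _ "\<lambda>z. g z - g 0"]) (auto intro!: derivative_eq_intros g)
  then have "prim 0 = 0 \<and> (\<forall>z\<in>\<Omega>. (prim has_field_derivative vp (- \<kappa> - 1) z) (at z))"
    unfolding prim_def by (rule someI_ex)
  then show "prim 0 = 0" "z \<in> \<Omega> \<Longrightarrow> (prim has_field_derivative vp (- \<kappa> - 1) z) (at z)" by auto
qed

lemma deriv_zero_constant:
  assumes "open S" "connected S" "\<And>x. x \<in> S \<Longrightarrow> (f has_field_derivative 0) (at x)" "x \<in> S" "y \<in> S"
  shows "f x = (f y :: complex)"
proof -
  have "continuous_on S f" using assms(3) by (intro continuous_at_imp_continuous_on ballI DERIV_isCont) auto
  then obtain a where "\<And>x. x \<in> S \<Longrightarrow> f x = a"
    using DERIV_zero_connected_constant[OF assms(2,1) finite.emptyI] assms(3) by (metis Diff_empty)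
  then show ?thesis using assms by simp
qed

lemma prim_odd:
  assumes z: "z \<in> \<Omega>" shows "prim (- z) = - prim z"
proof -
  have "prim z + prim (- z) = prim 0 + prim (- 0)"
  proof (rule deriv_zero_constant[OF open_\<Omega> starlike_imp_connected[OF starlike_\<Omega>] _ z zero_in_\<Omega>])
    fix x assume x: "x \<in> \<Omega>"
    have "((\<lambda>x. prim (- x)) has_field_derivative vp (- \<kappa> - 1) (- x) * (- 1)) (at x)"
      by (rule DERIV_chain2[OF prim(2)]) (use x in \<open>auto simp: minus_in_\<Omega> intro!: derivative_eq_intros\<close>)
    from DERIV_add[OF prim(2)[OF x] this]
    show "((\<lambda>z. prim z + prim (- z)) has_field_derivative 0) (at x)" by (simp add: vp_minus)
  qed
  then show ?thesis by (simp add: prim(1) eq_neg_iff_add_eq_0 add.commute)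
qed

text \<open>The solution of the differential equation on all of \<open>\<Omega>\<close> with value
  -i pi c at 0, the boundary value of G prescribed by \<open>limit_0\<close>.\<close>

definition Gc :: "complex \<Rightarrow> complex" where
  "Gc z = vp \<kappa> z * (- \<i> * of_real (pi * c) - of_real (\<sigma> * (2 * \<kappa> + 1)) * prim z)"

lemma Gc_deriv:
  assumes z: "z \<in> \<Omega>"
  shows "\<exists>D. (Gc has_field_derivative D) (at z) \<and>
    v z * D = 2 * of_real (\<kappa> * \<sigma>) * z * Gc z - of_real (\<sigma> * (2 * \<kappa> + 1))"
proof (intro exI conjI)
  let ?b = "- \<i> * of_real (pi * c) - of_real (\<sigma> * (2 * \<kappa> + 1)) * prim z"
  let ?D = "of_real \<kappa> * vp (\<kappa> - 1) z * (2 * of_real \<sigma> * z) * ?b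
     + vp \<kappa> z * (- (of_real (\<sigma> * (2 * \<kappa> + 1)) * vp (- \<kappa> - 1) z))"
  show "(Gc has_field_derivative ?D) (at z)"
    unfolding Gc_def[abs_def] by (rule derivative_eq_intros vp_deriv[OF z] prim(2)[OF z] refl)+ (simp add: algebra_simps)
  have 1: "v z * vp (\<kappa> - 1) z = vp \<kappa> z"
    using vp_add[of 1 "\<kappa> - 1" z] vp_1[OF z] by simp
  have 2: "v z * (vp \<kappa> z * vp (- \<kappa> - 1) z) = 1"
    using vp_add[of \<kappa> "- \<kappa> - 1" z] vp_add[of 1 "- 1" z] vp_1[OF z] vp_0[OF z] by simp
  have "v z * ?D = of_real \<kappa> * (v z * vp (\<kappa> - 1) z) * (2 * of_real \<sigma> * z) * ?b
     - of_real (\<sigma> * (2 * \<kappa> + 1)) * (v z * (vp \<kappa> z * vp (- \<kappa> - 1) z))"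
    by (simp add: algebra_simps)
  also have "\<dots> = 2 * of_real (\<kappa> * \<sigma>) * z * (vp \<kappa> z * ?b) - of_real (\<sigma> * (2 * \<kappa> + 1))"
    unfolding 1 2 by (simp add: algebra_simps)
  finally show "v z * ?D = 2 * of_real (\<kappa> * \<sigma>) * z * Gc z - of_real (\<sigma> * (2 * \<kappa> + 1))"
    by (simp add: Gc_def)
qed

lemma Gc_holomorphic: "Gc holomorphic_on \<Omega>"
  using Gc_deriv open_\<Omega> by (auto simp: holomorphic_on_open)

lemma G_DERIV: "Im z \<noteq> 0 \<Longrightarrow> (G has_field_derivative deriv G z) (at z)"
  using cauchy_transform_has_field_derivative[of z] DERIV_imp_deriv by metis

text \<open>With the integrating factor v^(-\<kappa>) the equation says that \<open>A\<close> has
  derivative 0; connectedness and the limit at 0 along the imaginary axis determine its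
  value.\<close>

lemma Gc_eq_upper:
  assumes z: "z \<in> \<Omega>" "Im z > 0" shows "Gc z = G z"
proof -
  let ?U = "\<Omega> \<inter> {z. Im z > 0}"
  define A where "A = (\<lambda>z. vp (- \<kappa>) z * G z + of_real (\<sigma> * (2 * \<kappa> + 1)) * prim z)"
  have U: "open ?U" using open_\<Omega> open_upper_halfplane by auto
  have der: "(A has_field_derivative 0) (at x)" if x: "x \<in> ?U" for x
  proof -
    have x': "x \<in> \<Omega>" "Im x \<noteq> 0" using x by auto
    have "vp (- \<kappa>) x = vp (- \<kappa> - 1) x * v x"
      using vp_add[of "- \<kappa> - 1" 1 x] vp_1[OF x'(1)] by simp
    then have "of_real (- \<kappa>) * vp (- \<kappa> - 1) x * (2 * of_real \<sigma> * x) * G x + vp (- \<kappa>) x * deriv G x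
        + of_real (\<sigma> * (2 * \<kappa> + 1)) * vp (- \<kappa> - 1) x
      = vp (- \<kappa> - 1) x * (v x * deriv G x - 2 * of_real (\<kappa> * \<sigma>) * x * G x + of_real (\<sigma> * (2 * \<kappa> + 1)))"
      by (simp add: algebra_simps)
    also have "\<dots> = 0" using ode[OF x'(2)] by (simp add: v_def)
    finally have eq0: "of_real (- \<kappa>) * vp (- \<kappa> - 1) x * (2 * of_real \<sigma> * x) * G x + vp (- \<kappa>) x * deriv G x
        + of_real (\<sigma> * (2 * \<kappa> + 1)) * vp (- \<kappa> - 1) x = 0" .
    have "((\<lambda>z. vp (- \<kappa>) z * G z + of_real (\<sigma> * (2 * \<kappa> + 1)) * prim z) has_field_derivative
       (of_real (- \<kappa>) * vp (- \<kappa> - 1) x * (2 * of_real \<sigma> * x) * G x + deriv G x * vp (- \<kappa>) x)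
        + of_real (\<sigma> * (2 * \<kappa> + 1)) * vp (- \<kappa> - 1) x) (at x)"
      by (intro DERIV_add DERIV_mult DERIV_cmult vp_deriv[OF x'(1)] G_DERIV[OF x'(2)] prim(2)[OF x'(1)])
    then show ?thesis using eq0 by (simp add: A_def[abs_def] mult.commute)
  qed
  have const: "A w = A z" if "w \<in> ?U" for w
    by (rule deriv_zero_constant[OF U connected_\<Omega>_upper der that]) (use z in auto)
  have lim: "((\<lambda>y. A (\<i> * of_real y)) \<longlongrightarrow> vp (- \<kappa>) 0 * (- \<i> * of_real (pi * c)) + of_real (\<sigma> * (2 * \<kappa> + 1)) * prim 0) (at_right 0)"
  proof -
    have y0: "((\<lambda>y. \<i> * complex_of_real y) \<longlongrightarrow> 0) (at_right 0)" by (auto intro!: tendsto_eq_intros)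
    have "isCont (vp (- \<kappa>)) 0" "isCont prim 0"
      using vp_deriv[OF zero_in_\<Omega>] prim(2)[OF zero_in_\<Omega>] DERIV_isCont by blast+
    then have "((\<lambda>y. vp (- \<kappa>) (\<i> * of_real y)) \<longlongrightarrow> vp (- \<kappa>) 0) (at_right 0)"
      "((\<lambda>y. prim (\<i> * of_real y)) \<longlongrightarrow> prim 0) (at_right 0)"
      using isCont_tendsto_compose y0 by blast+
    then show ?thesis unfolding A_def by (intro tendsto_intros limit_0)
  qed
  moreover have "((\<lambda>y. A (\<i> * of_real y)) \<longlongrightarrow> A z) (at_right 0)"
  proof (rule tendsto_eventually)
    have "\<forall>\<^sub>F y in at_right 0. y \<in> {0<..<1::real}" by (rule eventually_at_right_real) simp
    then show "\<forall>\<^sub>F y in at_right 0. A (\<i> * of_real y) = A z"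
    proof eventually_elim
      case (elim y)
      then have "\<i> * of_real y \<in> ball (0::complex) 1" by (auto simp: norm_mult)
      then show ?case using elim ball_subset_\<Omega> by (intro const) auto
    qed
  qed
  ultimately have "A z = vp (- \<kappa>) 0 * (- \<i> * of_real (pi * c)) + of_real (\<sigma> * (2 * \<kappa> + 1)) * prim 0"
    by (intro tendsto_unique[of "at_right (0::real)"]) auto
  then have Az: "A z = - \<i> * of_real (pi * c)" by (simp add: prim(1) vp_def)
  have inv: "vp \<kappa> z * vp (- \<kappa>) z = 1" using vp_add[of \<kappa> "- \<kappa>" z] vp_0[OF z(1)] by simp
  have "Gc z = vp \<kappa> z * (A z - of_real (\<sigma> * (2 * \<kappa> + 1)) * prim z)" by (simp add: Gc_def Az)
  also have "\<dots> = vp \<kappa> z * vp (- \<kappa>) z * G z" by (simp add: A_def)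
  finally show ?thesis using inv by simp
qed

text \<open>G and \<open>prim\<close> are odd and \<open>vp\<close> is even, so passing to the lower
  half-plane flips only the sign of the -i pi c term; this is the origin of the jump.\<close>

lemma Gc_eq_lower:
  assumes z: "z \<in> \<Omega>" "Im z < 0" shows "Gc z = G z - 2 * pi * \<i> * of_real c * vp \<kappa> z"
proof -
  have "G z = - G (- z)" using odd[of z] z by simp
  also have "G (- z) = Gc (- z)" using Gc_eq_upper[of "- z"] z minus_in_\<Omega> by simp
  also have "\<dots> = vp \<kappa> z * (- \<i> * of_real (pi * c) + of_real (\<sigma> * (2 * \<kappa> + 1)) * prim z)"
    by (simp add: Gc_def vp_minus prim_odd[OF z(1)])
  finally show ?thesis by (simp add: Gc_def algebra_simps)
qed

section \<open>The domain of the continuation, and properness over the lower half-plane\<close>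

definition D2 :: "complex set" where "D2 = {z \<in> \<Omega>. 2 * \<bar>\<kappa>\<bar> * \<bar>Im (Ln (v z))\<bar> < pi}"
text \<open>On \<open>D2\<close> the power v^\<kappa> has positive real part, which vanishes where
  |arg v| = pi / (2 |\<kappa>|). The upper half-plane is added as a whole, because \<open>D2\<close>
  need not cover it and G itself is available there.\<close>

definition D :: "complex set" where "D = {z. Im z > 0} \<union> D2"
definition Gt :: "complex \<Rightarrow> complex" where "Gt z = (if Im z > 0 then G z else Gc z)"

lemma open_D2: "open D2"
proof -
  have "continuous_on \<Omega> (\<lambda>z. 2 * \<bar>\<kappa>\<bar> * \<bar>Im (Ln (v z))\<bar>)"
    by (intro continuous_intros continuous_on_v) (auto simp: \<Omega>_def)
  then have "open (\<Omega> \<inter> (\<lambda>z. 2 * \<bar>\<kappa>\<bar> * \<bar>Im (Ln (v z))\<bar>) -` {..<pi})"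
    using open_\<Omega> by (rule continuous_open_preimage) simp
  moreover have "\<Omega> \<inter> (\<lambda>z. 2 * \<bar>\<kappa>\<bar> * \<bar>Im (Ln (v z))\<bar>) -` {..<pi} = D2" by (auto simp: D2_def)
  ultimately show ?thesis by simp
qed

lemma D2_subset: "D2 \<subseteq> \<Omega>" by (auto simp: D2_def)

lemma open_D: "open D"
  unfolding D_def using open_D2 open_upper_halfplane by auto

lemma Gt_eq_Gc: "z \<in> \<Omega> \<Longrightarrow> Gt z = Gc z"
  using Gc_eq_upper by (simp add: Gt_def)

text \<open>Triangle inequality for the jump formula: where G is controlled, Gt must be as large as
  |v|^\<kappa>. It serves at infinity and near the branch point -i.\<close>

lemma norm_v_powr_le:
  assumes w: "w \<in> \<Omega>" "Im w < 0"
  shows "2 * pi * c * norm (v w) powr \<kappa> \<le> norm (G w) + norm (Gt w)"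
proof -
  have "2 * pi * \<i> * of_real c * vp \<kappa> w = G w - Gt w"
    using Gc_eq_lower[OF w] Gt_eq_Gc[OF w(1)] by simp
  moreover have "norm (2 * pi * \<i> * of_real c * vp \<kappa> w) = 2 * pi * c * norm (v w) powr \<kappa>"
    using c_pos v_neq_0[OF w(1)] by (simp add: norm_mult vp_def norm_powr_of_real_complex)
  ultimately show ?thesis using norm_triangle_ineq4[of "G w" "Gt w"] by simp
qed

lemma Gt_holomorphic: "Gt holomorphic_on D"
  unfolding D_def
proof (rule holomorphic_on_Un)
  show "Gt holomorphic_on {z. Im z > 0}"
  proof (rule holomorphic_transform)
    show "G holomorphic_on {z. Im z > 0}"
      by (rule holomorphic_on_subset[OF cauchy_transform_holomorphic]) auto
  qed (simp add: Gt_def)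
  show "Gt holomorphic_on D2"
    by (rule holomorphic_transform[OF holomorphic_on_subset[OF Gc_holomorphic D2_subset]])
       (use D2_subset Gt_eq_Gc in auto)
qed (auto simp: open_D2 open_upper_halfplane)

lemma deriv_Gt_upper:
  assumes "Im w > 0" shows "deriv Gt w = deriv G w"
proof (rule deriv_cong_ev)
  have "\<forall>\<^sub>F z in nhds w. z \<in> {z. Im z > 0}"
    by (rule eventually_nhds_in_open) (use assms open_upper_halfplane in auto)
  then show "\<forall>\<^sub>F z in nhds w. Gt z = G z" by eventually_elim (simp add: Gt_def)
qed simp

lemma Gt_ode:
  assumes w: "w \<in> D"
  shows "v w * deriv Gt w = 2 * of_real (\<kappa> * \<sigma>) * w * Gt w - of_real (\<sigma> * (2 * \<kappa> + 1))"
proof (cases "Im w > 0")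
  case True
  show ?thesis using ode[of w] True deriv_Gt_upper[OF True] by (simp add: Gt_def v_def)
next
  case False
  then have w': "w \<in> \<Omega>" using w D2_subset by (auto simp: D_def)
  have "deriv Gt w = deriv Gc w"
  proof (rule deriv_cong_ev)
    have "\<forall>\<^sub>F z in nhds w. z \<in> \<Omega>"
      by (rule eventually_nhds_in_open[OF open_\<Omega> w'])
    then show "\<forall>\<^sub>F z in nhds w. Gt z = Gc z" by eventually_elim (simp add: Gt_eq_Gc)
  qed simp
  moreover obtain E where "(Gc has_field_derivative E) (at w)"
    "v w * E = 2 * of_real (\<kappa> * \<sigma>) * w * Gc w - of_real (\<sigma> * (2 * \<kappa> + 1))"
    using Gc_deriv[OF w'] by blast
  ultimately show ?thesis using DERIV_imp_deriv Gt_eq_Gc[OF w'] by metis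
qed

lemma deriv_Gt_neq_0:
  assumes w: "w \<in> D" and Im: "Im (Gt w) < 0" shows "deriv Gt w \<noteq> 0"
proof
  assume 0: "deriv Gt w = 0"
  \<comment> \<open>The only possible value of w Gt(w) at a critical point; b = 1 + 1 / (2 \<kappa>)
    exceeds 1 exactly when \<open>\<kappa> > 0\<close>.\<close>
  define b where "b = (2 * \<kappa> + 1) / (2 * \<kappa>)"
  have b: "b > 0" using \<kappa> by (simp add: b_def)
  have "of_real (2 * \<kappa> * \<sigma>) * (w * Gt w) = complex_of_real (\<sigma> * (2 * \<kappa> + 1))"
    using Gt_ode[OF w] 0 by (simp add: algebra_simps)
  moreover have "complex_of_real (2 * \<kappa> * \<sigma>) \<noteq> 0" using \<kappa> \<sigma> by auto
  ultimately have "w * Gt w = of_real (\<sigma> * (2 * \<kappa> + 1)) / of_real (2 * \<kappa> * \<sigma>)"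
    by (metis nonzero_mult_div_cancel_left)
  also have "\<dots> = of_real (\<sigma> * (2 * \<kappa> + 1) / (2 * \<kappa> * \<sigma>))" by (simp only: of_real_divide)
  also have "\<sigma> * (2 * \<kappa> + 1) / (2 * \<kappa> * \<sigma>) = b" using \<sigma> \<kappa> by (auto simp: b_def field_simps)
  finally have wG: "w * Gt w = of_real b" .
  then have w0: "w \<noteq> 0" using b by auto
  then have Gw: "Gt w = of_real b / w" using wG by (simp add: field_simps)
  show False
  proof (cases "Im w > 0")
    case True
    show False
    proof (cases "\<kappa> < 0")
      case k: True
      show False using 0 critical[OF k True] deriv_Gt_upper[OF True] by simp
    next
      case False
      then have "\<kappa> > 0" using \<kappa> by simp
      then have b1: "b > 1" by (simp add: b_def field_simps)
      have "F_transform M w = w / of_real b" using Gw True by (simp add: F_transform_def Gt_def)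
      then have "Im w / b \<ge> Im w" using Im_F_transform_ge[OF True] by simp
      then show False using b1 True by (simp add: field_simps)
    qed
  next
    case False
    have "Im (Gt w) = - b * Im w / (norm w)\<^sup>2" unfolding Gw by (simp add: Im_divide cmod_power2)
    also have "\<dots> \<ge> 0" using False b by (intro divide_nonneg_nonneg) (auto simp: mult_nonneg_nonpos)
    finally show False using Im by simp
  qed
qed

text \<open>Below the axis Gt = G - 2 pi i c v^\<kappa> with Im G > 0; the real points of
  \<open>\<Omega>\<close> are approached from below.\<close>

lemma Im_Gt_lower:
  assumes w: "w \<in> \<Omega>" "Im w \<le> 0"
  shows "- Im (Gt w) \<le> 2 * pi * c * Re (vp \<kappa> w)"
proof -
  define \<Phi> where "\<Phi> = (\<lambda>z. - Im (Gc z) - 2 * pi * c * Re (vp \<kappa> z))"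
  have neg: "\<Phi> z \<le> 0" if "z \<in> \<Omega>" "Im z < 0" for z
    using Gc_eq_lower[OF that] Im_cauchy_transform_pos[OF that(2)] by (simp add: \<Phi>_def)
  have "continuous_on \<Omega> \<Phi>"
    unfolding \<Phi>_def using Gc_holomorphic vp_holomorphic
    by (intro continuous_intros holomorphic_on_imp_continuous_on)
  then have cont: "isCont \<Phi> w" using w open_\<Omega> by (simp add: continuous_on_eq_continuous_at)
  have lim: "((\<lambda>y. w - \<i> * of_real y) \<longlongrightarrow> w) (at_right 0)" by (auto intro!: tendsto_eq_intros)
  have "((\<lambda>y. \<Phi> (w - \<i> * of_real y)) \<longlongrightarrow> \<Phi> w) (at_right 0)"
    by (rule isCont_tendsto_compose[OF cont lim])
  moreover have "\<forall>\<^sub>F y in at_right 0. \<Phi> (w - \<i> * of_real y) \<le> 0"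
  proof -
    have "\<forall>\<^sub>F y in at_right 0. w - \<i> * of_real y \<in> \<Omega>"
      using topological_tendstoD[OF lim open_\<Omega> w(1)] .
    then show ?thesis using eventually_at_right_less[of "0::real"]
      by eventually_elim (use w neg in auto)
  qed
  ultimately have "\<Phi> w \<le> 0" by (intro tendsto_upperbound) auto
  then show ?thesis using Gt_eq_Gc[OF w(1)] by (simp add: \<Phi>_def)
qed

lemma Re_vp_le: "w \<in> \<Omega> \<Longrightarrow> Re (vp \<kappa> w) \<le> norm (v w) powr \<kappa>"
  using complex_Re_le_cmod[of "vp \<kappa> w"] v_neq_0 by (simp add: vp_def norm_powr_of_real_complex)

lemma norm_v_ge: "norm (v w) \<ge> (norm w)\<^sup>2 - 1"
proof -
  have "(norm w)\<^sup>2 = norm (v w - 1)" using \<sigma> by (simp add: v_def norm_mult norm_power)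
  also have "\<dots> \<le> norm (v w) + 1" using norm_triangle_ineq4[of "v w" 1] by simp
  finally show ?thesis by simp
qed

lemma norm_le_of_norm_v:
  assumes "norm (v w) \<le> B" shows "norm w \<le> B + 2"
proof (rule ccontr)
  assume "\<not> norm w \<le> B + 2"
  moreover have "B \<ge> 0" using assms norm_ge_zero order_trans by blast
  ultimately have *: "norm w > B + 2" "norm w \<ge> 1" by auto
  then have "(norm w)\<^sup>2 \<ge> norm w" by (intro self_le_power) auto
  then show False using norm_v_ge[of w] assms * by linarith
qed

text \<open>Above the axis Im G is small at infinity. Below it, for \<open>\<kappa> < 0\<close> the
  bound of -Im Gt by Re v^\<kappa> decays, whereas for \<open>\<kappa> > 0\<close> G stays bounded
  and v^\<kappa> makes Gt too large.\<close>

lemma bounded_preimage: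
  assumes d: "d > 0"
  shows "\<exists>R. \<forall>w\<in>D. d \<le> - Im (Gt w) \<longrightarrow> norm (Gt w) \<le> B \<longrightarrow> norm w \<le> R"
proof -
  obtain R1 where R1: "\<And>w. Im w > 0 \<Longrightarrow> d \<le> - Im (G w) \<Longrightarrow> norm w \<le> R1"
    using Im_small_at_infinity[OF d] by blast
  have "\<exists>R. \<forall>w\<in>\<Omega>. Im w \<le> 0 \<longrightarrow> d \<le> - Im (Gt w) \<longrightarrow> norm (Gt w) \<le> B \<longrightarrow> norm w \<le> R"
  proof (cases "\<kappa> < 0")
    case True
    have "norm w \<le> (d / (2 * pi * c)) powr (1 / \<kappa>) + 2" if w: "w \<in> \<Omega>" "Im w \<le> 0" "d \<le> - Im (Gt w)" for w
    proof (rule norm_le_of_norm_v)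
      let ?n = "norm (v w)"
      have n: "?n > 0" using v_neq_0[OF w(1)] by simp
      have "d \<le> 2 * pi * c * Re (vp \<kappa> w)" using Im_Gt_lower[OF w(1,2)] w(3) by simp
      also have "\<dots> \<le> 2 * pi * c * ?n powr \<kappa>" using Re_vp_le[OF w(1)] c_pos by (intro mult_left_mono) auto
      finally have "d / (2 * pi * c) \<le> ?n powr \<kappa>" using c_pos by (simp add: field_simps)
      then have "(?n powr \<kappa>) powr (1 / \<kappa>) \<le> (d / (2 * pi * c)) powr (1 / \<kappa>)"
        using d c_pos True by (intro powr_mono2') auto
      then show "?n \<le> (d / (2 * pi * c)) powr (1 / \<kappa>)" using n True by (simp add: powr_powr)
    qed
    then show ?thesis by blast
  next
    case False
    then have k: "\<kappa> > 0" "\<sigma> = -1" using params by auto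
    obtain R2 where R2: "\<And>w. Im w < 0 \<Longrightarrow> R2 \<le> norm w \<Longrightarrow> norm (G w) \<le> R2"
      using bounded_at_infinity[OF k(1)] by blast
    define E where "E = ((\<bar>B\<bar> + \<bar>R2\<bar>) / (2 * pi * c)) powr (1 / \<kappa>) + 2"
    have E: "E \<ge> 2" by (simp add: E_def)
    have "norm w \<le> E + \<bar>R2\<bar>" if w: "w \<in> \<Omega>" "Im w \<le> 0" "norm (Gt w) \<le> B" for w
    proof (cases "Im w = 0")
      case True
      have vw: "v w = of_real (1 + \<sigma> * (Re w)\<^sup>2)" using True by (simp add: v_def complex_eq_iff power2_eq_square)
      have "v w \<notin> \<real>\<^sub>\<le>\<^sub>0" using w(1) by (simp add: \<Omega>_def)
      then have "1 + \<sigma> * (Re w)\<^sup>2 > 0" unfolding vw complex_nonpos_Reals_iff Re_complex_of_real Im_complex_of_real by simp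
      then have "1 - (Re w)\<^sup>2 > 0" using k by simp
      then have "\<bar>Re w\<bar> \<le> 1" using abs_square_le_1 by fastforce
      then have "norm w \<le> 1" using True cmod_le[of w] by simp
      then show ?thesis using E by simp
    next
      case im: False
      then have imw: "Im w < 0" using w by simp
      show ?thesis
      proof (cases "norm w \<le> \<bar>R2\<bar>")
        case False
        then have "norm (G w) \<le> R2" by (intro R2[OF imw]) simp
        then have Gw: "norm (G w) \<le> \<bar>R2\<bar>" by simp
        let ?n = "norm (v w)"
        have n: "?n > 0" using v_neq_0[OF w(1)] by simp
        have "2 * pi * c * ?n powr \<kappa> \<le> \<bar>R2\<bar> + \<bar>B\<bar>" using norm_v_powr_le[OF w(1) imw] Gw w(3) by linarith
        then have "?n powr \<kappa> \<le> (\<bar>B\<bar> + \<bar>R2\<bar>) / (2 * pi * c)" using c_pos by (simp add: field_simps)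
        then have "(?n powr \<kappa>) powr (1 / \<kappa>) \<le> ((\<bar>B\<bar> + \<bar>R2\<bar>) / (2 * pi * c)) powr (1 / \<kappa>)"
          using k by (intro powr_mono2) auto
        then have "?n \<le> ((\<bar>B\<bar> + \<bar>R2\<bar>) / (2 * pi * c)) powr (1 / \<kappa>)" using n k by (simp add: powr_powr)
        then have "norm w \<le> E" using norm_le_of_norm_v unfolding E_def by blast
        then show ?thesis by simp
      qed (use E in auto)
    qed
    then show ?thesis by blast
  qed
  then obtain R where R: "\<And>w. w \<in> \<Omega> \<Longrightarrow> Im w \<le> 0 \<Longrightarrow> d \<le> - Im (Gt w) \<Longrightarrow> norm (Gt w) \<le> B \<Longrightarrow> norm w \<le> R"
    by blast
  have "norm w \<le> max R R1" if "w \<in> D" "d \<le> - Im (Gt w)" "norm (Gt w) \<le> B" for w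
  proof (cases "Im w > 0")
    case True
    then show ?thesis using R1[of w] that by (simp add: Gt_def)
  next
    case False
    then show ?thesis using R[of w] that D2_subset by (force simp: D_def)
  qed
  then show ?thesis by blast
qed

text \<open>The heart of properness. A limit l outside \<open>D\<close> has Im l <= 0. If l is real
  off the open support, Im G tends to 0 on approach from above. On approach from below, either
  |\<kappa>| |arg v| tends to pi / 2 and Re v^\<kappa> to 0, or l is a zero of v and |v|^\<kappa>
  tends to 0 or to infinity. Each case contradicts the bounds on Gt.\<close>

lemma limit_in_D:
  assumes x: "\<And>n. x n \<in> D" "\<And>n. d \<le> - Im (Gt (x n))" "\<And>n. norm (Gt (x n)) \<le> B"
    and lim: "x \<longlonglongrightarrow> l" and d: "d > 0"
  shows "l \<in> D"
proof (rule ccontr)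
  assume l: "l \<notin> D"
  then have Iml: "Im l \<le> 0" by (auto simp: D_def not_less)
  have vlim: "(\<lambda>n. v (x n)) \<longlonglongrightarrow> v l"
    using continuous_on_tendsto_compose[OF continuous_on_v[of UNIV] lim] by simp
  define a where "a = (\<lambda>w. arccos (Re (v w) / norm (v w)))"
  have a_eq: "a w = \<bar>Im (Ln (v w))\<bar>" if "v w \<noteq> 0" for w using abs_Im_Ln_eq[OF that] by (simp add: a_def)
  \<comment> \<open>Inside \<open>\<Omega>\<close> this is failure of the condition defining
    \<open>D2\<close>; on the cut the angle is pi and
    \<open>2 * \<bar>\<kappa>\<bar> \<ge> 1\<close> takes over.\<close>
  have al: "2 * \<bar>\<kappa>\<bar> * a l \<ge> pi" if v0: "v l \<noteq> 0"
  proof (cases "l \<in> \<Omega>")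
    case True
    then show ?thesis using l a_eq[OF v0] by (auto simp: D_def D2_def not_less)
  next
    case False
    then have "Im (v l) = 0" "Re (v l) \<le> 0" by (auto simp: \<Omega>_def complex_nonpos_Reals_iff)
    then have "Re (v l) / norm (v l) = -1" using v0 by (auto simp: cmod_def complex_eq_iff)
    then have "a l = pi" by (simp add: a_def)
    then show ?thesis using mult_right_mono[OF \<kappa>(2), of pi] by simp
  qed
  have "\<forall>\<^sub>F n in sequentially. \<not> Im (x n) > 0"
  proof (cases "\<forall>\<^sub>F n in sequentially. \<not> Im (x n) > 0")
    case False
    then have freq: "\<exists>\<^sub>F n in sequentially. Im (x n) > 0" by (simp add: frequently_def)
    have "Im l \<ge> 0"
    proof (rule ccontr)
      assume "\<not> Im l \<ge> 0"
      then have "\<forall>\<^sub>F n in sequentially. Im (x n) < 0"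
        using tendsto_Im[OF lim] by (intro order_tendstoD) auto
      then have "\<forall>\<^sub>F n in sequentially. \<not> Im (x n) > 0" by eventually_elim simp
      then show False using False by simp
    qed
    then have Iml0: "Im l = 0" using Iml by simp
    then have l_eq: "l = of_real (Re l)" by (simp add: complex_eq_iff)
    have vl: "v l = of_real (1 + \<sigma> * (Re l)\<^sup>2)" using Iml0 by (simp add: v_def complex_eq_iff power2_eq_square)
    \<comment> \<open>Real points with v > 0 have angle 0 and belong to \<open>D2\<close>, so l is
      not one of them.\<close>
    have "1 + \<sigma> * (Re l)\<^sup>2 \<le> 0"
    proof (rule ccontr)
      assume *: "\<not> 1 + \<sigma> * (Re l)\<^sup>2 \<le> 0"
      then have "v l \<notin> \<real>\<^sub>\<le>\<^sub>0"
        unfolding vl complex_nonpos_Reals_iff Re_complex_of_real Im_complex_of_real by simp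
      then have "l \<in> \<Omega>" by (simp add: \<Omega>_def)
      moreover have Ln_real: "Im (Ln (complex_of_real r)) = 0" if "r > 0" for r using that by (simp add: Ln_of_real)
      have "0 < 1 + \<sigma> * (Re l)\<^sup>2" using * by simp
      from Ln_real[OF this] have "Im (Ln (v l)) = 0" unfolding vl .
      ultimately show False using l by (auto simp: D_def D2_def)
    qed
    from Im_small_off_support[OF this d] have "\<forall>\<^sub>F w in nhds l. Im w > 0 \<longrightarrow> - Im (G w) < d"
      using l_eq by simp
    then have "\<forall>\<^sub>F n in sequentially. Im (x n) > 0 \<longrightarrow> - Im (G (x n)) < d"
      using lim by (rule eventually_compose_filterlim)
    then have "\<forall>\<^sub>F n in sequentially. \<not> Im (x n) > 0"
    proof eventually_elim
      case (elim n)
      then show ?case using x(2)[of n] by (auto simp: Gt_def)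
    qed
    then show ?thesis .
  qed
  then have low: "\<forall>\<^sub>F n in sequentially. Im (x n) \<le> 0 \<and> x n \<in> D2"
  proof eventually_elim
    case (elim n)
    then show ?case using x(1)[of n] by (auto simp: D_def not_less)
  qed
  have bound: "d \<le> 2 * pi * c * Re (vp \<kappa> (x n))" if "Im (x n) \<le> 0" "x n \<in> D2" for n
    using Im_Gt_lower[of "x n"] that x(2)[of n] D2_subset by force
  show False
  proof (cases "v l = 0")
    case False
    have alim: "(\<lambda>n. a (x n)) \<longlonglongrightarrow> a l"
    proof -
      have q: "(\<lambda>n. Re (v (x n)) / norm (v (x n))) \<longlonglongrightarrow> Re (v l) / norm (v l)"
        using False by (intro tendsto_intros vlim) auto
      have bd: "-1 \<le> Re (v w) / norm (v w)" "Re (v w) / norm (v w) \<le> 1" for w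
      proof -
        have "\<bar>Re (v w) / norm (v w)\<bar> \<le> 1"
          using abs_Re_le_cmod[of "v w"] by (simp add: divide_le_eq_1)
        then show "-1 \<le> Re (v w) / norm (v w)" "Re (v w) / norm (v w) \<le> 1" by linarith+
      qed
      show ?thesis unfolding a_def
        by (rule continuous_on_tendsto_compose[OF continuous_on_arccos' q]) (use bd in auto)
    qed
    have ev: "\<forall>\<^sub>F n in sequentially. 2 * \<bar>\<kappa>\<bar> * a (x n) \<le> pi"
      using low by eventually_elim (use v_neq_0 a_eq in \<open>auto simp: D2_def\<close>)
    have "2 * \<bar>\<kappa>\<bar> * a l \<le> pi"
      by (rule tendsto_upperbound[OF _ ev]) (intro tendsto_intros alim, simp)
    \<comment> \<open>Squeezed between the condition on \<open>D2\<close> and l outside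
      \<open>D\<close>, the angle is exactly critical, so the cosine in Re v^\<kappa> vanishes in
      the limit.\<close>
    then have half: "\<bar>\<kappa>\<bar> * a l = pi / 2" using al[OF False] by simp
    have "(\<lambda>n. 2 * pi * c * (norm (v (x n)) powr \<kappa> * cos (\<bar>\<kappa>\<bar> * a (x n)))) \<longlonglongrightarrow>
        2 * pi * c * (norm (v l) powr \<kappa> * cos (\<bar>\<kappa>\<bar> * a l))"
      using False by (intro tendsto_intros vlim alim) auto
    moreover have "\<forall>\<^sub>F n in sequentially. d \<le> 2 * pi * c * (norm (v (x n)) powr \<kappa> * cos (\<bar>\<kappa>\<bar> * a (x n)))"
      using low
    proof eventually_elim
      case (elim n)
      then have "v (x n) \<noteq> 0" using v_neq_0 D2_subset by blast
      then show ?case using bound[of n] elim Re_powr_of_real[of "v (x n)" \<kappa>] by (simp add: vp_def a_def)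
    qed
    ultimately have "d \<le> 2 * pi * c * (norm (v l) powr \<kappa> * cos (\<bar>\<kappa>\<bar> * a l))"
      by (intro tendsto_lowerbound) auto
    then show False using d half by simp
  next
    case v0: True
    have n0: "(\<lambda>n. norm (v (x n))) \<longlonglongrightarrow> 0" using tendsto_norm[OF vlim] v0 by simp
    show False
    proof (cases "\<kappa> > 0")
      case True
      have "(\<lambda>n. 2 * pi * c * (norm (v (x n)) powr \<kappa>)) \<longlonglongrightarrow> 2 * pi * c * (0 powr \<kappa>)"
        using True by (intro tendsto_intros n0 tendsto_powr') auto
      moreover have "\<forall>\<^sub>F n in sequentially. d \<le> 2 * pi * c * (norm (v (x n)) powr \<kappa>)"
        using low
      proof eventually_elim
        case (elim n)
        have "2 * pi * c * Re (vp \<kappa> (x n)) \<le> 2 * pi * c * (norm (v (x n)) powr \<kappa>)"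
          using Re_vp_le[of "x n"] elim D2_subset c_pos by (intro mult_left_mono) auto
        then show ?case using elim by (intro order_trans[OF bound[of n]]) auto
      qed
      ultimately have "d \<le> 2 * pi * c * (0 powr \<kappa>)" by (intro tendsto_lowerbound) auto
      then show False using d True by simp
    next
      case False
      then have k: "\<sigma> = 1" "\<kappa> < 0" using params by auto
      have "v l = 1 + l\<^sup>2" using v_def[of l] k(1) by (metis mult_1 of_real_1)
      then have "(l - \<i>) * (l + \<i>) = v l" by (simp only: algebra_simps power2_eq_square) simp
      then have "(l - \<i>) * (l + \<i>) = 0" using v0 by simp
      then consider "l = \<i>" | "l = - \<i>" by (metis add_eq_0_iff2 eq_iff_diff_eq_0 mult_eq_0_iff)
      then have "l = - \<i>" by cases (use Iml in auto)
      \<comment> \<open>At distance 1/2 below the real axis |G| <= 2, so the jump formula turns the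
        bound on Gt into one on |v|^\<kappa>, which blows up at -i.\<close>
      then have "Im l < - (1 / 2)" by simp
      then have "\<forall>\<^sub>F n in sequentially. Im (x n) < - (1 / 2)"
        using tendsto_Im[OF lim] by (intro order_tendstoD) auto
      then have ev: "\<forall>\<^sub>F n in sequentially. norm (v (x n)) powr \<kappa> \<le> (2 + B) / (2 * pi * c)"
        using low
      proof eventually_elim
        case (elim n)
        let ?w = "x n"
        have w: "?w \<in> \<Omega>" using elim D2_subset by blast
        have im: "Im ?w < 0" using elim by simp
        have "norm (G ?w) \<le> 1 / \<bar>Im ?w\<bar>" by (rule norm_cauchy_transform_le) (use im in simp)
        also have "\<dots> \<le> 1 / (1 / 2)" using elim by (intro divide_left_mono) auto
        finally have Gw: "norm (G ?w) \<le> 2" by simp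
        have "2 * pi * c * norm (v ?w) powr \<kappa> \<le> 2 + B" using norm_v_powr_le[OF w im] Gw x(3)[of n] by linarith
        then show ?case using c_pos by (simp add: field_simps)
      qed
      have "filterlim (\<lambda>n. norm (v (x n))) (at_right 0) sequentially"
        unfolding filterlim_at using n0 low
        by (auto elim!: eventually_mono dest!: subsetD[OF D2_subset] v_neq_0)
      moreover have "filterlim (\<lambda>u::real. u powr \<kappa>) at_top (at_right 0)"
        using k(2) by real_asymp
      ultimately have "filterlim (\<lambda>n. norm (v (x n)) powr \<kappa>) at_top sequentially"
        by (rule filterlim_compose[rotated])
      then have "\<forall>\<^sub>F n in sequentially. norm (v (x n)) powr \<kappa> > (2 + B) / (2 * pi * c)"
        by (simp add: filterlim_at_top_dense)
      then have "\<forall>\<^sub>F n in sequentially. False" using ev by eventually_elim simp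
      then show False by simp
    qed
  qed
qed

lemma compact_preimage:
  assumes L: "compact L" "L \<subseteq> {z. Im z < 0}"
  shows "compact {w \<in> D. Gt w \<in> L}"
proof (cases "L = {}")
  case False
  obtain z0 where z0: "z0 \<in> L" "\<And>z. z \<in> L \<Longrightarrow> Im z \<le> Im z0"
    using continuous_attains_sup[OF L(1) False continuous_on_Im[OF continuous_on_id]] by blast
  define d where "d = - Im z0"
  have d: "d > 0" "\<And>z. z \<in> L \<Longrightarrow> d \<le> - Im z" using z0 L(2) by (auto simp: d_def)
  obtain B where B: "\<And>z. z \<in> L \<Longrightarrow> norm z \<le> B"
    using compact_imp_bounded[OF L(1)] by (auto simp: bounded_iff)
  have "bounded {w \<in> D. Gt w \<in> L}"
    using bounded_preimage[OF d(1), of B] d(2) B unfolding bounded_iff by blast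
  moreover have "closed {w \<in> D. Gt w \<in> L}"
    unfolding closed_sequential_limits
  proof (intro allI impI, elim conjE)
    fix x l assume x: "\<forall>n. x n \<in> {w \<in> D. Gt w \<in> L}" and lim: "x \<longlonglongrightarrow> l"
    have l: "l \<in> D"
      by (rule limit_in_D[OF _ _ _ lim d(1), of B]) (use x d(2) B in auto)
    have "isCont Gt l"
      using holomorphic_on_imp_continuous_on[OF Gt_holomorphic] l open_D by (simp add: continuous_on_eq_continuous_at)
    then have "(\<lambda>n. Gt (x n)) \<longlonglongrightarrow> Gt l" by (rule isCont_tendsto_compose[OF _ lim])
    then have "Gt l \<in> L" using compact_imp_closed[OF L(1)] x by (auto intro: closed_sequentially)
    then show "l \<in> {w \<in> D. Gt w \<in> L}" using l by simp
  qed
  ultimately show ?thesis by (simp add: compact_eq_bounded_closed)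
qed simp

section \<open>The two bounds for the indicator\<close>

lemma in_BB_range_1: "M \<in> BB_range 1"
proof (rule BB_range_1I[OF real_distribution_axioms open_D _ Gt_holomorphic])
  show "{z. Im z > 0} \<subseteq> D" by (auto simp: D_def)
  show "Gt z = G z" if "Im z > 0" for z using that by (simp add: Gt_def)
qed (use compact_preimage deriv_Gt_neq_0 in blast)+

lemma Re_cauchy_imaginary: "y > 0 \<Longrightarrow> Re (G (\<i> * of_real y)) = 0"
  using odd[of "\<i> * of_real y"] cauchy_transform_cnj[of "\<i> * of_real y"] by (auto simp: complex_eq_iff)

lemma v_imaginary: "v (\<i> * of_real y) = of_real (1 - \<sigma> * y\<^sup>2)"
  by (simp add: v_def power_mult_distrib)

lemma imaginary_in_D: "1 - \<sigma> * y\<^sup>2 > 0 \<Longrightarrow> \<i> * of_real y \<in> D"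
  unfolding D_def D2_def \<Omega>_def mem_Collect_eq Un_iff v_imaginary
  by (auto simp: Ln_of_real complex_nonpos_Reals_iff simp flip: of_real_power of_real_mult of_real_diff)

text \<open>For \<open>\<sigma> = -1\<close> the whole imaginary axis lies in \<open>D\<close> and
  there is no exit. For \<open>\<sigma> = 1\<close> the exit can only be at -i, near which (x + 1)
  |Gt| dominates a multiple of (x + 1)^(1 + \<kappa>) up to a vanishing term; this diverges because
  \<open>\<kappa> < -1\<close>.\<close>

lemma le_1_of_BB_range:
  assumes "M \<in> BB_range t" shows "t \<le> 1"
proof (rule BB_range_le_1[OF real_distribution_axioms assms Re_cauchy_imaginary open_D _ Gt_holomorphic])
  fix y :: real assume "y \<ge> 0"
  then show "\<i> * of_real y \<in> D" using imaginary_in_D[of 0] by (cases "y = 0") (auto simp: D_def)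
next
  fix y :: real assume "y > 0"
  then show "Gt (\<i> * of_real y) = G (\<i> * of_real y)" by (simp add: Gt_def)
next
  fix b :: real assume b: "b < 0" and in_D: "\<And>y. y > b \<Longrightarrow> \<i> * of_real y \<in> D" and notD: "\<i> * of_real b \<notin> D"
  have k: "\<sigma> = 1" "\<kappa> < -1"
  proof -
    have "\<sigma> \<noteq> -1"
    proof
      assume "\<sigma> = -1"
      then have "1 - \<sigma> * b\<^sup>2 > 0" by (simp add: add_pos_nonneg)
      then show False using imaginary_in_D notD by blast
    qed
    then show "\<sigma> = 1" "\<kappa> < -1" using params by auto
  qed
  have "b \<le> -1"
  proof (rule ccontr)
    assume "\<not> b \<le> -1"
    then have "b\<^sup>2 < 1" using b by (simp add: abs_square_less_1)
    then show False using imaginary_in_D[of b] notD k by simp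
  qed
  moreover have "\<not> b < -1"
  proof
    assume "b < -1"
    then have "\<i> * of_real (-1) \<in> D" using in_D[of "-1"] by simp
    moreover have "v (\<i> * of_real (-1)) = 0" unfolding v_imaginary using k by simp
    ultimately show False by (auto simp: D_def D2_def \<Omega>_def)
  qed
  ultimately have b1: "b = -1" by simp
  \<comment> \<open>The factor \<open>2 powr \<kappa>\<close> comes from 1 - x^2 <= 2 (x + 1), and
    the term -2 (x + 1) below from |G| <= 2 when x < -1/2.\<close>
  define p where "p = 2 * pi * c * 2 powr \<kappa>"
  have p: "p > 0" using c_pos by (simp add: p_def)
  have "filterlim (\<lambda>x. p * (x + 1) powr (1 + \<kappa>) - 2 * (x + 1)) at_top (at_right (-1))"
  proof -
    have 1: "filterlim (\<lambda>x::real. x + 1) (at_right 0) (at_right (-1))"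
      unfolding filterlim_at by (auto intro!: tendsto_eq_intros simp: eventually_at_right_less[of "-1::real"] eventually_at_filter)
    have 2: "filterlim (\<lambda>u. p * u powr (1 + \<kappa>) - 2 * u) at_top (at_right 0)"
      using k(2) p by real_asymp
    show ?thesis by (rule filterlim_compose[OF 2 1])
  qed
  moreover have "\<forall>\<^sub>F x in at_right (-1). p * (x + 1) powr (1 + \<kappa>) - 2 * (x + 1) \<le> (x + 1) * norm (Gt (\<i> * of_real x))"
  proof -
    have "\<forall>\<^sub>F x in at_right (-1). x \<in> {-1<..<- (1/2)::real}" by (rule eventually_at_right_real) simp
    then show ?thesis
    proof eventually_elim
      case (elim x)
      let ?w = "\<i> * complex_of_real x"
      have x: "-1 < x" "x < -1/2" using elim by auto
      have x1: "1 - x\<^sup>2 > 0" using x by (simp add: abs_square_less_1)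
      have vw: "v ?w = of_real (1 - x\<^sup>2)" using v_imaginary[of x] k(1) by (metis mult_1)
      have w: "?w \<in> \<Omega>" "Im ?w < 0" unfolding \<Omega>_def mem_Collect_eq vw using x1 x
        by (auto simp: complex_nonpos_Reals_iff simp del: of_real_diff of_real_power)
      have "norm (G ?w) \<le> 1 / \<bar>Im ?w\<bar>" by (rule norm_cauchy_transform_le) (use w in auto)
      also have "\<dots> \<le> 1 / (1 / 2)" using x by (intro divide_left_mono) auto
      finally have Gw: "norm (G ?w) \<le> 2" by simp
      have "norm (v ?w) = 1 - x\<^sup>2" unfolding vw norm_of_real using x1 by simp
      then have 1: "2 * pi * c * (1 - x\<^sup>2) powr \<kappa> \<le> 2 + norm (Gt ?w)" using norm_v_powr_le[OF w] Gw by simp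
      have "1 - x\<^sup>2 = (1 - x) * (x + 1)" by (simp add: algebra_simps power2_eq_square)
      also have "\<dots> \<le> 2 * (x + 1)" using x by (intro mult_right_mono) auto
      finally have "(2 * (x + 1)) powr \<kappa> \<le> (1 - x\<^sup>2) powr \<kappa>"
        using k x1 by (intro powr_mono2') auto
      then have "2 * pi * c * (2 * (x + 1)) powr \<kappa> \<le> 2 * pi * c * (1 - x\<^sup>2) powr \<kappa>"
        using c_pos by (intro mult_left_mono) auto
      moreover have "p * (x + 1) powr \<kappa> = 2 * pi * c * (2 * (x + 1)) powr \<kappa>"
        unfolding p_def powr_mult by simp
      ultimately have "p * (x + 1) powr \<kappa> \<le> 2 + norm (Gt ?w)" using 1 by linarith
      then have "(x + 1) * (p * (x + 1) powr \<kappa>) \<le> (x + 1) * (2 + norm (Gt ?w))"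
        using x by (intro mult_left_mono) auto
      moreover have "(x + 1) powr (1 + \<kappa>) = (x + 1) * (x + 1) powr \<kappa>" using x by (simp add: powr_add)
      ultimately show ?case by (simp add: algebra_simps)
    qed
  qed
  ultimately have "filterlim (\<lambda>x. (x + 1) * norm (Gt (\<i> * of_real x))) at_top (at_right (-1))"
    by (rule filterlim_at_top_mono)
  then show "filterlim (\<lambda>x. (x - b) * norm (Gt (\<i> * of_real x))) at_top (at_right b)" by (simp add: b1)
qed

theorem free_divisibility_indicator_eq_1: "free_divisibility_indicator M = 1"
  unfolding free_divisibility_indicator_def
proof (rule antisym)
  show "(SUP t\<in>{t. 0 \<le> t \<and> M \<in> BB_range t}. ennreal t) \<le> 1"
  proof (rule SUP_least)
    fix t assume "t \<in> {t. 0 \<le> t \<and> M \<in> BB_range t}"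
    then have "t \<le> 1" using le_1_of_BB_range by simp
    then show "ennreal t \<le> 1" by (metis ennreal_1 ennreal_leI)
  qed
  have "ennreal 1 \<le> (SUP t\<in>{t. 0 \<le> t \<and> M \<in> BB_range t}. ennreal t)"
    by (rule SUP_upper) (simp add: in_BB_range_1)
  then show "1 \<le> (SUP t\<in>{t. 0 \<le> t \<and> M \<in> BB_range t}. ennreal t)" by simp
qed

end

section \<open>Cauchy transforms of even densities\<close>

locale even_density =
  fixes f :: "real \<Rightarrow> real"
  assumes f_measurable [measurable]: "f \<in> borel_measurable borel"
    and f_nonneg: "\<And>x. f x \<ge> 0"
    and f_even: "\<And>x. f (- x) = f x"
    and f_total: "(\<integral>\<^sup>+x. ennreal (f x) \<partial>lborel) = 1"
begin

definition M :: "real measure" where "M = density lborel (\<lambda>x. ennreal (f x))"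

sublocale real_distribution M
proof -
  have "prob_space M"
    by (rule prob_spaceI) (simp add: M_def emeasure_density f_total)
  then show "real_distribution M"
    by (simp add: real_distribution_def real_distribution_axioms_def M_def)
qed

lemma f_integrable: "integrable lborel f" and f_integral: "(LINT x|lborel. f x) = 1"
proof -
  show i: "integrable lborel f"
    by (rule integrableI_nonneg) (use f_nonneg f_total in auto)
  have "ennreal (LINT x|lborel. f x) = 1"
    using nn_integral_eq_integral[OF i] f_nonneg f_total by simp
  then show "(LINT x|lborel. f x) = 1"
    by (metis ennreal_1 ennreal_inj integral_nonneg_AE f_nonneg AE_I2 zero_le_one)
qed

lemma integral_M:
  fixes g :: "real \<Rightarrow> 'b::{banach, second_countable_topology}"
  assumes "g \<in> borel_measurable borel"
  shows "(LINT x|M. g x) = (LINT x|lborel. f x *\<^sub>R g x)"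
  unfolding M_def by (rule integral_density) (use assms f_nonneg in auto)

lemma integrable_M:
  fixes g :: "real \<Rightarrow> 'b::{banach, second_countable_topology}"
  assumes "g \<in> borel_measurable borel"
  shows "integrable M g \<longleftrightarrow> integrable lborel (\<lambda>x. f x *\<^sub>R g x)"
  unfolding M_def by (rule integrable_density) (use assms f_nonneg in auto)

lemma cauchy_transform_odd: "cauchy_transform M (- z) = - cauchy_transform M z"
proof -
  have "cauchy_transform M (- z) = (LINT x|lborel. f x *\<^sub>R (1 / (- z - of_real x)))"
    unfolding cauchy_transform_def by (rule integral_M) simp
  also have "\<dots> = \<bar>-1\<bar> *\<^sub>R (LINT x|lborel. f (0 + (-1) * x) *\<^sub>R (1 / (- z - of_real (0 + (-1) * x))))"
    by (rule lborel_integral_real_affine) simp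
  also have "\<dots> = (LINT x|lborel. - (f x *\<^sub>R (1 / (z - of_real x))))"
  proof -
    have "1 / (of_real x - z) = - (1 / (z - of_real x))" for x :: real
      by (metis minus_diff_eq minus_divide_right)
    then show ?thesis by (simp add: f_even)
  qed
  also have "\<dots> = - cauchy_transform M z"
    unfolding cauchy_transform_def by (subst integral_M) simp_all
  finally show ?thesis .
qed

section \<open>Poisson estimates for the imaginary part\<close>

lemma poisson_lborel:
  assumes z: "Im z > 0"
  shows "integrable lborel (\<lambda>x. Im z / (norm (z - of_real x))\<^sup>2)"
    and "(LINT x|lborel. Im z / (norm (z - of_real x))\<^sup>2) = pi"
proof -
  show "integrable lborel (\<lambda>x. Im z / (norm (z - of_real x))\<^sup>2)"
    by (rule integrable_poisson_kernel_lborel[OF z])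
  have "(LINT x|lborel. 1 * complex_of_real (Im z / (norm (z - of_real x))\<^sup>2)) = complex_of_real pi * 1"
    by (rule poisson_upper_half_plane(2)[where g = "\<lambda>_. 1" and B = 1 and e = 1]) (use z in auto)
  then have "complex_of_real (LINT x|lborel. Im z / (norm (z - of_real x))\<^sup>2) = of_real pi"
    unfolding mult_1 mult_1_right integral_complex_of_real .
  then show "(LINT x|lborel. Im z / (norm (z - of_real x))\<^sup>2) = pi" by (simp only: of_real_eq_iff)
qed

lemma Im_cauchy_transform_lborel:
  assumes z: "Im z > 0"
  shows "- Im (cauchy_transform M z) = (LINT x|lborel. f x * (Im z / (norm (z - of_real x))\<^sup>2))"
proof -
  have "- Im (cauchy_transform M z) = (LINT x|M. Im z * (1 / (norm (z - of_real x))\<^sup>2))"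
    using z by (subst integral_mult_right_zero) (simp add: Im_cauchy_transform)
  also have "\<dots> = (LINT x|lborel. f x *\<^sub>R (Im z * (1 / (norm (z - of_real x))\<^sup>2)))"
    by (rule integral_M) simp
  finally show ?thesis by simp
qed

text \<open>Split the Poisson integral at distance h: near Re z the density is at most B and the
  kernel has mass at most pi; farther away the kernel is at most Im z / h^2 and the density has mass
  at most 1.\<close>

lemma Im_cauchy_transform_le:
  assumes z: "Im z > 0" and h: "h > 0" and B: "B \<ge> 0" "\<And>x. \<bar>x - Re z\<bar> < h \<Longrightarrow> f x \<le> B"
  shows "- Im (cauchy_transform M z) \<le> B * pi + Im z / h\<^sup>2"
proof -
  let ?P = "\<lambda>x. Im z / (norm (z - complex_of_real x))\<^sup>2"
  have P0: "?P x \<ge> 0" for x using z by simp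
  have "integrable M (\<lambda>x. Im z * (1 / (norm (z - of_real x))\<^sup>2))"
    using z by (intro integrable_mult_right integrable_poisson_kernel) simp
  then have i: "integrable lborel (\<lambda>x. f x * ?P x)" by (subst (asm) integrable_M) auto
  have "- Im (cauchy_transform M z) = (LINT x|lborel. f x * ?P x)" by (rule Im_cauchy_transform_lborel[OF z])
  also have "\<dots> \<le> (LINT x|lborel. B * ?P x + Im z / h\<^sup>2 * f x)"
  proof (rule integral_mono[OF i])
    show "integrable lborel (\<lambda>x. B * ?P x + Im z / h\<^sup>2 * f x)"
      by (intro Bochner_Integration.integrable_add integrable_mult_right poisson_lborel z f_integrable)
    fix x
    show "f x * ?P x \<le> B * ?P x + Im z / h\<^sup>2 * f x"
    proof (cases "\<bar>x - Re z\<bar> < h")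
      case True
      have "f x * ?P x \<le> B * ?P x" using B(2)[OF True] P0 by (rule mult_right_mono)
      moreover have "0 \<le> Im z / h\<^sup>2 * f x" using z f_nonneg by simp
      ultimately show ?thesis by simp
    next
      case False
      then have "h \<le> \<bar>Re (z - of_real x)\<bar>" by simp
      also have "\<dots> \<le> norm (z - of_real x)" by (rule abs_Re_le_cmod)
      finally have "h\<^sup>2 \<le> (norm (z - of_real x))\<^sup>2" using h by (intro power_mono) auto
      then have "?P x \<le> Im z / h\<^sup>2" using h z by (intro divide_left_mono) (auto intro!: mult_pos_pos elim: less_le_trans[rotated])
      then have "f x * ?P x \<le> f x * (Im z / h\<^sup>2)" using f_nonneg by (rule mult_left_mono)
      moreover have "0 \<le> B * ?P x" by (rule mult_nonneg_nonneg[OF B(1) P0])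
      moreover have "f x * (Im z / h\<^sup>2) = Im z / h\<^sup>2 * f x" by (rule mult.commute)
      ultimately show ?thesis by linarith
    qed
  qed
  also have "\<dots> = B * pi + Im z / h\<^sup>2"
    using poisson_lborel[OF z] f_integrable f_integral
    by (subst Bochner_Integration.integral_add) (auto simp del: times_divide_eq_right times_divide_eq_left)
  finally show ?thesis .
qed

lemma Im_cauchy_transform_small_at_infinity:
  assumes lim: "(f \<longlongrightarrow> 0) at_infinity" and d: "d > 0"
  shows "\<exists>B. \<forall>w. Im w > 0 \<longrightarrow> d \<le> - Im (cauchy_transform M w) \<longrightarrow> norm w \<le> B"
proof -
  have "\<forall>\<^sub>F x in at_infinity. f x < d / (4 * pi)"
    using order_tendstoD(2)[OF lim, of "d / (4 * pi)"] d by simp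
  then obtain R where R: "\<And>x. norm x \<ge> R \<Longrightarrow> f x < d / (4 * pi)" unfolding eventually_at_infinity by blast
  \<comment> \<open>Since Im w <= 1 / d, this makes the far term at most d / 4, as is the near
    term.\<close>
  define h where "h = 2 / d"
  have h: "h > 0" using d by (simp add: h_def)
  have "norm w \<le> \<bar>R\<bar> + h + 1 / d" if w: "Im w > 0" "d \<le> - Im (cauchy_transform M w)" for w
  proof -
    have "d \<le> 1 / Im w"
      using w norm_cauchy_transform_le[of w] abs_Im_le_cmod[of "cauchy_transform M w"] by simp
    then have Imw: "Im w \<le> 1 / d" using w d by (simp add: field_simps)
    have "\<bar>Re w\<bar> \<le> \<bar>R\<bar> + h"
    proof (rule ccontr)
      assume *: "\<not> \<bar>Re w\<bar> \<le> \<bar>R\<bar> + h"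
      have "- Im (cauchy_transform M w) \<le> d / (4 * pi) * pi + Im w / h\<^sup>2"
      proof (rule Im_cauchy_transform_le[OF w(1) h])
        fix x assume "\<bar>x - Re w\<bar> < h"
        then have "norm x \<ge> R" using * by simp
        then show "f x \<le> d / (4 * pi)" using R by fastforce
      qed (use d in simp)
      also have "Im w / h\<^sup>2 \<le> (1 / d) / h\<^sup>2" using Imw by (rule divide_right_mono) simp
      also have "d / (4 * pi) * pi + (1 / d) / h\<^sup>2 = d / 2"
        using d by (simp add: h_def power2_eq_square)
      also have "\<dots> < d" using d by simp
      finally show False using w(2) by simp
    qed
    then show ?thesis using Imw cmod_le[of w] w by simp
  qed
  then show ?thesis by blast
qed

lemma Im_cauchy_transform_small_at_zero_of_density:
  assumes cont: "isCont f x" "f x = 0" and d: "d > 0"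
  shows "\<forall>\<^sub>F w in nhds (of_real x). Im w > 0 \<longrightarrow> - Im (cauchy_transform M w) < d"
proof -
  have "\<forall>\<^sub>F y in nhds x. f y < d / (4 * pi)"
  proof -
    have "(f \<longlongrightarrow> f x) (nhds x)" using cont(1) by (simp only: isCont_def tendsto_at_iff_tendsto_nhds)
    then have "(f \<longlongrightarrow> 0) (nhds x)" using cont(2) by simp
    then show ?thesis using d by (intro order_tendstoD) auto
  qed
  then obtain e where e: "e > 0" "\<And>y. dist y x < e \<Longrightarrow> f y < d / (4 * pi)" unfolding eventually_nhds_metric by blast
  define h where "h = e / 2"
  have h: "h > 0" using e by (simp add: h_def)
  \<comment> \<open>\<open>d * h\<^sup>2 / 4\<close> makes the far term at most d / 4;
    \<open>r \<le> h\<close> keeps the window of radius h around Re w within distance e of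
    x.\<close>
  define r where "r = min h (d * h\<^sup>2 / 4)"
  have r: "r > 0" "r \<le> h" "r \<le> d * h\<^sup>2 / 4" using h d by (auto simp: r_def)
  have "- Im (cauchy_transform M w) < d" if w: "dist w (of_real x) < r" "Im w > 0" for w
  proof -
    have re: "\<bar>Re w - x\<bar> < r" and im: "\<bar>Im w\<bar> < r"
      using w(1) abs_Re_le_cmod[of "w - of_real x"] abs_Im_le_cmod[of "w - of_real x"] by (auto simp: dist_norm)
    have "- Im (cauchy_transform M w) \<le> d / (4 * pi) * pi + Im w / h\<^sup>2"
    proof (rule Im_cauchy_transform_le[OF w(2) h])
      fix y assume "\<bar>y - Re w\<bar> < h"
      then have "\<bar>y - x\<bar> < e" using re r(2) unfolding h_def by linarith
      then have "dist y x < e" by (simp add: dist_real_def)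
      then show "f y \<le> d / (4 * pi)" using e(2) by fastforce
    qed (use d in simp)
    also have "Im w / h\<^sup>2 \<le> (d * h\<^sup>2 / 4) / h\<^sup>2" using im r by (intro divide_right_mono) auto
    also have "d / (4 * pi) * pi + (d * h\<^sup>2 / 4) / h\<^sup>2 = d / 2" using h by simp
    also have "\<dots> < d" using d by simp
    finally show ?thesis by simp
  qed
  then show ?thesis unfolding eventually_nhds_metric using r by blast
qed

lemma Re_cauchy_transform_imaginary: "Re (cauchy_transform M (\<i> * of_real y)) = 0"
  using cauchy_transform_odd[of "\<i> * of_real y"] cauchy_transform_cnj[of "\<i> * of_real y"]
  by (auto simp: complex_eq_iff)

text \<open>Rescaling x = y u turns the Poisson kernel at i y into the fixed kernel 1 / (1 + u^2),
  so dominated convergence applies; the real part vanishes by oddness.\<close>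

lemma cauchy_transform_limit_0:
  assumes bnd: "\<And>x. f x \<le> B" and cont: "isCont f 0"
  shows "((\<lambda>y. cauchy_transform M (\<i> * of_real y)) \<longlongrightarrow> - \<i> * of_real (pi * f 0)) (at_right 0)"
proof -
  let ?P = "\<lambda>u. Im \<i> / (norm (\<i> - complex_of_real u))\<^sup>2"
  have B: "B \<ge> 0" using bnd[of 0] f_nonneg[of 0] by linarith
  have eq: "- Im (cauchy_transform M (\<i> * of_real y)) = (LINT u|lborel. f (y * u) * ?P u)" if y: "y > 0" for y
  proof -
    have "- Im (cauchy_transform M (\<i> * of_real y))
        = (LINT x|lborel. f x * (Im (\<i> * of_real y) / (norm (\<i> * of_real y - complex_of_real x))\<^sup>2))"
      by (rule Im_cauchy_transform_lborel) (use y in simp)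
    also have "\<dots> = \<bar>y\<bar> *\<^sub>R (LINT u|lborel. f (0 + y * u) * (Im (\<i> * of_real y) / (norm (\<i> * of_real y - complex_of_real (0 + y * u)))\<^sup>2))"
      by (rule lborel_integral_real_affine) (use y in simp)
    also have "\<dots> = y * (LINT u|lborel. f (y * u) * (y / (y\<^sup>2 + (y * u)\<^sup>2)))"
      unfolding cmod_power2 using y by (simp add: add.commute)
    also have "\<dots> = (LINT u|lborel. y * (f (y * u) * (y / (y\<^sup>2 + (y * u)\<^sup>2))))"
      by (rule integral_mult_right_zero[symmetric])
    also have "\<dots> = (LINT u|lborel. f (y * u) * ?P u)"
    proof (rule Bochner_Integration.integral_cong[OF refl])
      fix u
      have "y * (y / (y\<^sup>2 + (y * u)\<^sup>2)) = y\<^sup>2 * 1 / (y\<^sup>2 * (1 + u\<^sup>2))"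
        by (simp add: power_mult_distrib distrib_left power2_eq_square)
      also have "\<dots> = 1 / (1 + u\<^sup>2)" using y by simp
      also have "\<dots> = ?P u" unfolding cmod_power2 by (simp add: add.commute)
      finally show "y * (f (y * u) * (y / (y\<^sup>2 + (y * u)\<^sup>2))) = f (y * u) * ?P u" by (metis mult.left_commute)
    qed
    finally show ?thesis .
  qed
  have iP: "integrable lborel ?P" by (rule poisson_lborel) simp
  have "((\<lambda>s. LINT u|lborel. f (inverse s * u) * ?P u) \<longlongrightarrow> (LINT u|lborel. f 0 * ?P u)) at_top"
  proof (rule integral_dominated_convergence_at_top[where w = "\<lambda>u. B * ?P u"])
    show "integrable lborel (\<lambda>u. B * ?P u)" using iP by (rule integrable_mult_right)
    show "\<forall>\<^sub>F s in at_top. AE u in lborel. norm (f (inverse s * u) * ?P u) \<le> B * ?P u"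
      using bnd f_nonneg by (intro always_eventually allI AE_I2) (auto simp: abs_mult intro!: divide_right_mono)
    show "AE u in lborel. ((\<lambda>s. f (inverse s * u) * ?P u) \<longlongrightarrow> f 0 * ?P u) at_top"
    proof (rule AE_I2)
      fix u :: real
      have "((\<lambda>s. inverse s * u) \<longlongrightarrow> 0 * u) at_top"
        by (intro tendsto_intros tendsto_inverse_0_at_top filterlim_ident)
      then have "((\<lambda>s. f (inverse s * u)) \<longlongrightarrow> f 0) at_top"
        using isCont_tendsto_compose[OF cont] by simp
      then show "((\<lambda>s. f (inverse s * u) * ?P u) \<longlongrightarrow> f 0 * ?P u) at_top" by (intro tendsto_intros)
    qed
  qed auto
  also have "(LINT u|lborel. f 0 * ?P u) = pi * f 0"
    using poisson_lborel(2)[of \<i>] by (subst integral_mult_right_zero) simp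
  finally have lim: "((\<lambda>s. LINT u|lborel. f (inverse s * u) * ?P u) \<longlongrightarrow> pi * f 0) at_top" .
  have "((\<lambda>s. - Im (cauchy_transform M (\<i> * of_real (inverse s)))) \<longlongrightarrow> pi * f 0) at_top"
  proof (rule Lim_transform_eventually[OF lim])
    show "\<forall>\<^sub>F s in at_top. (LINT u|lborel. f (inverse s * u) * ?P u) = - Im (cauchy_transform M (\<i> * of_real (inverse s)))"
      using eventually_gt_at_top[of "0::real"]
    proof eventually_elim
      case (elim s)
      then show ?case using eq[of "inverse s"] by simp
    qed
  qed
  then have "((\<lambda>y. - Im (cauchy_transform M (\<i> * of_real y))) \<longlongrightarrow> pi * f 0) (at_right 0)"
    by (simp add: filterlim_at_right_to_top)
  then have "((\<lambda>y. - \<i> * of_real (- Im (cauchy_transform M (\<i> * of_real y)))) \<longlongrightarrow> - \<i> * of_real (pi * f 0)) (at_right 0)"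
    by (intro tendsto_intros)
  moreover have "- \<i> * of_real (- Im (cauchy_transform M (\<i> * of_real y))) = cauchy_transform M (\<i> * of_real y)" for y
    using Re_cauchy_transform_imaginary[of y] by (simp add: complex_eq_iff)
  ultimately show ?thesis by simp
qed

text \<open>Integration by parts: c v^(\<kappa> + 1) / (z - x) has derivative f k, where
  \<open>k\<close> collects exactly the terms of the equation, and \<open>lim_a\<close> and
  \<open>lim_b\<close> remove the boundary values.\<close>

lemma cauchy_transform_ode:
  fixes a b :: ereal
  assumes ab: "a < b" and v_pos: "\<And>x. x \<in> einterval a b \<Longrightarrow> 1 + \<sigma> * x\<^sup>2 > 0"
    and f_in: "\<And>x. x \<in> einterval a b \<Longrightarrow> f x = c * (1 + \<sigma> * x\<^sup>2) powr \<kappa>"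
    and f_out: "\<And>x. x \<notin> einterval a b \<Longrightarrow> f x = 0"
    and lim_a: "((\<lambda>x. (1 + \<sigma> * (real_of_ereal x)\<^sup>2) powr (\<kappa> + 1)) \<longlongrightarrow> 0) (at_right a)"
    and lim_b: "((\<lambda>x. (1 + \<sigma> * (real_of_ereal x)\<^sup>2) powr (\<kappa> + 1)) \<longlongrightarrow> 0) (at_left b)"
    and z: "Im z \<noteq> 0"
  shows "(1 + of_real \<sigma> * z\<^sup>2) * deriv (cauchy_transform M) z
        = 2 * of_real (\<kappa> * \<sigma>) * z * cauchy_transform M z - of_real (\<sigma> * (2 * \<kappa> + 1))"
proof -
  define k where "k = (\<lambda>x. 2 * of_real (\<sigma> * \<kappa>) * z * (1 / (z - of_real x))
      + (1 + of_real \<sigma> * z\<^sup>2) * (1 / (z - of_real x)\<^sup>2) - of_real (\<sigma> * (2 * \<kappa> + 1)))"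
  define r where "r = (\<lambda>x. c * (1 + \<sigma> * x\<^sup>2) powr (\<kappa> + 1))"
  define g where "g = (\<lambda>x. (c * (1 + \<sigma> * x\<^sup>2) powr \<kappa>) *\<^sub>R k x)"
  define F where "F = (\<lambda>x. of_real (r x) * (1 / (z - of_real x)))"
  have km [measurable]: "k \<in> borel_measurable borel" unfolding k_def by measurable
  have int1: "integrable M (\<lambda>x. 1 / (z - of_real x))" by (rule integrable_cauchy_kernel[OF z])
  have int2: "integrable M (\<lambda>x. 1 / (z - of_real x)\<^sup>2)"
    using integrable_cauchy_kernel2[OF z z] by (simp add: power2_eq_square)
  have ki: "integrable M k" unfolding k_def
    by (intro Bochner_Integration.integrable_diff Bochner_Integration.integrable_add integrable_mult_right int1 int2) simp
  have gi: "indicator (einterval a b) x *\<^sub>R g x = f x *\<^sub>R k x" for x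
    using f_in[of x] f_out[of x] by (cases "x \<in> einterval a b") (auto simp: g_def)
  have Fd: "(F has_vector_derivative g x) (at x)" if x: "x \<in> einterval a b" for x
  proof -
    note zx = diff_of_real_neq_0[OF z, of x]
    have pos: "1 + \<sigma> * x\<^sup>2 > 0" by (rule v_pos[OF x])
    have "(r has_real_derivative c * ((\<kappa> + 1) * (1 + \<sigma> * x\<^sup>2) powr \<kappa> * (\<sigma> * (2 * x)))) (at x)"
      unfolding r_def
      by (rule derivative_eq_intros has_real_derivative_powr refl pos | use pos in simp)+
    then have rd: "((\<lambda>x. complex_of_real (r x)) has_vector_derivative
        of_real (c * ((\<kappa> + 1) * (1 + \<sigma> * x\<^sup>2) powr \<kappa> * (\<sigma> * (2 * x))))) (at x)"
      by (intro has_vector_derivative_of_real) (simp add: has_real_derivative_iff_has_vector_derivative)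
    have "((\<lambda>w. 1 / (z - w)) has_field_derivative 1 / (z - of_real x)\<^sup>2) (at (of_real x))"
      using zx by (auto intro!: derivative_eq_intros simp: power2_eq_square)
    then have kd: "((\<lambda>x. 1 / (z - of_real x)) has_vector_derivative 1 / (z - of_real x)\<^sup>2) (at x)"
      by (rule has_vector_derivative_real_field)
    have "(F has_vector_derivative of_real (r x) * (1 / (z - of_real x)\<^sup>2)
        + of_real (c * ((\<kappa> + 1) * (1 + \<sigma> * x\<^sup>2) powr \<kappa> * (\<sigma> * (2 * x)))) * (1 / (z - of_real x))) (at x)"
      unfolding F_def by (rule has_vector_derivative_mult[OF rd kd])
    moreover have "of_real (r x) * (1 / (z - of_real x)\<^sup>2)
        + of_real (c * ((\<kappa> + 1) * (1 + \<sigma> * x\<^sup>2) powr \<kappa> * (\<sigma> * (2 * x)))) * (1 / (z - of_real x)) = g x"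
    proof -
      define u where "u = 1 / (z - complex_of_real x)"
      \<comment> \<open>Replacing x u by z u - 1 removes x from the bracket and leaves a polynomial
        in u.\<close>
      have xu: "of_real x * u = z * u - 1" using zx by (simp add: u_def field_simps)
      have xu2: "(of_real x)\<^sup>2 * u\<^sup>2 = (z * u - 1)\<^sup>2" using xu by (metis power_mult_distrib)
      have u2: "1 / (z - complex_of_real x)\<^sup>2 = u\<^sup>2" by (simp add: u_def power_divide)
      have rx: "r x = c * (1 + \<sigma> * x\<^sup>2) powr \<kappa> * (1 + \<sigma> * x\<^sup>2)"
        using pos by (simp add: r_def powr_add)
      define w where "w = complex_of_real (c * (1 + \<sigma> * x\<^sup>2) powr \<kappa>)"
      have "of_real (r x) * u\<^sup>2 + of_real (c * ((\<kappa> + 1) * (1 + \<sigma> * x\<^sup>2) powr \<kappa> * (\<sigma> * (2 * x)))) * u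
         = w * (u\<^sup>2 + of_real \<sigma> * ((of_real x)\<^sup>2 * u\<^sup>2) + 2 * of_real \<sigma> * (of_real \<kappa> + 1) * (of_real x * u))"
        by (simp add: rx w_def algebra_simps)
      also have "\<dots> = w * (2 * of_real (\<sigma> * \<kappa>) * z * u + (1 + of_real \<sigma> * z\<^sup>2) * u\<^sup>2 - of_real (\<sigma> * (2 * \<kappa> + 1)))"
        unfolding xu xu2 by (simp add: algebra_simps power2_eq_square)
      finally show ?thesis
        unfolding g_def k_def scaleR_conv_of_real u2 u_def[symmetric] w_def[symmetric] .
    qed
    ultimately show ?thesis by simp
  qed
  have Flim: "((F \<circ> real_of_ereal) \<longlongrightarrow> 0) A" if A: "((\<lambda>x. (1 + \<sigma> * (real_of_ereal x)\<^sup>2) powr (\<kappa> + 1)) \<longlongrightarrow> 0) A" for A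
  proof (rule Lim_null_comparison)
    show "\<forall>\<^sub>F x in A. norm ((F \<circ> real_of_ereal) x) \<le> \<bar>c\<bar> * (1 + \<sigma> * (real_of_ereal x)\<^sup>2) powr (\<kappa> + 1) * (1 / \<bar>Im z\<bar>)"
    proof (intro always_eventually allI)
      fix x
      show "norm ((F \<circ> real_of_ereal) x) \<le> \<bar>c\<bar> * (1 + \<sigma> * (real_of_ereal x)\<^sup>2) powr (\<kappa> + 1) * (1 / \<bar>Im z\<bar>)"
        unfolding o_def F_def norm_mult norm_of_real r_def abs_mult
        by (intro mult_mono norm_inverse_diff_of_real_le[OF z]) auto
    qed
    show "((\<lambda>x. \<bar>c\<bar> * (1 + \<sigma> * (real_of_ereal x)\<^sup>2) powr (\<kappa> + 1) * (1 / \<bar>Im z\<bar>)) \<longlongrightarrow> 0) A"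
      using tendsto_mult[OF tendsto_mult[OF tendsto_const[of "\<bar>c\<bar>"] A] tendsto_const[of "1 / \<bar>Im z\<bar>"]] by simp
  qed
  have "(LBINT x=a..b. g x) = 0 - 0"
  proof (rule interval_integral_FTC_integrable[OF ab])
    fix x assume "a < ereal x" "ereal x < b"
    then have x: "x \<in> einterval a b" by (simp add: einterval_def)
    show "(F has_vector_derivative g x) (at x)" by (rule Fd[OF x])
    show "isCont g x"
      unfolding g_def k_def using diff_of_real_neq_0[OF z, of x] v_pos[OF x]
      by (intro continuous_intros) auto
  next
    show "set_integrable lborel (einterval a b) g"
      unfolding set_integrable_def gi using ki by (subst (asm) integrable_M) auto
  qed (intro Flim lim_a lim_b)+
  moreover have "(LBINT x=a..b. g x) = (LINT x|M. k x)"
    using less_imp_le[OF ab] by (simp add: interval_lebesgue_integral_def set_lebesgue_integral_def gi integral_M)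
  ultimately have "(LINT x|M. k x) = 0" by simp
  also have "(LINT x|M. k x) = 2 * of_real (\<sigma> * \<kappa>) * z * cauchy_transform M z
      + (1 + of_real \<sigma> * z\<^sup>2) * (LINT x|M. 1 / (z - of_real x)\<^sup>2) - of_real (\<sigma> * (2 * \<kappa> + 1))"
  proof -
    have "(LINT x|M. k x) = (LINT x|M. 2 * of_real (\<sigma> * \<kappa>) * z * (1 / (z - of_real x))
      + (1 + of_real \<sigma> * z\<^sup>2) * (1 / (z - of_real x)\<^sup>2)) - (LINT x|M. of_real (\<sigma> * (2 * \<kappa> + 1)))"
      unfolding k_def
      by (intro Bochner_Integration.integral_diff Bochner_Integration.integrable_add integrable_mult_right int1 int2) simp
    also have "(LINT x|M. 2 * of_real (\<sigma> * \<kappa>) * z * (1 / (z - of_real x))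
      + (1 + of_real \<sigma> * z\<^sup>2) * (1 / (z - of_real x)\<^sup>2))
      = (LINT x|M. 2 * of_real (\<sigma> * \<kappa>) * z * (1 / (z - of_real x)))
      + (LINT x|M. (1 + of_real \<sigma> * z\<^sup>2) * (1 / (z - of_real x)\<^sup>2))"
      by (intro Bochner_Integration.integral_add integrable_mult_right int1 int2)
    also have "(LINT x|M. 2 * of_real (\<sigma> * \<kappa>) * z * (1 / (z - of_real x))) = 2 * of_real (\<sigma> * \<kappa>) * z * cauchy_transform M z"
      unfolding cauchy_transform_def by (rule integral_mult_right_zero)
    also have "(LINT x|M. (1 + of_real \<sigma> * z\<^sup>2) * (1 / (z - of_real x)\<^sup>2))
        = (1 + of_real \<sigma> * z\<^sup>2) * (LINT x|M. 1 / (z - of_real x)\<^sup>2)"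
      by (rule integral_mult_right_zero)
    finally show ?thesis using prob_space by simp
  qed
  also have "(LINT x|M. 1 / (z - of_real x)\<^sup>2) = - deriv (cauchy_transform M) z"
    using DERIV_imp_deriv[OF cauchy_transform_has_field_derivative[OF z]] by simp
  finally show ?thesis by (simp add: algebra_simps)
qed

lemma AE_M_neq_0: "AE x in M. x \<noteq> 0"
proof -
  have "AE x in lborel. x \<noteq> (0::real)" by (rule AE_lborel_singleton)
  then show ?thesis unfolding M_def by (subst AE_density) (auto elim: eventually_mono)
qed

text \<open>At i the factor 1 + z^2 vanishes, so a critical point w satisfies w G(w) = i G(i). Up to
  nonzero factors the difference of the two sides is the Cauchy transform at w of the law weighted
  by x^2 / (1 + x^2), whose imaginary part is negative. The case w = i needs one more derivative of
  the equation.\<close>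

lemma deriv_cauchy_transform_neq_0:
  assumes ode: "\<And>z. Im z \<noteq> 0 \<Longrightarrow> (1 + z\<^sup>2) * deriv (cauchy_transform M) z
        = 2 * of_real \<kappa> * z * cauchy_transform M z - of_real (2 * \<kappa> + 1)"
    and \<kappa>: "\<kappa> < 0" and w: "Im w > 0"
  shows "deriv (cauchy_transform M) w \<noteq> 0"
proof
  let ?G = "cauchy_transform M"
  assume 0: "deriv ?G w = 0"
  have i0: "Im \<i> \<noteq> 0" by simp
  have wi: "Im w \<noteq> 0" using w by simp
  show False
  proof (cases "w = \<i>")
    case True
    have hol: "deriv ?G holomorphic_on {z. Im z > 0}"
      by (intro holomorphic_deriv open_upper_halfplane holomorphic_on_subset[OF cauchy_transform_holomorphic]) auto
    have iU: "\<i> \<in> {z. Im z > 0}" by simp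
    obtain D2 where D2: "(deriv ?G has_field_derivative D2) (at \<i>)"
      using hol iU unfolding holomorphic_on_open[OF open_upper_halfplane] by blast
    have Gd: "(?G has_field_derivative deriv ?G \<i>) (at \<i>)"
      using cauchy_transform_has_field_derivative[OF i0] DERIV_imp_deriv by metis
    \<comment> \<open>At i the equation loses its G' term; its derivative there yields \<kappa> G(i)
      = 0 once G'(i) = 0.\<close>
    define L where "L = (\<lambda>z. (1 + z\<^sup>2) * deriv ?G z - (2 * of_real \<kappa> * z * ?G z - of_real (2 * \<kappa> + 1)))"
    have "(L has_field_derivative (2 * \<i>) * deriv ?G \<i> + (1 + \<i>\<^sup>2) * D2 - (2 * of_real \<kappa> * ?G \<i> + 2 * of_real \<kappa> * \<i> * deriv ?G \<i>)) (at \<i>)"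
      unfolding L_def by (rule derivative_eq_intros D2 Gd refl | simp add: algebra_simps)+
    moreover have "(L has_field_derivative 0) (at \<i>)"
    proof (rule has_field_derivative_transform_within_open[of "\<lambda>_. 0" _ _ "{z. Im z > 0}"])
      show "0 = L z" if "z \<in> {z. Im z > 0}" for z using ode[of z] that by (simp add: L_def)
    qed (auto simp: open_upper_halfplane)
    ultimately have "(2 * \<i>) * deriv ?G \<i> + (1 + \<i>\<^sup>2) * D2 - (2 * of_real \<kappa> * ?G \<i> + 2 * of_real \<kappa> * \<i> * deriv ?G \<i>) = 0"
      by (rule DERIV_unique)
    then have "of_real \<kappa> * ?G \<i> = 0" using 0 True by simp
    then show False using \<kappa> cauchy_transform_neq_0[OF i0] by simp
  next
    case False
    have w1: "1 + w\<^sup>2 \<noteq> 0"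
    proof
      assume "1 + w\<^sup>2 = 0"
      then have "(w - \<i>) * (w + \<i>) = 0" by (simp add: algebra_simps power2_eq_square)
      then have "w = - \<i>" using False by (metis add_eq_0_iff2 eq_iff_diff_eq_0 mult_eq_0_iff)
      then show False using w by simp
    qed
    have "2 * of_real \<kappa> * w * ?G w = 2 * of_real \<kappa> * \<i> * ?G \<i>"
      using ode[OF wi] ode[OF i0] 0 by simp
    then have wG: "w * ?G w = \<i> * ?G \<i>" using \<kappa> by simp
    define K where "K = (\<lambda>u x. 1 / (u - complex_of_real x))"
    have Ki: "integrable M (K u)" "(LINT x|M. K u x) = ?G u" if "Im u \<noteq> 0" for u
      unfolding K_def by (auto simp: cauchy_transform_def integrable_cauchy_kernel[OF that])
    define q where "q = (\<lambda>x::real. x\<^sup>2 / (1 + x\<^sup>2))"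
    have q01: "0 \<le> q x" "q x \<le> 1" for x by (auto simp: q_def divide_le_eq add_pos_nonneg)
    have qm [measurable]: "q \<in> borel_measurable borel" unfolding q_def by measurable
    have Km [measurable]: "K u \<in> borel_measurable borel" for u unfolding K_def by measurable
    have Kb: "norm (q x * K w x) \<le> 1 / \<bar>Im w\<bar>" for x
    proof -
      have "norm (q x * K w x) \<le> 1 * (1 / \<bar>Im w\<bar>)"
        unfolding norm_mult K_def using q01[of x] norm_inverse_diff_of_real_le[OF wi, of x]
        by (intro mult_mono) auto
      then show ?thesis by simp
    qed
    have Qi: "integrable M (\<lambda>x. q x * K w x)"
      by (rule integrable_bounded_complex[OF _ Kb]) simp
    \<comment> \<open>Partial fractions in x with poles w, i and -i; integration and oddness turn
      this into (1 + w^2) Q = w (w G(w) - i G(i)).\<close>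
    have eq: "(1 + w\<^sup>2) * (q x * K w x) = w\<^sup>2 * K w x + 1/2 * (K \<i> x + K (- \<i>) x) - w * (\<i> / 2) * (K \<i> x - K (- \<i>) x)" for x
    proof -
      define X where "X = complex_of_real x"
      have n: "w - X \<noteq> 0" "\<i> - X \<noteq> 0" "- \<i> - X \<noteq> 0"
        using diff_of_real_neq_0[OF wi, of x] diff_of_real_neq_0[OF i0, of x] diff_of_real_neq_0[of "-\<i>" x]
        by (auto simp: X_def)
      have X1: "(\<i> - X) * (- \<i> - X) = 1 + X\<^sup>2" by (simp add: algebra_simps power2_eq_square)
      then have X0: "1 + X\<^sup>2 \<noteq> 0" using n by (metis no_zero_divisors)
      have s: "K \<i> x + K (- \<i>) x = - 2 * X / (1 + X\<^sup>2)" "K \<i> x - K (- \<i>) x = - 2 * \<i> / (1 + X\<^sup>2)"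
        unfolding K_def X_def[symmetric] X1[symmetric] using n by (simp_all add: divide_simps)
      have qX: "complex_of_real (q x) = X\<^sup>2 / (1 + X\<^sup>2)" by (simp add: q_def X_def)
      have "w\<^sup>2 * K w x + 1/2 * (K \<i> x + K (- \<i>) x) - w * (\<i> / 2) * (K \<i> x - K (- \<i>) x)
          = w\<^sup>2 / (w - X) - (X + w) / (1 + X\<^sup>2)"
        unfolding s by (simp add: K_def X_def[symmetric] diff_divide_distrib add_divide_distrib)
      also have "\<dots> = (w\<^sup>2 * (1 + X\<^sup>2) - (X + w) * (w - X)) / ((w - X) * (1 + X\<^sup>2))"
        using n(1) X0 by (rule diff_frac_eq[THEN trans]) (simp add: mult.commute)
      also have "w\<^sup>2 * (1 + X\<^sup>2) - (X + w) * (w - X) = (1 + w\<^sup>2) * X\<^sup>2"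
        by (simp add: algebra_simps power2_eq_square)
      finally show ?thesis by (simp add: qX K_def X_def[symmetric])
    qed
    define Q where "Q = (LINT x|M. q x * K w x)"
    have "(1 + w\<^sup>2) * Q = (LINT x|M. (1 + w\<^sup>2) * (q x * K w x))"
      unfolding Q_def by (rule integral_mult_right_zero[symmetric])
    also have "\<dots> = (LINT x|M. w\<^sup>2 * K w x + 1/2 * (K \<i> x + K (- \<i>) x)) - (LINT x|M. w * (\<i> / 2) * (K \<i> x - K (- \<i>) x))"
      unfolding eq
      by (intro Bochner_Integration.integral_diff Bochner_Integration.integrable_add integrable_mult_right
          Bochner_Integration.integrable_diff Ki) (use wi in auto)
    also have "(LINT x|M. w\<^sup>2 * K w x + 1/2 * (K \<i> x + K (- \<i>) x)) = w\<^sup>2 * ?G w + 1/2 * (?G \<i> + ?G (- \<i>))"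
    proof -
      have "(LINT x|M. w\<^sup>2 * K w x + 1/2 * (K \<i> x + K (- \<i>) x)) = (LINT x|M. w\<^sup>2 * K w x) + (LINT x|M. 1/2 * (K \<i> x + K (- \<i>) x))"
        by (intro Bochner_Integration.integral_add Bochner_Integration.integrable_add integrable_mult_right Ki) (use wi in auto)
      moreover have "(LINT x|M. K \<i> x + K (- \<i>) x) = ?G \<i> + ?G (- \<i>)"
        using Ki[of \<i>] Ki[of "- \<i>"] by (subst Bochner_Integration.integral_add) auto
      ultimately show ?thesis using Ki(2)[OF wi] by (simp only: integral_mult_right_zero)
    qed
    also have "(LINT x|M. w * (\<i> / 2) * (K \<i> x - K (- \<i>) x)) = w * (\<i> / 2) * (?G \<i> - ?G (- \<i>))"
    proof -
      have "(LINT x|M. K \<i> x - K (- \<i>) x) = ?G \<i> - ?G (- \<i>)"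
        using Ki[of \<i>] Ki[of "- \<i>"] by (subst Bochner_Integration.integral_diff) auto
      then show ?thesis by (simp only: integral_mult_right_zero)
    qed
    also have "w\<^sup>2 * ?G w + 1/2 * (?G \<i> + ?G (- \<i>)) - w * (\<i> / 2) * (?G \<i> - ?G (- \<i>)) = w * (w * ?G w - \<i> * ?G \<i>)"
      unfolding cauchy_transform_odd by (simp add: algebra_simps power2_eq_square)
    finally have "Q = 0" using wG w1 by simp
    moreover have "Im Q < 0"
    proof -
      define p where "p = (\<lambda>x. q x * (1 / (norm (w - complex_of_real x))\<^sup>2))"
      have Imp: "Im (q x * K w x) = - Im w * p x" for x
      proof -
        have "Im (q x * K w x) = q x * Im (K w x)" by simp
        also have "\<dots> = q x * (- Im w / (norm (w - of_real x))\<^sup>2)" unfolding K_def Im_cauchy_kernel ..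
        finally show ?thesis by (simp add: p_def)
      qed
      have pi: "integrable M p"
      proof -
        have "integrable M (\<lambda>x. (- 1 / Im w) * Im (q x * K w x))"
          by (intro integrable_mult_right integrable_Im Qi)
        then show ?thesis unfolding Imp using w by simp
      qed
      have "0 < (LINT x|M. p x)"
      proof (rule expectation_greater[OF pi])
        \<comment> \<open>The weight vanishes only at 0, a null set for a law with a
          density.\<close>
        show "AE x in M. 0 < p x"
          using AE_M_neq_0
        proof eventually_elim
          case (elim x)
          then show ?case using diff_of_real_neq_0[OF wi, of x]
            by (auto simp: p_def q_def intro!: mult_pos_pos divide_pos_pos add_pos_nonneg)
        qed
      qed
      moreover have "Im Q = (LINT x|M. Im (q x * K w x))" unfolding Q_def by (rule integral_Im[OF Qi, symmetric])
      then have "Im Q = - Im w * (LINT x|M. p x)" unfolding Imp integral_mult_right_zero .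
      ultimately show ?thesis using w by (simp add: mult_neg_pos)
    qed
    ultimately show False by simp
  qed
qed

end

section \<open>Student t- and ultraspherical distributions\<close>

lemma nn_integral_Beta:
  fixes a b :: real
  assumes "a > 0" "b > 0"
  shows "(\<integral>\<^sup>+s. ennreal (indicator {0..1} s * (s powr (a - 1) * (1 - s) powr (b - 1))) \<partial>lborel) = ennreal (Beta a b)"
  by (rule nn_integral_has_integral_lebesgue[OF _ has_integral_Beta_real[OF assms]]) simp

lemma Beta_pos: "a > 0 \<Longrightarrow> b > 0 \<Longrightarrow> Beta a b > (0::real)"
  by (simp add: Beta_def Gamma_real_pos)

text \<open>Legendre's duplication formula in Beta form; it reconciles the symmetric Beta integral
  that arises for the t-law with the normalisation B(1/2, q - 1/2).\<close>

lemma Beta_duplication: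
  assumes a: "a > (0::real)" shows "2 powr (2 * a - 1) * Beta a a = Beta (1 / 2) a"
proof -
  have "complex_of_real a \<notin> \<int>\<^sub>\<le>\<^sub>0" "complex_of_real a + 1 / 2 \<notin> \<int>\<^sub>\<le>\<^sub>0"
    using a by (auto elim!: nonpos_Ints_cases simp: complex_eq_iff)
  then have L: "Gamma (complex_of_real a) * Gamma (complex_of_real a + 1 / 2)
      = exp ((1 - 2 * of_real a) * of_real (ln 2)) * of_real (sqrt pi) * Gamma (2 * complex_of_real a)"
    by (rule Gamma_legendre_duplication)
  have e1: "complex_of_real a + 1 / 2 = of_real (a + 1 / 2)" by simp
  have e2: "2 * complex_of_real a = of_real (2 * a)" by simp
  have e3: "(1 - complex_of_real (2 * a)) * of_real (ln 2) = of_real ((1 - 2 * a) * ln 2)" by simp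
  have "complex_of_real (Gamma a) * of_real (Gamma (a + 1 / 2))
      = of_real (exp ((1 - 2 * a) * ln 2)) * of_real (sqrt pi) * of_real (Gamma (2 * a))"
    using L unfolding e1 e2 e3 Gamma_complex_of_real exp_of_real .
  then have "complex_of_real (Gamma a * Gamma (a + 1 / 2)) = of_real (exp ((1 - 2 * a) * ln 2) * sqrt pi * Gamma (2 * a))"
    by (simp only: of_real_mult)
  then have G: "Gamma a * Gamma (a + 1 / 2) = exp ((1 - 2 * a) * ln 2) * sqrt pi * Gamma (2 * a)"
    by (simp only: of_real_eq_iff)
  have e: "2 powr (2 * a - 1) * exp ((1 - 2 * a) * ln 2) = 1"
    by (simp add: powr_def flip: exp_add) (simp add: algebra_simps)
  have pos: "Gamma a > 0" "Gamma (a + 1 / 2) > 0" "Gamma (2 * a) > 0" using a by (auto intro!: Gamma_real_pos)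
  have "2 powr (2 * a - 1) * (Gamma a * Gamma (a + 1 / 2)) = sqrt pi * Gamma (2 * a)"
    using arg_cong[OF e, of "\<lambda>x. x * (sqrt pi * Gamma (2 * a))"] unfolding G by (simp only: mult.assoc mult_1)
  then have "2 powr (2 * a - 1) * Gamma a / Gamma (2 * a) = sqrt pi / Gamma (a + 1 / 2)"
    using pos by (simp add: field_simps)
  then have "Gamma a * (2 powr (2 * a - 1) * Gamma a / Gamma (2 * a)) = Gamma a * (sqrt pi / Gamma (a + 1 / 2))"
    by simp
  then show ?thesis
    by (simp add: Beta_def Gamma_one_half_real mult_ac add.commute flip: mult_2)
qed

text \<open>The substitution \<open>g\<close> maps (0, 1) onto the line with 1 + x^2 = 1 / (4 s (1 -
  s)), so the integrand becomes 4^(q - 1) times a symmetric Beta integrand.\<close>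

lemma nn_integral_t_density:
  assumes q: "q > 1 / 2"
  shows "(\<integral>\<^sup>+x. ennreal (1 / (1 + x\<^sup>2) powr q) \<partial>lborel) = ennreal (Beta (1 / 2) (q - 1 / 2))"
proof -
  define f where "f = (\<lambda>x::real. 1 / (1 + x\<^sup>2) powr q)"
  define g where "g = (\<lambda>s::real. (2 * s - 1) / (2 * sqrt (s * (1 - s))))"
  define g' where "g' = (\<lambda>s::real. 1 / (4 * sqrt (s * (1 - s)) ^ 3))"
  define h where "h = (\<lambda>s::real. s powr (q - 1 / 2 - 1) * (1 - s) powr (q - 1 / 2 - 1))"
  have a: "q - 1 / 2 > 0" using q by simp
  have fg: "f (g s) * g' s = 4 powr (q - 1) * h s" if s: "0 < s" "s < 1" for s
  proof -
    define m where "m = s * (1 - s)"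
    have m: "m > 0" using s by (simp add: m_def)
    have "(2 * s - 1)\<^sup>2 = 1 - 4 * m" by (simp add: m_def power2_eq_square algebra_simps)
    then have "(g s)\<^sup>2 = (1 - 4 * m) / (4 * m)"
      using m by (simp add: g_def m_def[symmetric] power_divide power_mult_distrib)
    then have "1 + (g s)\<^sup>2 = 1 / (4 * m)" using m by (simp add: field_simps)
    then have "f (g s) = (4 * m) powr q" using m by (simp add: f_def powr_divide)
    moreover have "sqrt m ^ 3 = m powr (3 / 2)"
    proof -
      have "sqrt m ^ 3 = (m powr (1 / 2)) powr 3" using m by (simp add: powr_half_sqrt powr_numeral)
      then show ?thesis using m by (simp add: powr_powr)
    qed
    ultimately have "f (g s) * g' s = (4 * m) powr q / (4 * m powr (3 / 2))"
      by (simp add: g'_def m_def[symmetric])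
    also have "\<dots> = (4 powr q / 4) * (m powr q / m powr (3 / 2))" by (simp add: powr_mult)
    also have "\<dots> = 4 powr (q - 1) * m powr (q - 3 / 2)" by (simp add: powr_diff)
    also have "m powr (q - 3 / 2) = h s" by (simp add: h_def m_def powr_mult)
    finally show ?thesis .
  qed
  have E01: "einterval (ereal 0) (ereal 1) = {0<..<1}" by (auto simp: einterval_def)
  have hi: "set_integrable lborel {0<..<1} h"
    using integrable_Beta[OF a a] unfolding h_def by (rule set_integrable_subset) auto
  have hfg: "set_integrable lborel {0<..<1} (\<lambda>s. f (g s) * g' s)"
  proof -
    have "set_integrable lborel {0<..<1} (\<lambda>s. 4 powr (q - 1) * h s)" using hi by (rule set_integrable_mult_right)
    moreover have "indicator {0<..<1} s *\<^sub>R (4 powr (q - 1) * h s) = indicator {0<..<1} s *\<^sub>R (f (g s) * g' s)" for s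
      using fg[of s] by (auto simp: indicator_def)
    ultimately show ?thesis by (simp only: set_integrable_def)
  qed
  have dg: "(g has_real_derivative g' s) (at s)" if "ereal 0 < ereal s" "ereal s < ereal 1" for s
  proof -
    have s: "0 < s" "s < 1" using that by auto
    define r where "r = sqrt (s * (1 - s))"
    have m: "s * (1 - s) > 0" using s by simp
    then have r: "r > 0" "r * r = s * (1 - s)" by (auto simp: r_def)
    have "(g has_real_derivative (2 * (2 * r) - (2 * s - 1) * (2 * ((1 - 2 * s) * (inverse r / 2)))) / (2 * r * (2 * r))) (at s)"
      unfolding g_def r_def using m by (auto intro!: derivative_eq_intros simp: field_simps)
    also have "(2 * (2 * r) - (2 * s - 1) * (2 * ((1 - 2 * s) * (inverse r / 2)))) / (2 * r * (2 * r))
       = (4 * (r * r) + (2 * s - 1) * (2 * s - 1)) / (4 * r ^ 3)"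
      using r(1) by (simp add: field_simps power3_eq_cube)
    also have "4 * (r * r) + (2 * s - 1) * (2 * s - 1) = 1" unfolding r(2) by (simp add: algebra_simps)
    finally show ?thesis by (simp add: g'_def r_def)
  qed
  have cf: "isCont f (g s)" for s unfolding f_def by (intro continuous_intros) (auto simp: add_nonneg_eq_0_iff)
  have cg: "isCont g' s" if "ereal 0 < ereal s" "ereal s < ereal 1" for s
  proof -
    have "s * (1 - s) > 0" using that by auto
    then show ?thesis unfolding g'_def by (intro continuous_intros) auto
  qed
  have f0: "0 \<le> f (g s)" for s by (simp add: f_def)
  have g0: "0 \<le> g' s" if "ereal 0 \<le> ereal s" "ereal s \<le> ereal 1" for s using that by (simp add: g'_def)
  have "filterlim g at_bot (at_right 0)" unfolding g_def by real_asymp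
  then have lim0: "((ereal \<circ> g \<circ> real_of_ereal) \<longlongrightarrow> -\<infinity>) (at_right (ereal 0))" by (simp only: ereal_tendsto_simps)
  have "filterlim g at_top (at_left 1)" unfolding g_def by real_asymp
  then have lim1: "((ereal \<circ> g \<circ> real_of_ereal) \<longlongrightarrow> \<infinity>) (at_left (ereal 1))" by (simp only: ereal_tendsto_simps)
  have less: "ereal 0 < ereal 1" by simp
  note sub = interval_integral_substitution_nonneg[OF less dg cf cg f0 g0 lim0 lim1 hfg[folded E01]]
  have fi: "integrable lborel f" using sub(1) by (simp add: set_integrable_def einterval_def)
  have "(LINT x|lborel. f x) = (LBINT x=-\<infinity>..\<infinity>. f x)"
    by (simp add: interval_lebesgue_integral_def set_lebesgue_integral_def einterval_def)
  also have "\<dots> = (LBINT s=ereal 0..ereal 1. f (g s) * g' s)" by (rule sub(2))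
  also have "\<dots> = (LBINT s:{0<..<1}. f (g s) * g' s)"
    unfolding interval_lebesgue_integral_def E01 by simp
  also have "\<dots> = (LBINT s:{0<..<1}. 4 powr (q - 1) * h s)"
    by (rule set_lebesgue_integral_cong) (use fg in auto)
  also have "\<dots> = 4 powr (q - 1) * (LBINT s:{0<..<1}. h s)" by (rule set_integral_mult_right)
  also have "(LBINT s:{0<..<1}. h s) = integral {0<..<1} h" by (rule set_borel_integral_eq_integral(2)[OF hi])
  also have "\<dots> = integral {0..1} h" by (rule integral_open_interval_real[symmetric])
  also have "\<dots> = Beta (q - 1 / 2) (q - 1 / 2)"
    using has_integral_Beta_real[OF a a] unfolding h_def by (rule integral_unique)
  also have "4 powr (q - 1) = 2 powr (2 * (q - 1 / 2) - 1)"
  proof -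
    have "(4::real) = 2 powr 2" by simp
    then have "4 powr (q - 1) = (2 powr 2) powr (q - 1)" by simp
    then show ?thesis unfolding powr_powr by (simp add: algebra_simps)
  qed
  also have "\<dots> * Beta (q - 1 / 2) (q - 1 / 2) = Beta (1 / 2) (q - 1 / 2)" by (rule Beta_duplication[OF a])
  finally have "(LINT x|lborel. f x) = Beta (1 / 2) (q - 1 / 2)" .
  moreover have "(\<integral>\<^sup>+x. ennreal (f x) \<partial>lborel) = ennreal (LINT x|lborel. f x)"
    by (rule nn_integral_eq_integral[OF fi]) (simp add: f_def)
  ultimately show ?thesis by (simp add: f_def)
qed

section \<open>Verification of the shared analytic facts for each family\<close>

lemma power_density_t_dist:
  assumes q: "q > 1"
  shows "power_density (t_dist q) (1 / Beta (1 / 2) (q - 1 / 2)) 1 (- q)"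
proof -
  define B where "B = Beta (1 / 2) (q - 1 / 2)"
  have B: "B > 0" using q by (simp add: B_def Beta_pos)
  define f where "f = (\<lambda>x. 1 / B * (1 / (1 + x\<^sup>2) powr q))"
  have f_eq: "f x = 1 / B * (1 + 1 * x\<^sup>2) powr (- q)" for x by (simp add: f_def powr_minus_divide)
  interpret even_density f
  proof
    show "f \<in> borel_measurable borel" unfolding f_def by measurable
    show "f x \<ge> 0" for x using B by (simp add: f_def)
    show "f (- x) = f x" for x by (simp add: f_def)
    have "(\<integral>\<^sup>+x. ennreal (f x) \<partial>lborel) = (\<integral>\<^sup>+x. ennreal (1 / B) * ennreal (1 / (1 + x\<^sup>2) powr q) \<partial>lborel)"
      unfolding f_def using B by (intro nn_integral_cong ennreal_mult) auto
    also have "\<dots> = ennreal (1 / B) * ennreal B"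
      using nn_integral_t_density[of q] q by (subst nn_integral_cmult) (auto simp: B_def)
    also have "\<dots> = 1" using B by (simp flip: ennreal_mult)
    finally show "(\<integral>\<^sup>+x. ennreal (f x) \<partial>lborel) = 1" .
  qed
  have M: "t_dist q = M" unfolding M_def by (simp add: t_dist_def f_def B_def)
  have cont: "isCont f x" for x
    unfolding f_def by (intro continuous_intros) (auto simp: add_nonneg_eq_0_iff)
  have bnd: "f x \<le> 1 / B" for x
  proof -
    have "(1 + x\<^sup>2) powr q \<ge> 1" using q by (intro ge_one_powr_ge_zero) auto
    then have "1 / (1 + x\<^sup>2) powr q \<le> 1" by (simp add: divide_le_eq_1)
    then show ?thesis unfolding f_def using B by (intro mult_left_le) auto
  qed
  have lim: "(f \<longlongrightarrow> 0) at_infinity"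
  proof -
    have "(f \<longlongrightarrow> 0) at_top" "(f \<longlongrightarrow> 0) at_bot" unfolding f_def using q by real_asymp+
    then show ?thesis by (simp add: at_infinity_eq_at_top_bot filterlim_sup)
  qed
  have ode: "(1 + of_real 1 * z\<^sup>2) * deriv (cauchy_transform M) z
        = 2 * of_real (- q * 1) * z * cauchy_transform M z - of_real (1 * (2 * - q + 1))" if z: "Im z \<noteq> 0" for z
  proof (rule cauchy_transform_ode[where a = "-\<infinity>" and b = "\<infinity>" and c = "1 / B"])
    \<comment> \<open>Here q > 1 enters: the exponent -q + 1 is negative, so the boundary values at
      infinity vanish.\<close>
    show "((\<lambda>x. (1 + 1 * (real_of_ereal x)\<^sup>2) powr (- q + 1)) \<longlongrightarrow> 0) (at_right (- \<infinity>))"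
      unfolding at_right_MInf filterlim_filtermap real_of_ereal.simps using q by real_asymp
    show "((\<lambda>x. (1 + 1 * (real_of_ereal x)\<^sup>2) powr (- q + 1)) \<longlongrightarrow> 0) (at_left \<infinity>)"
      unfolding at_left_PInf filterlim_filtermap real_of_ereal.simps using q by real_asymp
  qed (use z f_eq in \<open>auto simp: einterval_def add_pos_nonneg\<close>)
  have "power_density M (1 / B) 1 (- q)"
  proof
    show "1 / B > 0" using B by simp
    show "1 = (1::real) \<and> - q < - 1 \<or> 1 = (- 1::real) \<and> 1 / 2 \<le> - q" using q by simp
    show "((\<lambda>y. cauchy_transform M (\<i> * complex_of_real y)) \<longlongrightarrow> - \<i> * complex_of_real (pi * (1 / B))) (at_right 0)"
      using cauchy_transform_limit_0[OF bnd cont] by (simp add: f_def)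
    show "\<exists>B. \<forall>w. 0 < Im w \<longrightarrow> d \<le> - Im (cauchy_transform M w) \<longrightarrow> cmod w \<le> B" if "0 < d" for d
      by (rule Im_cauchy_transform_small_at_infinity[OF lim that])
    show "deriv (cauchy_transform M) w \<noteq> 0" if "Im w > 0" for w
      by (rule deriv_cauchy_transform_neq_0[of "- q"]) (use ode q that in auto)
    show "\<forall>\<^sub>F w in nhds (complex_of_real x). 0 < Im w \<longrightarrow> - Im (cauchy_transform M w) < d"
      if "1 + 1 * x\<^sup>2 \<le> 0" for x d :: real
      using that add_pos_nonneg[of 1 "x\<^sup>2"] by simp
  qed (use q ode cauchy_transform_odd in auto)
  then show ?thesis by (simp add: M B_def)
qed

lemma power_density_u_dist:
  assumes p: "p \<ge> 1"
  shows "power_density (u_dist p) (1 / (4 powr p * Beta (p + 1 / 2) (p + 1 / 2))) (- 1) (p - 1 / 2)"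
proof -
  define B where "B = Beta (p + 1 / 2) (p + 1 / 2)"
  have B: "B > 0" using p by (simp add: B_def Beta_pos)
  define c where "c = 1 / (4 powr p * B)"
  have c: "c > 0" using B by (simp add: c_def)
  define f where "f = (\<lambda>x. c * (1 - x\<^sup>2) powr (p - 1 / 2) * indicator {-1..1} x)"
  \<comment> \<open>The \<open>max\<close> form displays continuity at the endpoints, which the
    indicator hides; it rests on the exponent being positive.\<close>
  have f_max: "f x = c * (max 0 (1 - x\<^sup>2)) powr (p - 1 / 2)" for x
  proof (cases "x \<in> {-1..1}")
    case True
    then have "\<bar>x\<bar> \<le> 1" by auto
    then have "x\<^sup>2 \<le> 1" by (simp add: abs_square_le_1)
    then show ?thesis using True by (simp add: f_def max_def)
  next
    case False
    then have "\<not> \<bar>x\<bar> \<le> 1" by auto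
    then have "\<not> x\<^sup>2 \<le> 1" by (simp add: abs_square_le_1)
    then show ?thesis using False by (simp add: f_def max_def)
  qed
  interpret even_density f
  proof
    show "f \<in> borel_measurable borel" unfolding f_def by measurable
    show "f x \<ge> 0" for x using c by (simp add: f_def)
    show "f (- x) = f x" for x by (simp add: f_max)
    have b: "p + 1 / 2 > 0" using p by simp
    \<comment> \<open>x = -1 + 2 s sends 1 - x^2 to 4 s (1 - s); the factors 2 and 4^(p - 1/2)
      combine to the 4^p of the normalisation.\<close>
    have "(\<integral>\<^sup>+x. ennreal (f x) \<partial>lborel) = ennreal \<bar>2\<bar> * (\<integral>\<^sup>+s. ennreal (f (-1 + 2 * s)) \<partial>lborel)"
      by (rule nn_integral_real_affine) (auto simp: f_def)
    also have "(\<integral>\<^sup>+s. ennreal (f (-1 + 2 * s)) \<partial>lborel) = (\<integral>\<^sup>+s. ennreal (c * 4 powr (p - 1 / 2))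
        * ennreal (indicator {0..1} s * (s powr (p + 1 / 2 - 1) * (1 - s) powr (p + 1 / 2 - 1))) \<partial>lborel)"
    proof (rule nn_integral_cong)
      fix s :: real
      have "1 - (-1 + 2 * s)\<^sup>2 = 4 * (s * (1 - s))" by (simp add: power2_eq_square algebra_simps)
      moreover have "indicator {-1..1} (-1 + 2 * s) = (indicator {0..1} s :: real)" by (auto simp: indicator_def)
      ultimately have "f (-1 + 2 * s) = c * 4 powr (p - 1 / 2) * (indicator {0..1} s * (s powr (p + 1 / 2 - 1) * (1 - s) powr (p + 1 / 2 - 1)))"
        by (simp add: f_def powr_mult)
      then show "ennreal (f (-1 + 2 * s)) = ennreal (c * 4 powr (p - 1 / 2))
        * ennreal (indicator {0..1} s * (s powr (p + 1 / 2 - 1) * (1 - s) powr (p + 1 / 2 - 1)))"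
        using c by (simp only:) (rule ennreal_mult, auto)
    qed
    also have "\<dots> = ennreal (c * 4 powr (p - 1 / 2)) * ennreal B"
      using nn_integral_Beta[OF b b] by (subst nn_integral_cmult) (auto simp: B_def)
    also have "ennreal \<bar>2\<bar> * (ennreal (c * 4 powr (p - 1 / 2)) * ennreal B) = ennreal (2 * (c * 4 powr (p - 1 / 2) * B))"
      using c B by (simp add: ennreal_mult)
    also have "2 * (c * 4 powr (p - 1 / 2) * B) = 1"
    proof -
      have "4 powr (p - 1 / 2) = 4 powr p / (2::real)" by (simp add: powr_diff powr_half_sqrt)
      then show ?thesis using B by (simp add: c_def)
    qed
    finally show "(\<integral>\<^sup>+x. ennreal (f x) \<partial>lborel) = 1" by simp
  qed
  have M: "u_dist p = M" unfolding M_def by (simp add: u_dist_def f_def c_def B_def)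
  have cont: "isCont f x" for x
  proof -
    have "((\<lambda>x. c * (max 0 (1 - x\<^sup>2)) powr (p - 1 / 2)) \<longlongrightarrow> c * (max 0 (1 - x\<^sup>2)) powr (p - 1 / 2)) (at x)"
      using p by (intro tendsto_intros tendsto_powr') auto
    then show ?thesis unfolding isCont_def f_max .
  qed
  have bnd: "f x \<le> c" for x
  proof -
    have "(max 0 (1 - x\<^sup>2)) powr (p - 1 / 2) \<le> 1" using p by (intro powr_le1) auto
    then show ?thesis unfolding f_max using c by (intro mult_left_le) auto
  qed
  have out: "f x = 0" if "1 - x\<^sup>2 \<le> 0" for x using that by (simp add: f_max)
  have lim: "(f \<longlongrightarrow> 0) at_infinity"
  proof (rule tendsto_eventually)
    have "f x = 0" if "2 \<le> norm x" for x using that by (auto simp: f_def indicator_def)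
    then show "\<forall>\<^sub>F x in at_infinity. f x = 0" unfolding eventually_at_infinity by blast
  qed
  have ode: "(1 + of_real (- 1) * z\<^sup>2) * deriv (cauchy_transform M) z
        = 2 * of_real ((p - 1 / 2) * (- 1)) * z * cauchy_transform M z - of_real (- 1 * (2 * (p - 1 / 2) + 1))" if z: "Im z \<noteq> 0" for z
  proof (rule cauchy_transform_ode[where a = "ereal (-1)" and b = "ereal 1" and c = c])
    have iff: "x \<in> einterval (ereal (-1)) (ereal 1) \<longleftrightarrow> x\<^sup>2 < 1" for x
      by (auto simp: einterval_def abs_square_less_1)
    show "1 + - 1 * x\<^sup>2 > 0" if "x \<in> einterval (ereal (-1)) (ereal 1)" for x using that iff by simp
    show "f x = c * (1 + - 1 * x\<^sup>2) powr (p - 1 / 2)" if "x \<in> einterval (ereal (-1)) (ereal 1)" for x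
      using that iff[of x] by (simp add: f_max)
    show "f x = 0" if "x \<notin> einterval (ereal (-1)) (ereal 1)" for x by (rule out) (use that iff[of x] in linarith)
    \<comment> \<open>The base tends to 0, so the limit rule for real powers wants it eventually
      nonnegative; hence the endpoints are approached from inside.\<close>
    have lim0: "((\<lambda>x::real. (1 + - 1 * x\<^sup>2) powr (p - 1 / 2 + 1)) \<longlongrightarrow> 0) A"
      if "((\<lambda>x::real. 1 + - 1 * x\<^sup>2) \<longlongrightarrow> 0) A" "\<forall>\<^sub>F x in A. 0 \<le> 1 + - 1 * x\<^sup>2" for A
      using tendsto_powr'[OF that(1) tendsto_const[of "p - 1 / 2 + 1"]] that(2) p by simp
    have "\<forall>\<^sub>F x in at_right (-1::real). x \<in> {-1<..<0}" by (rule eventually_at_right_real) simp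
    then have "\<forall>\<^sub>F x in at_right (-1::real). 0 \<le> 1 + - 1 * x\<^sup>2"
      by eventually_elim (simp add: abs_square_le_1)
    then have "((\<lambda>x::real. (1 + - 1 * x\<^sup>2) powr (p - 1 / 2 + 1)) \<longlongrightarrow> 0) (at_right (-1))"
      by (intro lim0) (auto intro!: tendsto_eq_intros)
    then show "((\<lambda>x. (1 + - 1 * (real_of_ereal x)\<^sup>2) powr (p - 1 / 2 + 1)) \<longlongrightarrow> 0) (at_right (ereal (-1)))"
      unfolding at_right_ereal filterlim_filtermap real_of_ereal.simps .
    have "\<forall>\<^sub>F x in at_left (1::real). x \<in> {0<..<1}" by (rule eventually_at_left_real) simp
    then have "\<forall>\<^sub>F x in at_left (1::real). 0 \<le> 1 + - 1 * x\<^sup>2"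
      by eventually_elim (simp add: abs_square_le_1)
    then have "((\<lambda>x::real. (1 + - 1 * x\<^sup>2) powr (p - 1 / 2 + 1)) \<longlongrightarrow> 0) (at_left 1)"
      by (intro lim0) (auto intro!: tendsto_eq_intros)
    then show "((\<lambda>x. (1 + - 1 * (real_of_ereal x)\<^sup>2) powr (p - 1 / 2 + 1)) \<longlongrightarrow> 0) (at_left (ereal 1))"
      unfolding at_left_ereal filterlim_filtermap real_of_ereal.simps .
  qed (use z in auto)
  have far: "norm (cauchy_transform M w) \<le> 2" if w: "2 \<le> norm w" for w
  proof -
    have "norm (cauchy_transform M w) \<le> (LINT x|lborel. norm (f x *\<^sub>R (1 / (w - of_real x))))"
      unfolding cauchy_transform_def by (subst integral_M, simp) (rule integral_norm_bound)
    also have "\<dots> \<le> (LINT x|lborel. f x)"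
    proof (rule integral_mono')
      show "integrable lborel f" by (rule f_integrable)
      fix x
      show "norm (f x *\<^sub>R (1 / (w - of_real x))) \<le> f x"
      proof (cases "\<bar>x\<bar> \<le> 1")
        case True
        then have "1 \<le> norm (w - of_real x)" using norm_triangle_ineq2[of w "of_real x"] w by simp
        moreover have "1 / n \<le> 1" if "1 \<le> n" for n :: real using that by (simp add: divide_le_eq)
        ultimately have "1 / norm (w - of_real x) \<le> 1" by blast
        then have "f x * (1 / norm (w - of_real x)) \<le> f x" using f_nonneg by (intro mult_left_le) auto
        then show ?thesis using f_nonneg[of x] by (simp add: norm_divide)
      next
        case False
        then have "f x = 0" by (auto simp: f_def indicator_def)
        then show ?thesis by simp
      qed
      show "0 \<le> f x" by (rule f_nonneg)
    qed
    also have "\<dots> = 1" by (rule f_integral)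
    finally show ?thesis by simp
  qed
  have "power_density M c (- 1) (p - 1 / 2)"
  proof
    show "c > 0" by (rule c)
    show "- 1 = (1::real) \<and> p - 1 / 2 < - 1 \<or> - 1 = (- 1::real) \<and> 1 / 2 \<le> p - 1 / 2" using p by simp
    show "((\<lambda>y. cauchy_transform M (\<i> * complex_of_real y)) \<longlongrightarrow> - \<i> * complex_of_real (pi * c)) (at_right 0)"
      using cauchy_transform_limit_0[OF bnd cont] by (simp add: f_def)
    show "\<exists>B. \<forall>w. 0 < Im w \<longrightarrow> d \<le> - Im (cauchy_transform M w) \<longrightarrow> cmod w \<le> B" if "0 < d" for d
      by (rule Im_cauchy_transform_small_at_infinity[OF lim that])
    show "\<forall>\<^sub>F w in nhds (complex_of_real x). 0 < Im w \<longrightarrow> - Im (cauchy_transform M w) < d"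
      if "1 + - 1 * x\<^sup>2 \<le> 0" "0 < d" for x d
      using Im_cauchy_transform_small_at_zero_of_density[OF cont out that(2)] that(1) by simp
    show "\<exists>B. \<forall>w. Im w < 0 \<longrightarrow> B \<le> cmod w \<longrightarrow> cmod (cauchy_transform M w) \<le> B"
      by (rule exI[of _ 2]) (use far in blast)
    show "deriv (cauchy_transform M) w \<noteq> 0" if "p - 1 / 2 < 0" for w using that p by simp
  qed (use p ode cauchy_transform_odd in auto)
  then show ?thesis by (simp add: M c_def B_def)
qed

theorem proposition7p2:
  shows "(\<forall>q::real. q \<in> {1<..2} \<union> (\<Union>n\<in>{1::nat..}. {2 * real n + 1/4 .. 2 * real n + 2}) \<longrightarrow>
            free_divisibility_indicator (t_dist q) = 1) \<and>
         (\<forall>p::real. p \<in> {1..} \<longrightarrow> free_divisibility_indicator (u_dist p) = 1)"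
proof (intro conjI allI impI)
  fix q :: real assume "q \<in> {1<..2} \<union> (\<Union>n\<in>{1::nat..}. {2 * real n + 1/4 .. 2 * real n + 2})"
  then have "q > 1" by auto
  then show "free_divisibility_indicator (t_dist q) = 1"
    by (rule power_density.free_divisibility_indicator_eq_1[OF power_density_t_dist])
next
  fix p :: real assume "p \<in> {1..}"
  then have "p \<ge> 1" by simp
  then show "free_divisibility_indicator (u_dist p) = 1"
    by (rule power_density.free_divisibility_indicator_eq_1[OF power_density_u_dist])
qed

end
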